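(* Let $n\in\mathbb{N}$ and let $T_n$ be the bounded operator on $L^2((0,\infty))$ given by $$(T_nf)(x) := \frac{1}{x^n}\int_0^x\int_0^{t_1}\cdots\int_0^{t_{n-1}} f(u)\,du\,dt_{n-1}\cdots dt_1,\qquad x\in(0,\infty).$$ Let $r_n(z)=z^n\prod_{k=1}^{n-1}(1+kz)^{-1}$. Then $T_n$ is normal and $$\sigma(T_n)=r_n(\sigma(T_1))=\big\{r_n(1+e^{i\theta}) \,\big|\, \theta\in[0,2\pi]\big\},$$ $$\sigma(T_n)=\sigma_{ac}(T_n),\qquad \sigma_p(T_n)=\sigma_{sc}(T_n)=\emptyset.$$
   Context: For a normal operator, $\sigma_{ac}$, $\sigma_{sc}$, $\sigma_p$ denote the absolutely continuous spectrum, singularly continuous spectrum, and the set of eigenvalues. *)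

theory Defs
  imports "HOL-Analysis.Analysis"
begin

text \<open>The Hilbert space L^2((0,\<infinity>)) is modelled by square-integrable complex functions
  on (0,\<infinity>) (Lebesgue measure), with all identities understood almost everywhere.
  Operators are maps on functions (real \<Rightarrow> complex).\<close>

abbreviation M0 :: "real measure" where
  "M0 \<equiv> lebesgue_on {0<..}"

definition L2 :: "(real \<Rightarrow> complex) set" where
  "L2 = {f. f \<in> borel_measurable M0 \<and> integrable M0 (\<lambda>x. (cmod (f x))\<^sup>2)}"

definition ae_eq :: "(real \<Rightarrow> complex) \<Rightarrow> (real \<Rightarrow> complex) \<Rightarrow> bool" where
  "ae_eq f g \<longleftrightarrow> (AE x in M0. f x = g x)"

definition ip :: "(real \<Rightarrow> complex) \<Rightarrow> (real \<Rightarrow> complex) \<Rightarrow> complex" where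
  "ip f g = (LINT x|M0. f x * cnj (g x))"

definition L2norm :: "(real \<Rightarrow> complex) \<Rightarrow> real" where
  "L2norm f = sqrt (LINT x|M0. (cmod (f x))\<^sup>2)"

type_synonym op = "(real \<Rightarrow> complex) \<Rightarrow> (real \<Rightarrow> complex)"

definition bounded_op_on :: "(real \<Rightarrow> complex) set \<Rightarrow> op \<Rightarrow> bool" where
  "bounded_op_on K T \<longleftrightarrow>
     (\<forall>f\<in>K. T f \<in> K) \<and>
     (\<forall>f\<in>K. \<forall>g\<in>K. ae_eq f g \<longrightarrow> ae_eq (T f) (T g)) \<and>
     (\<forall>f\<in>K. \<forall>g\<in>K. ae_eq (T (\<lambda>x. f x + g x)) (\<lambda>x. T f x + T g x)) \<and>
     (\<forall>f\<in>K. \<forall>c. ae_eq (T (\<lambda>x. c * f x)) (\<lambda>x. c * T f x)) \<and>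
     (\<exists>C. \<forall>f\<in>K. L2norm (T f) \<le> C * L2norm f)"

definition is_adjoint :: "op \<Rightarrow> op \<Rightarrow> bool" where
  "is_adjoint T A \<longleftrightarrow> bounded_op_on L2 A \<and>
     (\<forall>f\<in>L2. \<forall>g\<in>L2. ip (T f) g = ip f (A g))"

definition normal_op :: "op \<Rightarrow> bool" where
  "normal_op T \<longleftrightarrow> bounded_op_on L2 T \<and>
     (\<exists>A. is_adjoint T A \<and> (\<forall>f\<in>L2. ae_eq (T (A f)) (A (T f))))"

definition spectrum_on :: "(real \<Rightarrow> complex) set \<Rightarrow> op \<Rightarrow> complex set" where
  "spectrum_on K T = {l. \<not> (\<exists>S. bounded_op_on K S \<and>
       (\<forall>f\<in>K. ae_eq (S (\<lambda>x. T f x - l * f x)) f) \<and>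
       (\<forall>g\<in>K. ae_eq (\<lambda>x. T (S g) x - l * S g x) g))}"

definition point_spectrum :: "op \<Rightarrow> complex set" where
  "point_spectrum T = {l. \<exists>f\<in>L2. \<not> ae_eq f (\<lambda>x. 0) \<and> ae_eq (T f) (\<lambda>x. l * f x)}"

definition is_spectral_measure :: "op \<Rightarrow> (real \<Rightarrow> complex) \<Rightarrow> complex measure \<Rightarrow> bool" where
  "is_spectral_measure T f \<mu> \<longleftrightarrow>
     sets \<mu> = sets borel \<and> finite_measure \<mu> \<and>
     (\<exists>K. compact K \<and> emeasure \<mu> (UNIV - K) = 0) \<and>
     (\<forall>A. is_adjoint T A \<longrightarrow>
        (\<forall>j k::nat. (\<integral>z. z ^ j * cnj z ^ k \<partial>\<mu>) = ip ((T ^^ j) ((A ^^ k) f)) f))"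

definition spectral_measure :: "op \<Rightarrow> (real \<Rightarrow> complex) \<Rightarrow> complex measure" where
  "spectral_measure T f = (THE \<mu>. is_spectral_measure T f \<mu>)"

text \<open>Null sets of the one-dimensional Hausdorff measure on \<complex>.\<close>
definition H1_null :: "complex set \<Rightarrow> bool" where
  "H1_null A \<longleftrightarrow> (\<forall>\<epsilon>>0. \<exists>C :: nat \<Rightarrow> complex set.
      A \<subseteq> (\<Union>i. C i) \<and> (\<forall>i. bounded (C i)) \<and>
      summable (\<lambda>i. diameter (C i)) \<and> (\<Sum>i. diameter (C i)) < \<epsilon>)"

definition abs_cont_meas :: "complex measure \<Rightarrow> bool" where
  "abs_cont_meas \<mu> \<longleftrightarrow> (\<forall>A\<in>sets borel. H1_null A \<longrightarrow> emeasure \<mu> A = 0)"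

definition sing_cont_meas :: "complex measure \<Rightarrow> bool" where
  "sing_cont_meas \<mu> \<longleftrightarrow> (\<forall>z. emeasure \<mu> {z} = 0) \<and>
     (\<exists>A\<in>sets borel. H1_null A \<and> emeasure \<mu> (UNIV - A) = 0)"

definition H_ac :: "op \<Rightarrow> (real \<Rightarrow> complex) set" where
  "H_ac T = {f\<in>L2. abs_cont_meas (spectral_measure T f)}"

definition H_sc :: "op \<Rightarrow> (real \<Rightarrow> complex) set" where
  "H_sc T = {f\<in>L2. sing_cont_meas (spectral_measure T f)}"

definition sigma_ac :: "op \<Rightarrow> complex set" where
  "sigma_ac T = spectrum_on (H_ac T) T"

definition sigma_sc :: "op \<Rightarrow> complex set" where
  "sigma_sc T = spectrum_on (H_sc T) T"

definition Iop :: op where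
  "Iop g = (\<lambda>x. LINT t:{0..x}|lebesgue. g t)"

definition Tn :: "nat \<Rightarrow> op" where
  "Tn n f = (\<lambda>x. (Iop ^^ n) f x / of_real (x ^ n))"

definition rn :: "nat \<Rightarrow> complex \<Rightarrow> complex" where
  "rn n z = z ^ n * (\<Prod>k=1..n-1. inverse (1 + of_nat k * z))"

end

theory Submission
  imports Defs "HOL-Probability.Probability" "HOL-Computational_Algebra.Fundamental_Theorem_Algebra"
begin

text \<open>
  In the coordinate \<open>x = e^t\<close> the operator \<open>T_n\<close> is a convolution on the line, namely the composition
  of the resolvents \<open>f \<mapsto> x^{-k} \<integral>_0^x t^{k-1} f(t) dt\<close> for \<open>k = 1, \<dots>, n\<close>. The Mellin transform on
  the critical line therefore turns it into multiplication by
  \<open>m(\<tau>) = \<Prod>_{k<n} 1 / (k + 1/2 + i \<tau>)\<close>, which is \<open>r_n\<close> at the point \<open>1 / (1/2 + i \<tau>)\<close> of the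
  circle \<open>|z - 1| = 1\<close>. The isometry is only needed on a dense set of functions that the operators
  preserve: an operator on \<open>L2\<close> is determined by its symbol, which yields normality, adjoints and, by
  partial fractions, the resolvent off the closure of the range of \<open>m\<close>; wave packets concentrated near
  \<open>\<tau>\<close> are approximate eigenvectors. The spectral measure of \<open>f\<close> is the image under \<open>m\<close> of a measure
  with a Lebesgue density. Since \<open>|m|\<close> is strictly decreasing in \<open>|\<tau>|\<close> with inverse locally Lipschitz
  away from \<open>0\<close>, preimages of sets of vanishing one-dimensional Hausdorff measure are Lebesgue null,
  so all spectral measures are absolutely continuous and there are no eigenvalues.
\<close>

section \<open>The Fourier transform of bounded continuous integrable functions\<close>

text \<open>Operators are assembled from integral operators by composition, sums and scalars,
  identities between them are checked on symbols, and boundedness carries these identities from the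
  dense set to \<open>L2\<close>. A resolvent therefore has to be exhibited as such an operator;
  dividing a transform by \<open>m - l\<close> would not be enough. The spectral measure is a
  definite description, so existence and uniqueness have to be settled before the absolutely and
  singularly continuous subspaces can be described at all; uniqueness is a moment problem in
  \<open>z\<close> and \<open>cnj z\<close>. Because \<open>m (- \<tau>)\<close> is the conjugate of
  \<open>m \<tau>\<close>, the curve may cross itself on the real axis. Points are therefore
  compared on one half-line at a time, and only through the modulus. The spectral point
  \<open>0\<close> is the value of \<open>m\<close> at infinity. It is not attained, so it enters
  through approximate eigenvectors and is excluded from the resolvent construction. For
  \<open>n = 0\<close> the operator is the identity, which has an eigenvalue; hence
  \<open>n \<ge> 1\<close>.\<close>

definition fourier :: "(real \<Rightarrow> complex) \<Rightarrow> real \<Rightarrow> complex" where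
  "fourier g \<tau> = (LINT t|lborel. g t * iexp (- (\<tau> * t)))"

definition conv :: "(real \<Rightarrow> complex) \<Rightarrow> (real \<Rightarrow> complex) \<Rightarrow> real \<Rightarrow> complex" where
  "conv k g t = (LINT u|lborel. k u * g (t - u))"

text \<open>Integrability makes the transform a genuine function, boundedness adds square
  integrability, and continuity gives a meaning to the value at \<open>0\<close> in the inversion
  formula. Convolution with an integrable kernel preserves all three properties.\<close>

definition BCI :: "(real \<Rightarrow> complex) set" where
  "BCI = {g. continuous_on UNIV g \<and> bounded (range g) \<and> integrable lborel g}"

lemma BCI_I:
  assumes "continuous_on UNIV g" "\<And>t. cmod (g t) \<le> B" "integrable lborel g"
  shows "g \<in> BCI"
  using assms by (auto simp: BCI_def bounded_iff)

lemma BCI_D: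
  assumes "g \<in> BCI"
  shows "continuous_on UNIV g" "integrable lborel g" "g \<in> borel_measurable borel"
  using assms by (auto simp: BCI_def intro: borel_measurable_continuous_onI)

lemma BCI_bound:
  assumes "g \<in> BCI"
  obtains B where "B > 0" "\<And>t. cmod (g t) \<le> B"
proof -
  have "bounded (range g)" using assms by (auto simp: BCI_def)
  then obtain B where "B > 0" "\<And>t. cmod (g t) \<le> B" by (auto simp: bounded_pos)
  thus ?thesis by (rule that)
qed

lemma integrable_times_iexp:
  assumes "integrable lborel (g :: real \<Rightarrow> complex)"
  shows "integrable lborel (\<lambda>t. g t * iexp (- (\<tau> * t)))"
proof -
  have [measurable]: "g \<in> borel_measurable borel" using assms by (simp add: integrable_iff_bounded)
  show ?thesis
    by (rule Bochner_Integration.integrable_bound[OF assms]) (auto simp: norm_mult)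
qed

lemma fourier_norm_le:
  assumes "integrable lborel g"
  shows "cmod (fourier g \<tau>) \<le> (LINT t|lborel. cmod (g t))"
proof -
  have "cmod (fourier g \<tau>) \<le> (LINT t|lborel. cmod (g t * iexp (- (\<tau> * t))))"
    unfolding fourier_def by (rule integral_norm_bound)
  thus ?thesis by (simp add: norm_mult)
qed

lemma continuous_fourier:
  assumes "integrable lborel g"
  shows "continuous_on UNIV (fourier g)"
proof -
  have [measurable]: "g \<in> borel_measurable borel" using assms by (simp add: integrable_iff_bounded)
  have "isCont (fourier g) \<tau>" for \<tau>
    unfolding continuous_at_sequentially comp_def
  proof safe
    fix X assume X: "X \<longlonglongrightarrow> \<tau>"
    show "(\<lambda>n. fourier g (X n)) \<longlonglongrightarrow> fourier g \<tau>"
      unfolding fourier_def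
    proof (rule integral_dominated_convergence[where w="\<lambda>t. cmod (g t)"])
      show "AE t in lborel. (\<lambda>i. g t * iexp (- (X i * t))) \<longlonglongrightarrow> g t * iexp (- (\<tau> * t))"
        by (intro AE_I2 tendsto_intros X)
    qed (use assms in \<open>auto simp: norm_mult\<close>)
  qed
  thus ?thesis by (simp add: continuous_at_imp_continuous_on)
qed

section \<open>Gaussian summation and Fourier inversion at the origin\<close>

definition gauss :: "real \<Rightarrow> real" where
  "gauss x = exp (- x\<^sup>2 / 2)"

lemma gauss_pos: "gauss x > 0" and gauss_le_1: "gauss x \<le> 1" and gauss_0: "gauss 0 = 1"
  by (auto simp: gauss_def)

lemma continuous_on_gauss [continuous_intros]:
  "continuous_on A f \<Longrightarrow> continuous_on A (\<lambda>x. gauss (f x))"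
  unfolding gauss_def by (intro continuous_intros) auto

lemma measurable_gauss [measurable]: "gauss \<in> borel_measurable borel"
  unfolding gauss_def by measurable

lemma gauss_minus [simp]: "gauss (- x) = gauss x"
  by (simp add: gauss_def[abs_def])

text \<open>This is the characteristic function of the standard normal distribution, freed of its
  normalising factor.\<close>

lemma fourier_gaussian:
  "(LINT \<tau>|lborel. iexp (x * \<tau>) * gauss \<tau>) = sqrt (2 * pi) * gauss x"
proof -
  have "gauss x = char std_normal_distribution x"
    by (simp add: char_std_normal_distribution gauss_def)
  also have "\<dots> = (LINT \<tau>|lborel. std_normal_density \<tau> *\<^sub>R iexp (x * \<tau>))"
    unfolding char_def by (subst integral_density) auto
  also have "\<dots> = (LINT \<tau>|lborel. (1 / sqrt (2 * pi)) * (iexp (x * \<tau>) * gauss \<tau>))"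
    by (intro Bochner_Integration.integral_cong) (auto simp: std_normal_density_def scaleR_conv_of_real gauss_def)
  also have "\<dots> = (1 / sqrt (2 * pi)) * (LINT \<tau>|lborel. iexp (x * \<tau>) * gauss \<tau>)"
    by simp
  finally show ?thesis by (simp add: field_simps del: real_sqrt_mult)
qed

lemma integrable_gaussian: "integrable lborel (\<lambda>x::real. gauss x)"
proof -
  have "integrable lborel (\<lambda>x. sqrt (2 * pi) * (std_normal_density x * x ^ 0))"
    by (intro integrable_mult_right integrable_std_normal_moment)
  thus ?thesis by (simp add: std_normal_density_def gauss_def)
qed

lemma integral_gaussian: "(LINT x|lborel. gauss x) = sqrt (2 * pi)"
proof -
  have "complex_of_real (LINT x|lborel. gauss x) = of_real (sqrt (2 * pi))"
    using fourier_gaussian[of 0] by (simp add: gauss_0 flip: integral_complex_of_real)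
  thus ?thesis by (simp only: of_real_eq_iff)
qed

text \<open>Fubini moves the transform from \<open>h\<close> to the Gaussian, where it is explicit.
  As \<open>e\<close> tends to \<open>0\<close> the right-hand side averages \<open>h\<close> ever
  closer to \<open>0\<close>, while the weight \<open>gauss (e * \<tau>)\<close> tends to
  \<open>1\<close>: a summation method recovering \<open>h 0\<close>.\<close>

lemma fourier_gauss_duality:
  fixes h :: "real \<Rightarrow> complex"
  assumes h: "h \<in> BCI" and e: "e > 0"
  shows "(LINT \<tau>|lborel. fourier h \<tau> * gauss (e * \<tau>)) =
    sqrt (2 * pi) * (LINT u|lborel. h (e * u) * gauss u)"
proof -
  note [measurable] = BCI_D(3)[OF h]
  have hi: "integrable lborel h" by (rule BCI_D(2)[OF h])
  have ge: "integrable lborel (\<lambda>\<tau>. complex_of_real (gauss (e * \<tau>)))"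
    using lborel_integrable_real_affine_iff[of e gauss 0] e integrable_gaussian
    by (intro integrable_of_real) simp
  let ?F = "\<lambda>\<tau> t. h t * iexp (- (\<tau> * t)) * of_real (gauss (e * \<tau>))"
  have FI: "integrable (lborel \<Otimes>\<^sub>M lborel) (\<lambda>(\<tau>, t). ?F \<tau> t)"
  proof (rule lborel_pair.Fubini_integrable)
    show "AE \<tau> in lborel. integrable lborel (\<lambda>t. case (\<tau>, t) of (\<tau>, t) \<Rightarrow> ?F \<tau> t)"
      using integrable_times_iexp[OF hi] by auto
    have "(\<lambda>\<tau>. LINT t|lborel. norm (case (\<tau>, t) of (\<tau>, t) \<Rightarrow> ?F \<tau> t)) =
      (\<lambda>\<tau>. (LINT t|lborel. cmod (h t)) * gauss (e * \<tau>))"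
      by (simp add: norm_mult abs_of_pos[OF gauss_pos])
    thus "integrable lborel (\<lambda>\<tau>. LINT t|lborel. norm (case (\<tau>, t) of (\<tau>, t) \<Rightarrow> ?F \<tau> t))"
      using integrable_norm[OF ge] by (simp add: abs_of_pos[OF gauss_pos])
  qed measurable
  have "(LINT \<tau>|lborel. fourier h \<tau> * gauss (e * \<tau>)) = (LINT \<tau>|lborel. LINT t|lborel. ?F \<tau> t)"
    unfolding fourier_def by simp
  also have "\<dots> = (LINT t|lborel. LINT \<tau>|lborel. ?F \<tau> t)"
    by (rule lborel_pair.Fubini_integral[symmetric, OF FI])
  also have "\<dots> = (LINT t|lborel. h t * (sqrt (2 * pi) * gauss (t / e) / e))"
  proof (intro Bochner_Integration.integral_cong refl)
    fix t
    have "(LINT \<tau>|lborel. ?F \<tau> t) = h t * (LINT \<tau>|lborel. iexp (- (\<tau> * t)) * of_real (gauss (e * \<tau>)))"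
      by (simp add: mult.assoc)
    also have "(LINT \<tau>|lborel. iexp (- (\<tau> * t)) * of_real (gauss (e * \<tau>)))
      = (LINT \<tau>|lborel. (\<lambda>y. iexp (- (t / e) * y) * of_real (gauss y)) (0 + e * \<tau>))"
      using e by (intro Bochner_Integration.integral_cong) (auto simp: field_simps)
    also have "\<dots> = (1 / e) *\<^sub>R (LINT y|lborel. iexp (- (t / e) * y) * of_real (gauss y))"
      using e by (subst lborel_integral_real_affine[of e "\<lambda>y. iexp (- (t / e) * y) * of_real (gauss y)" 0]) auto
    also have "\<dots> = sqrt (2 * pi) * gauss (t / e) / e"
      by (subst fourier_gaussian) (simp add: scaleR_conv_of_real)
    finally show "(LINT \<tau>|lborel. ?F \<tau> t) = h t * (sqrt (2 * pi) * gauss (t / e) / e)" .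
  qed
  also have "\<dots> = e *\<^sub>R (LINT u|lborel. h (e * u) * (sqrt (2 * pi) * gauss u / e))"
    using e by (subst lborel_integral_real_affine[of e _ 0]) auto
  also have "\<dots> = (LINT u|lborel. sqrt (2 * pi) * (h (e * u) * gauss u))"
    using e by (subst integral_scaleR_right[symmetric])
       (auto intro!: Bochner_Integration.integral_cong simp: scaleR_conv_of_real field_simps)
  finally show ?thesis by simp
qed

text \<open>Fourier inversion at the origin: positivity of the transform replaces the integrability
  hypothesis, by monotone convergence in the Gaussian summation.\<close>

lemma fourier_inversion_zero:
  fixes h :: "real \<Rightarrow> complex" and p :: "real \<Rightarrow> real"
  assumes h: "h \<in> BCI" and pos: "\<And>\<tau>. fourier h \<tau> = of_real (p \<tau>)" "\<And>\<tau>. p \<tau> \<ge> 0"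
  shows "integrable lborel p" "complex_of_real (LINT \<tau>|lborel. p \<tau>) = 2 * pi * h 0"
proof -
  note [measurable] = BCI_D(3)[OF h]
  obtain B where B: "B > 0" "\<And>t. cmod (h t) \<le> B" using BCI_bound[OF h] by blast
  have hi: "integrable lborel h" by (rule BCI_D(2)[OF h])
  have "continuous_on UNIV (\<lambda>\<tau>. Re (fourier h \<tau>))"
    by (intro continuous_intros continuous_on_subset[OF continuous_fourier[OF hi]]) auto
  hence [measurable]: "p \<in> borel_measurable borel"
    by (auto simp: pos intro: borel_measurable_continuous_onI)
  let ?e = "\<lambda>n. 1 / real (Suc n)"
  have pb: "p \<tau> \<le> (LINT t|lborel. cmod (h t))" for \<tau>
    using fourier_norm_le[OF hi, of \<tau>] pos[of \<tau>] by simp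
  have lim: "(\<lambda>n. LINT u|lborel. h (?e n * u) * gauss u) \<longlonglongrightarrow>
     (LINT u|lborel. h 0 * gauss u)"
  proof (rule integral_dominated_convergence[where w="\<lambda>u. B * gauss u"])
    show "AE x in lborel. (\<lambda>i. h (?e i * x) * gauss x) \<longlonglongrightarrow> h 0 * gauss x"
    proof (intro AE_I2 tendsto_intros)
      fix x :: real
      have "(\<lambda>i. ?e i * x) \<longlonglongrightarrow> 0 * x"
        by (intro tendsto_intros LIMSEQ_Suc[OF lim_const_over_n])
      moreover have "isCont h 0" using BCI_D(1)[OF h] by (simp add: continuous_on_eq_continuous_at)
      ultimately show "(\<lambda>i. h (?e i * x)) \<longlonglongrightarrow> h 0"
        using isCont_tendsto_compose by fastforce
    qed
  qed (use B integrable_gaussian in \<open>auto simp: norm_mult less_imp_le[OF gauss_pos] intro!: mult_right_mono\<close>)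
  have val: "complex_of_real (LINT \<tau>|lborel. p \<tau> * gauss (?e n * \<tau>)) =
     sqrt (2 * pi) * (LINT u|lborel. h (?e n * u) * gauss u)" for n
    using fourier_gauss_duality[OF h, of "?e n"] unfolding pos
    by (simp flip: integral_complex_of_real del: of_nat_Suc)
  have "h 0 * (LINT u|lborel. complex_of_real (gauss u)) = h 0 * sqrt (2 * pi)"
    by (subst integral_complex_of_real) (simp add: integral_gaussian)
  hence "(\<lambda>n. complex_of_real (LINT \<tau>|lborel. p \<tau> * gauss (?e n * \<tau>))) \<longlonglongrightarrow>
     sqrt (2 * pi) * (h 0 * sqrt (2 * pi))"
    unfolding val using lim by (intro tendsto_intros) (simp add: integral_gaussian)
  \<comment> \<open>One factor \<open>sqrt (2 * pi)\<close> comes from the duality formula, the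
    other from the total mass of the Gaussian.\<close>
  moreover have "complex_of_real (sqrt (2 * pi)) * complex_of_real (sqrt (2 * pi)) = of_real (2 * pi)"
    by (simp only: of_real_mult[symmetric] real_sqrt_mult_self) simp
  hence "sqrt (2 * pi) * (h 0 * sqrt (2 * pi)) = 2 * pi * h 0"
    by (simp add: mult.left_commute del: real_sqrt_mult)
  ultimately have L: "(\<lambda>n. complex_of_real (LINT \<tau>|lborel. p \<tau> * gauss (?e n * \<tau>))) \<longlonglongrightarrow>
     2 * pi * h 0"
    by metis
  hence L2: "(\<lambda>n. LINT \<tau>|lborel. p \<tau> * gauss (?e n * \<tau>)) \<longlonglongrightarrow> Re (2 * pi * h 0)"
    using tendsto_Re by fastforce
  have int: "integrable lborel (\<lambda>\<tau>. p \<tau> * gauss (?e n * \<tau>))" for n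
  proof (rule Bochner_Integration.integrable_bound)
    show "integrable lborel (\<lambda>\<tau>. (LINT t|lborel. cmod (h t)) * gauss (?e n * \<tau>))"
      using lborel_integrable_real_affine_iff[of "?e n" "\<lambda>x. gauss x" 0] integrable_gaussian
      by (intro integrable_mult_right) simp
  qed (use pos pb order.trans[OF pos(2) pb] gauss_pos in \<open>auto simp: abs_mult less_imp_le intro!: mult_right_mono\<close>)
  have mono: "AE \<tau> in lborel. mono (\<lambda>n. p \<tau> * gauss (?e n * \<tau>))"
    by (intro AE_I2 monoI mult_left_mono pos)
       (auto simp: gauss_def power_mult_distrib power_divide intro!: mult_right_mono power_mono divide_left_mono)
  have AElim: "AE \<tau> in lborel. (\<lambda>n. p \<tau> * gauss (?e n * \<tau>)) \<longlonglongrightarrow> p \<tau>"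
  proof (intro AE_I2)
    fix \<tau>
    have "(\<lambda>i. ?e i * \<tau>) \<longlonglongrightarrow> 0 * \<tau>"
      by (intro tendsto_intros LIMSEQ_Suc[OF lim_const_over_n])
    moreover have "isCont gauss (0 * \<tau>)" by (simp add: gauss_def[abs_def])
    ultimately have "(\<lambda>n. gauss (?e n * \<tau>)) \<longlonglongrightarrow> gauss (0 * \<tau>)"
      by (rule isCont_tendsto_compose[rotated])
    hence "(\<lambda>n. p \<tau> * gauss (?e n * \<tau>)) \<longlonglongrightarrow> p \<tau> * gauss (0 * \<tau>)"
      by (rule tendsto_mult_left)
    thus "(\<lambda>n. p \<tau> * gauss (?e n * \<tau>)) \<longlonglongrightarrow> p \<tau>" by (simp add: gauss_0)
  qed
  show "integrable lborel p"
    by (rule integrable_monotone_convergence[OF int mono AElim L2]) simp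
  have "(LINT \<tau>|lborel. p \<tau>) = Re (2 * pi * h 0)"
    by (rule integral_monotone_convergence[OF int mono AElim L2]) simp
  moreover have "Im (2 * pi * h 0) = 0"
    using LIMSEQ_unique[OF tendsto_Im[OF L], of 0] by simp
  ultimately show "complex_of_real (LINT \<tau>|lborel. p \<tau>) = 2 * pi * h 0"
    by (simp add: complex_eq_iff)
qed

lemma measurable_cnj [measurable]: "cnj \<in> borel_measurable borel"
  by (intro borel_measurable_continuous_onI continuous_intros)

lemma continuous_on_UNIV_tendsto:
  assumes "continuous_on UNIV (g :: real \<Rightarrow> complex)" "X \<longlonglongrightarrow> t"
  shows "(\<lambda>n. g (X n)) \<longlonglongrightarrow> g t"
  using assms isCont_tendsto_compose[of t g X sequentially] by (simp add: continuous_on_eq_continuous_at)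

section \<open>Convolution and the Plancherel identity\<close>

text \<open>Continuity and boundedness are inherited from \<open>g\<close> alone, so
  \<open>k\<close> may have a jump, as the exponential kernels of the averaging operators
  do.\<close>

lemma fourier_conv:
  assumes k: "integrable lborel k" and g: "g \<in> BCI"
  shows "conv k g \<in> BCI" "fourier (conv k g) \<tau> = fourier k \<tau> * fourier g \<tau>"
proof -
  note [measurable] = BCI_D(3)[OF g]
  have [measurable]: "k \<in> borel_measurable borel" using k by (simp add: integrable_iff_bounded)
  obtain B where B: "B > 0" "\<And>t. cmod (g t) \<le> B" using BCI_bound[OF g] by blast
  have gi: "integrable lborel g" by (rule BCI_D(2)[OF g])
  have shift: "integrable lborel (\<lambda>t. g (t - u))" "(LINT t|lborel. cmod (g (t - u))) = (LINT t|lborel. cmod (g t))" for u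
    using lborel_integrable_real_affine_iff[of 1 g "-u"] gi lborel_integral_real_affine[of 1 "\<lambda>t. cmod (g t)" "-u"]
    by (simp_all add: add.commute)
  have ki: "integrable lborel (\<lambda>u. B * cmod (k u))" using k by simp
  have prod: "integrable (lborel \<Otimes>\<^sub>M lborel) (\<lambda>(u, t). k u * g (t - u))"
  proof (rule lborel_pair.Fubini_integrable)
    have "(\<lambda>u. LINT t|lborel. norm (case (u, t) of (u, t) \<Rightarrow> k u * g (t - u))) =
      (\<lambda>u. cmod (k u) * (LINT t|lborel. cmod (g t)))"
      by (simp add: norm_mult shift)
    thus "integrable lborel (\<lambda>u. LINT t|lborel. norm (case (u, t) of (u, t) \<Rightarrow> k u * g (t - u)))"
      using k by simp
  qed (use shift in auto)
  have cont: "isCont (conv k g) t" for t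
    unfolding continuous_at_sequentially comp_def
  proof safe
    fix X assume X: "X \<longlonglongrightarrow> t"
    show "(\<lambda>n. conv k g (X n)) \<longlonglongrightarrow> conv k g t"
      unfolding conv_def
    proof (rule integral_dominated_convergence[where w="\<lambda>u. B * cmod (k u)"])
      show "AE u in lborel. (\<lambda>i. k u * g (X i - u)) \<longlonglongrightarrow> k u * g (t - u)"
        by (intro AE_I2 tendsto_intros X continuous_on_UNIV_tendsto[OF BCI_D(1)[OF g]])
      show "AE u in lborel. norm (k u * g (X i - u)) \<le> B * cmod (k u)" for i
        using B by (intro AE_I2) (simp add: norm_mult mult.commute[of B] mult_left_mono)
    qed (use ki in auto)
  qed
  have bd: "cmod (conv k g t) \<le> (LINT u|lborel. B * cmod (k u))" for t
  proof -
    have "cmod (conv k g t) \<le> (LINT u|lborel. cmod (k u * g (t - u)))"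
      unfolding conv_def by (rule integral_norm_bound)
    also have "\<dots> \<le> (LINT u|lborel. B * cmod (k u))"
    proof (rule integral_mono[OF _ ki])
      show *: "cmod (k u * g (t - u)) \<le> B * cmod (k u)" for u
        using B by (simp add: norm_mult mult.commute[of B] mult_left_mono)
      show "integrable lborel (\<lambda>u. cmod (k u * g (t - u)))"
        by (rule Bochner_Integration.integrable_bound[OF ki]) (use * B in auto)
    qed
    finally show ?thesis .
  qed
  have "integrable lborel (\<lambda>t. LINT u|lborel. k u * g (t - u))"
    by (rule lborel_pair.integrable_snd[OF prod])
  hence int: "integrable lborel (conv k g)" by (simp add: conv_def[abs_def])
  show "conv k g \<in> BCI"
    by (rule BCI_I[OF continuous_at_imp_continuous_on bd int]) (use cont in auto)
  have prod': "integrable (lborel \<Otimes>\<^sub>M lborel) (\<lambda>(u, t). k u * g (t - u) * iexp (- (\<tau> * t)))"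
    by (rule Bochner_Integration.integrable_bound[OF prod]) (auto simp: norm_mult split: prod.splits)
  have "fourier (conv k g) \<tau> = (LINT t|lborel. LINT u|lborel. k u * g (t - u) * iexp (- (\<tau> * t)))"
    unfolding fourier_def conv_def by simp
  also have "\<dots> = (LINT u|lborel. LINT t|lborel. k u * g (t - u) * iexp (- (\<tau> * t)))"
    by (rule lborel_pair.Fubini_integral[OF prod'])
  also have "\<dots> = (LINT u|lborel. k u * iexp (- (\<tau> * u)) * fourier g \<tau>)"
  proof (intro Bochner_Integration.integral_cong refl)
    fix u
    have "(LINT t|lborel. k u * g (t - u) * iexp (- (\<tau> * t))) =
       (LINT t|lborel. k u * iexp (- (\<tau> * u)) * (g t * iexp (- (\<tau> * t))))"
      by (subst lborel_integral_real_affine[of 1 _ u])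
         (auto intro!: Bochner_Integration.integral_cong simp: algebra_simps mult_exp_exp)
    thus "(LINT t|lborel. k u * g (t - u) * iexp (- (\<tau> * t))) = k u * iexp (- (\<tau> * u)) * fourier g \<tau>"
      by (simp add: fourier_def)
  qed
  also have "\<dots> = fourier k \<tau> * fourier g \<tau>"
    by (simp add: fourier_def)
  finally show "fourier (conv k g) \<tau> = fourier k \<tau> * fourier g \<tau>" .
qed

lemma BCI_square_integrable:
  assumes g: "g \<in> BCI" and h: "h \<in> BCI"
  shows "integrable lborel (\<lambda>t. g t * cnj (h t))"
proof -
  note [measurable] = BCI_D(3)[OF g] BCI_D(3)[OF h]
  obtain B where B: "B > 0" "\<And>t. cmod (g t) \<le> B" using BCI_bound[OF g] by blast
  show ?thesis
  proof (rule Bochner_Integration.integrable_bound)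
    show "integrable lborel (\<lambda>t. B * cmod (h t))" using BCI_D(2)[OF h] by simp
  qed (use B in \<open>auto simp: norm_mult intro!: mult_right_mono\<close>)
qed

text \<open>The autocorrelation of \<open>g\<close>, its convolution with
  \<open>cnj (g (- t))\<close>, has the nonnegative transform \<open>|fourier g|^2\<close> and the
  value \<open>\<integral> |g|^2\<close> at \<open>0\<close>. Inversion at the origin applied to it
  is the assertion, including integrability.\<close>

theorem plancherel_BCI:
  assumes g: "g \<in> BCI"
  shows "integrable lborel (\<lambda>\<tau>. (cmod (fourier g \<tau>))\<^sup>2)"
    "(LINT \<tau>|lborel. (cmod (fourier g \<tau>))\<^sup>2) = 2 * pi * (LINT t|lborel. (cmod (g t))\<^sup>2)"
proof -
  note [measurable] = BCI_D(3)[OF g]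
  define k where "k = (\<lambda>t. cnj (g (- t)))"
  have gm: "integrable lborel (\<lambda>t. g (- t))"
    using lborel_integrable_real_affine_iff[of "-1" g 0] BCI_D(2)[OF g] by simp
  hence k: "integrable lborel k"
    unfolding k_def by simp
  have "fourier k \<tau> = cnj (fourier g \<tau>)" for \<tau>
  proof -
    have "fourier k \<tau> = (LINT t|lborel. cnj (g (-t) * iexp (- (\<tau> * (- t)))))"
      unfolding fourier_def k_def by (intro Bochner_Integration.integral_cong) (auto simp: exp_cnj)
    also have "\<dots> = cnj (LINT t|lborel. g (-t) * iexp (- (\<tau> * (- t))))"
      by (rule Bochner_Integration.integral_cnj)
    also have "(LINT t|lborel. g (-t) * iexp (- (\<tau> * (- t)))) = fourier g \<tau>"
      unfolding fourier_def by (subst (2) lborel_integral_real_affine[of "-1" _ 0]) auto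
    finally show ?thesis .
  qed
  hence F: "fourier (conv k g) \<tau> = of_real ((cmod (fourier g \<tau>))\<^sup>2)" for \<tau>
    using fourier_conv(2)[OF k g] by (simp add: complex_norm_square mult.commute del: of_real_power)
  note inv = fourier_inversion_zero[OF fourier_conv(1)[OF k g] F zero_le_power2]
  show "integrable lborel (\<lambda>\<tau>. (cmod (fourier g \<tau>))\<^sup>2)" by (rule inv(1))
  have "conv k g 0 = (LINT u|lborel. cnj (g (- u)) * g (- u))"
    by (simp add: conv_def k_def)
  also have "\<dots> = (LINT u|lborel. cnj (g u) * g u)"
    by (subst (2) lborel_integral_real_affine[of "-1" _ 0]) auto
  also have "\<dots> = (LINT u|lborel. complex_of_real ((cmod (g u))\<^sup>2))"
    by (simp add: complex_norm_square mult.commute del: of_real_power)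
  also have "\<dots> = of_real (LINT u|lborel. (cmod (g u))\<^sup>2)" by (rule integral_complex_of_real)
  finally have "complex_of_real (LINT \<tau>|lborel. (cmod (fourier g \<tau>))\<^sup>2) = of_real (2 * pi * (LINT t|lborel. (cmod (g t))\<^sup>2))"
    using inv(2) by (simp del: of_real_power)
  thus "(LINT \<tau>|lborel. (cmod (fourier g \<tau>))\<^sup>2) = 2 * pi * (LINT t|lborel. (cmod (g t))\<^sup>2)"
    by (simp only: of_real_eq_iff)
qed

section \<open>The Mellin transform as an isometry of \<open>L2\<close>\<close>

lemma integrable_mult_square:
  fixes f g :: "'a \<Rightarrow> complex"
  assumes [measurable]: "f \<in> borel_measurable M" "g \<in> borel_measurable M"
    and "integrable M (\<lambda>x. (cmod (f x))\<^sup>2)" "integrable M (\<lambda>x. (cmod (g x))\<^sup>2)"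
  shows "integrable M (\<lambda>x. cmod (f x) * cmod (g x))" "integrable M (\<lambda>x. f x * cnj (g x))"
proof -
  have *: "cmod (f x) * cmod (g x) \<le> (cmod (f x))\<^sup>2 + (cmod (g x))\<^sup>2" for x
    using sum_squares_bound[of "cmod (f x)" "cmod (g x)"] mult_nonneg_nonneg[OF norm_ge_zero[of "f x"] norm_ge_zero[of "g x"]]
    by linarith
  have i: "integrable M (\<lambda>x. (cmod (f x))\<^sup>2 + (cmod (g x))\<^sup>2)" using assms by simp
  show "integrable M (\<lambda>x. cmod (f x) * cmod (g x))"
    by (rule Bochner_Integration.integrable_bound[OF i]) (use * in auto)
  show "integrable M (\<lambda>x. f x * cnj (g x))"
    by (rule Bochner_Integration.integrable_bound[OF i]) (use * in \<open>auto simp: norm_mult\<close>)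
qed

lemma Cauchy_Schwarz_integral:
  fixes f g :: "'a \<Rightarrow> complex"
  assumes [measurable]: "f \<in> borel_measurable M" "g \<in> borel_measurable M"
    and i: "integrable M (\<lambda>x. (cmod (f x))\<^sup>2)" "integrable M (\<lambda>x. (cmod (g x))\<^sup>2)"
  shows "(LINT x|M. cmod (f x) * cmod (g x)) \<le>
    sqrt (LINT x|M. (cmod (f x))\<^sup>2) * sqrt (LINT x|M. (cmod (g x))\<^sup>2)"
proof -
  have "(\<integral>\<^sup>+x. ennreal (cmod (f x)) * ennreal (cmod (g x)) \<partial>M)\<^sup>2 \<le>
      (\<integral>\<^sup>+x. ennreal (cmod (f x)) ^ 2 \<partial>M) * (\<integral>\<^sup>+x. ennreal (cmod (g x)) ^ 2 \<partial>M)"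
    by (rule Cauchy_Schwarz_nn_integral) measurable
  hence "(\<integral>\<^sup>+x. ennreal (cmod (f x) * cmod (g x)) \<partial>M)\<^sup>2 \<le>
      (\<integral>\<^sup>+x. ennreal ((cmod (f x))\<^sup>2) \<partial>M) * (\<integral>\<^sup>+x. ennreal ((cmod (g x))\<^sup>2) \<partial>M)"
    by (simp add: ennreal_mult ennreal_power)
  hence "(LINT x|M. cmod (f x) * cmod (g x))\<^sup>2 \<le> (LINT x|M. (cmod (f x))\<^sup>2) * (LINT x|M. (cmod (g x))\<^sup>2)"
    using i integrable_mult_square(1)[OF assms]
    by (simp add: nn_integral_eq_integral ennreal_power ennreal_mult[symmetric] ennreal_le_iff)
  hence "sqrt ((LINT x|M. cmod (f x) * cmod (g x))\<^sup>2) \<le> sqrt ((LINT x|M. (cmod (f x))\<^sup>2) * (LINT x|M. (cmod (g x))\<^sup>2))"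
    by (rule real_sqrt_le_mono)
  thus ?thesis by (simp add: real_sqrt_mult)
qed

lemma L2_I: "f \<in> borel_measurable M0 \<Longrightarrow> integrable M0 (\<lambda>x. (cmod (f x))\<^sup>2) \<Longrightarrow> f \<in> L2"
  and L2_meas: "f \<in> L2 \<Longrightarrow> f \<in> borel_measurable M0"
  and L2_int: "f \<in> L2 \<Longrightarrow> integrable M0 (\<lambda>x. (cmod (f x))\<^sup>2)"
  by (auto simp: L2_def)

lemma L2_cmult: "f \<in> L2 \<Longrightarrow> (\<lambda>x. c * f x) \<in> L2"
  by (auto simp: L2_def norm_mult power_mult_distrib)

lemma L2_add:
  assumes "f \<in> L2" "g \<in> L2"
  shows "(\<lambda>x. f x + g x) \<in> L2"
proof (rule L2_I)
  note [measurable] = assms[THEN L2_meas]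
  show "(\<lambda>x. f x + g x) \<in> borel_measurable M0" by measurable
  show "integrable M0 (\<lambda>x. (cmod (f x + g x))\<^sup>2)"
  proof (rule Bochner_Integration.integrable_bound)
    show "integrable M0 (\<lambda>x. 2 * (cmod (f x))\<^sup>2 + 2 * (cmod (g x))\<^sup>2)" using assms[THEN L2_int] by simp
    have "(cmod (f x + g x))\<^sup>2 \<le> 2 * (cmod (f x))\<^sup>2 + 2 * (cmod (g x))\<^sup>2" for x
    proof -
      have "(cmod (f x + g x))\<^sup>2 \<le> (cmod (f x) + cmod (g x))\<^sup>2" by (intro power_mono norm_triangle_ineq) auto
      also have "\<dots> \<le> 2 * (cmod (f x))\<^sup>2 + 2 * (cmod (g x))\<^sup>2"
        using sum_squares_bound[of "cmod (f x)" "cmod (g x)"] by (simp add: power2_sum)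
      finally show ?thesis .
    qed
    thus "AE x in M0. norm ((cmod (f x + g x))\<^sup>2) \<le> norm (2 * (cmod (f x))\<^sup>2 + 2 * (cmod (g x))\<^sup>2)"
      by (intro AE_I2) (simp add: order.trans)
  qed measurable
qed

lemma L2_diff: "f \<in> L2 \<Longrightarrow> g \<in> L2 \<Longrightarrow> (\<lambda>x. f x - g x) \<in> L2"
  using L2_add[of f "\<lambda>x. -1 * g x"] L2_cmult[of g "-1"] by simp

lemma L2_zero: "(\<lambda>x. 0) \<in> L2" by (simp add: L2_def)

lemma L2norm_nonneg: "L2norm f \<ge> 0" by (simp add: L2norm_def)

lemma L2norm_sq: "(L2norm f)\<^sup>2 = (LINT x|M0. (cmod (f x))\<^sup>2)" by (simp add: L2norm_def)

lemma L2norm_cmult: "L2norm (\<lambda>x. c * f x) = cmod c * L2norm f"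
  by (simp add: L2norm_def norm_mult power_mult_distrib real_sqrt_mult)

lemma L2_mult_integrable:
  assumes "f \<in> L2" "g \<in> L2"
  shows "integrable M0 (\<lambda>x. f x * cnj (g x))"
  using assms by (intro integrable_mult_square) (auto simp: L2_def)

lemma ip_bound:
  assumes "f \<in> L2" "g \<in> L2"
  shows "cmod (ip f g) \<le> L2norm f * L2norm g"
proof -
  have "cmod (ip f g) \<le> (LINT x|M0. cmod (f x * cnj (g x)))"
    unfolding ip_def by (rule integral_norm_bound)
  also have "\<dots> \<le> L2norm f * L2norm g"
    unfolding L2norm_def using assms
    by (simp add: norm_mult) (intro Cauchy_Schwarz_integral, auto simp: L2_def)
  finally show ?thesis .
qed

lemma ip_self: "ip f f = of_real ((L2norm f)\<^sup>2)"
  unfolding ip_def L2norm_sq integral_complex_of_real[symmetric]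
  by (simp add: complex_norm_square del: of_real_power)

lemma ip_add_left: "f \<in> L2 \<Longrightarrow> g \<in> L2 \<Longrightarrow> h \<in> L2 \<Longrightarrow> ip (\<lambda>x. f x + g x) h = ip f h + ip g h"
  unfolding ip_def by (simp add: distrib_right L2_mult_integrable)

lemma ip_diff_left: "f \<in> L2 \<Longrightarrow> g \<in> L2 \<Longrightarrow> h \<in> L2 \<Longrightarrow> ip (\<lambda>x. f x - g x) h = ip f h - ip g h"
  unfolding ip_def by (simp add: left_diff_distrib L2_mult_integrable)

lemma ip_diff_right: "f \<in> L2 \<Longrightarrow> g \<in> L2 \<Longrightarrow> h \<in> L2 \<Longrightarrow> ip h (\<lambda>x. f x - g x) = ip h f - ip h g"
  unfolding ip_def by (simp add: right_diff_distrib L2_mult_integrable)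

lemma ip_cmult_left: "ip (\<lambda>x. c * f x) h = c * ip f h"
  unfolding ip_def by (simp add: mult.assoc)

lemma L2norm_triangle:
  assumes "f \<in> L2" "g \<in> L2"
  shows "L2norm (\<lambda>x. f x + g x) \<le> L2norm f + L2norm g"
proof (rule power2_le_imp_le)
  have h: "(\<lambda>x. f x + g x) \<in> L2" by (rule L2_add[OF assms])
  have "complex_of_real ((L2norm (\<lambda>x. f x + g x))\<^sup>2) = ip (\<lambda>x. f x + g x) (\<lambda>x. f x + g x)"
    by (rule ip_self[symmetric])
  also have "\<dots> = ip f (\<lambda>x. f x + g x) + ip g (\<lambda>x. f x + g x)"
    by (rule ip_add_left[OF assms h])
  finally have "cmod (complex_of_real ((L2norm (\<lambda>x. f x + g x))\<^sup>2)) \<le>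
      cmod (ip f (\<lambda>x. f x + g x)) + cmod (ip g (\<lambda>x. f x + g x))"
    using norm_triangle_ineq by metis
  hence "(L2norm (\<lambda>x. f x + g x))\<^sup>2 \<le> cmod (ip f (\<lambda>x. f x + g x)) + cmod (ip g (\<lambda>x. f x + g x))"
    unfolding norm_of_real by simp
  also have "\<dots> \<le> (L2norm f + L2norm g) * L2norm (\<lambda>x. f x + g x)"
    using ip_bound[OF assms(1) h] ip_bound[OF assms(2) h] by (simp add: distrib_right)
  finally have *: "(L2norm (\<lambda>x. f x + g x))\<^sup>2 \<le> (L2norm f + L2norm g) * L2norm (\<lambda>x. f x + g x)" .
  show "(L2norm (\<lambda>x. f x + g x))\<^sup>2 \<le> (L2norm f + L2norm g)\<^sup>2"
  proof (cases "L2norm (\<lambda>x. f x + g x) = 0")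
    case False
    hence "L2norm (\<lambda>x. f x + g x) > 0" using L2norm_nonneg[of "\<lambda>x. f x + g x"] by simp
    hence "L2norm (\<lambda>x. f x + g x) \<le> L2norm f + L2norm g" using * by (simp add: power2_eq_square)
    thus ?thesis by (intro power_mono L2norm_nonneg)
  qed simp
qed (auto intro!: add_nonneg_nonneg L2norm_nonneg)

lemma L2norm_diff_triangle:
  assumes "f \<in> L2" "g \<in> L2" "h \<in> L2"
  shows "L2norm (\<lambda>x. f x - h x) \<le> L2norm (\<lambda>x. f x - g x) + L2norm (\<lambda>x. g x - h x)"
  using L2norm_triangle[OF L2_diff[OF assms(1,2)] L2_diff[OF assms(2,3)]] by simp

lemma L2norm_minus_commute: "L2norm (\<lambda>x. f x - g x) = L2norm (\<lambda>x. g x - f x)"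
  unfolding L2norm_def by (simp add: norm_minus_commute)

lemma L2norm_eq_0_iff:
  assumes "f \<in> L2"
  shows "L2norm f = 0 \<longleftrightarrow> ae_eq f (\<lambda>x. 0)"
  unfolding L2norm_def ae_eq_def using L2_int[OF assms]
  by (simp add: integral_nonneg_eq_0_iff_AE)

lemma ae_eq_refl [simp]: "ae_eq f f" by (simp add: ae_eq_def)
lemma ae_eq_sym: "ae_eq f g \<Longrightarrow> ae_eq g f" unfolding ae_eq_def by (auto elim: eventually_mono)
lemma ae_eq_trans: "ae_eq f g \<Longrightarrow> ae_eq g h \<Longrightarrow> ae_eq f h"
  unfolding ae_eq_def by (auto elim: eventually_elim2)
lemma ae_eq_I: "(\<And>x. x > 0 \<Longrightarrow> f x = g x) \<Longrightarrow> ae_eq f g"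
  unfolding ae_eq_def by (intro AE_I2) auto
lemma ae_eq_diff_iff: "ae_eq (\<lambda>x. f x - g x) (\<lambda>x. 0) \<longleftrightarrow> ae_eq f g"
  by (simp add: ae_eq_def)

lemma ae_eq_iff_L2norm:
  assumes "f \<in> L2" "g \<in> L2"
  shows "ae_eq f g \<longleftrightarrow> L2norm (\<lambda>x. f x - g x) = 0"
  using L2norm_eq_0_iff[OF L2_diff[OF assms]] by (simp add: ae_eq_diff_iff)

lemma ip_cong_ae:
  assumes "f \<in> L2" "g \<in> L2" "f' \<in> L2" "g' \<in> L2" "ae_eq f f'" "ae_eq g g'"
  shows "ip f g = ip f' g'"
  unfolding ip_def
proof (rule integral_cong_AE)
  note [measurable] = assms(1-4)[THEN L2_meas]
  show "(\<lambda>x. f x * cnj (g x)) \<in> borel_measurable M0" "(\<lambda>x. f' x * cnj (g' x)) \<in> borel_measurable M0"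
    by measurable
  show "AE x in M0. f x * cnj (g x) = f' x * cnj (g' x)"
    using assms(5,6) unfolding ae_eq_def by eventually_elim simp
qed

lemma L2norm_cong_ae:
  assumes "f \<in> L2" "f' \<in> L2" "ae_eq f f'"
  shows "L2norm f = L2norm f'"
proof -
  have "(L2norm f)\<^sup>2 = (L2norm f')\<^sup>2"
    using ip_cong_ae[OF assms(1,1,2,2,3,3)] unfolding ip_self by (simp only: of_real_eq_iff)
  thus ?thesis using L2norm_nonneg by (simp add: power2_eq_iff_nonneg)
qed

lemma ae_eq_from_ip:
  assumes "f \<in> L2" "g \<in> L2" "\<And>h. h \<in> L2 \<Longrightarrow> ip h f = ip h g"
  shows "ae_eq f g"
proof -
  have "ip (\<lambda>x. f x - g x) (\<lambda>x. f x - g x) = 0"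
    using assms L2_diff[OF assms(1,2)] by (simp add: ip_diff_right)
  hence "L2norm (\<lambda>x. f x - g x) = 0" unfolding ip_self by simp
  thus ?thesis using assms by (simp add: ae_eq_iff_L2norm)
qed

section \<open>The substitution \<open>x = exp t\<close>\<close>

text \<open>Substitution is applied on the compact intervals \<open>[-n, n]\<close>, whose images
  under \<open>exp\<close> exhaust the half-line; monotone convergence on both sides removes the
  truncation.\<close>

lemma nn_integral_exp_subst:
  assumes [measurable]: "A \<in> sets borel"
  shows "(\<integral>\<^sup>+x. indicator {0<..} x * indicator A x \<partial>lborel) =
    (\<integral>\<^sup>+t. ennreal (exp t) * indicator A (exp t) \<partial>lborel)"
proof -
  have S: "(\<integral>\<^sup>+x. ennreal (indicator A x * indicator {exp (- real n)..exp (real n)} x) \<partial>lborel) =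
      (\<integral>\<^sup>+t. ennreal (indicator A (exp t) * exp t * indicator {- real n..real n} t) \<partial>lborel)" for n
    by (rule nn_integral_substitution[of exp "- real n" "real n" "indicator A" exp])
       (auto intro!: derivative_eq_intros continuous_intros simp: set_borel_measurable_def)
  have 1: "(\<integral>\<^sup>+x. indicator {0<..} x * indicator A x \<partial>lborel) =
    (\<integral>\<^sup>+x. (SUP n. ennreal (indicator A x * indicator {exp (- real n)..exp (real n)} x)) \<partial>lborel)"
  proof (intro nn_integral_cong)
    fix x :: real
    show "indicator {0<..} x * indicator A x = (SUP n. ennreal (indicator A x * indicator {exp (- real n)..exp (real n)} x))"
    proof (cases "x > 0 \<and> x \<in> A")
      case True
      obtain N where N: "\<bar>ln x\<bar> \<le> real N" using real_arch_simple by blast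
      hence "- real N \<le> ln x" "ln x \<le> real N" by auto
      hence "exp (- real N) \<le> exp (ln x)" "exp (ln x) \<le> exp (real N)" by auto
      hence "(1::ennreal) \<le> (SUP n. ennreal (indicator A x * indicator {exp (- real n)..exp (real n)} x))"
        using True by (intro SUP_upper2[of N]) auto
      moreover have "(SUP n. ennreal (indicator A x * indicator {exp (- real n)..exp (real n)} x)) \<le> 1"
        by (intro SUP_least) (auto simp: indicator_def)
      ultimately show ?thesis using True by (auto intro: antisym)
    next
      case False
      have "x \<ge> exp (- real n) \<Longrightarrow> x > 0" for n by (rule less_le_trans[OF exp_gt_zero])
      hence "indicator A x * indicator {exp (- real n)..exp (real n)} x = (0::real)" for n
        using False by (auto simp: indicator_def)
      thus ?thesis using False by (simp only: ennreal_0 SUP_const) (auto simp: indicator_def)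
    qed
  qed
  have 2: "(\<integral>\<^sup>+t. ennreal (exp t) * indicator A (exp t) \<partial>lborel) =
    (\<integral>\<^sup>+t. (SUP n. ennreal (indicator A (exp t) * exp t * indicator {- real n..real n} t)) \<partial>lborel)"
  proof (intro nn_integral_cong)
    fix t :: real
    obtain N where N: "\<bar>t\<bar> \<le> real N" using real_arch_simple by blast
    show "ennreal (exp t) * indicator A (exp t) = (SUP n. ennreal (indicator A (exp t) * exp t * indicator {- real n..real n} t))"
    proof (rule antisym)
      show "ennreal (exp t) * indicator A (exp t) \<le> (SUP n. ennreal (indicator A (exp t) * exp t * indicator {- real n..real n} t))"
        using N by (intro SUP_upper2[of N]) (auto simp: indicator_def)
    qed (intro SUP_least, auto simp: indicator_def)
  qed
  have "incseq (\<lambda>n x. ennreal (indicator A x * indicator {exp (- real n)..exp (real n)} x))"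
  proof (intro monoI le_funI ennreal_leI mult_left_mono)
    fix m n :: nat and x :: real assume "m \<le> n"
    hence "exp (- real n) \<le> exp (- real m)" "exp (real m) \<le> exp (real n)" by auto
    thus "indicator {exp (- real m)..exp (real m)} x \<le> (indicator {exp (- real n)..exp (real n)} x :: real)"
      using order_trans[of "exp (- real n)" "exp (- real m)" x] order_trans[of x "exp (real m)" "exp (real n)"]
      by (auto simp: indicator_def)
  qed auto
  moreover have "incseq (\<lambda>n t. ennreal (indicator A (exp t) * exp t * indicator {- real n..real n} t))"
    by (intro monoI le_funI ennreal_leI mult_left_mono) (auto simp: indicator_def)
  ultimately show ?thesis
    unfolding 1 2 by (subst (1 2) nn_integral_monotone_convergence_SUP) (simp_all add: S)
qed

lemma distr_exp:
  "distr (density lborel (\<lambda>t. ennreal (exp t))) borel exp = density lborel (indicator {0<..})"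
proof (rule measure_eqI)
  fix A assume "A \<in> sets (distr (density lborel (\<lambda>t. ennreal (exp t))) borel exp)"
  hence [measurable]: "A \<in> sets borel" by simp
  have "exp -` A \<in> sets borel" using measurable_sets_borel[of exp borel A] by simp
  thus "emeasure (distr (density lborel (\<lambda>t. ennreal (exp t))) borel exp) A = emeasure (density lborel (indicator {0<..})) A"
    using nn_integral_exp_subst[of A]
    by (subst emeasure_distr) (auto simp: emeasure_density indicator_vimage[symmetric] indicator_def vimage_def)
qed simp

lemma M0_exp_subst:
  fixes \<phi> :: "real \<Rightarrow> 'b::{banach, second_countable_topology}"
  assumes [measurable]: "\<phi> \<in> borel_measurable borel"
  shows "integrable M0 \<phi> \<longleftrightarrow> integrable lborel (\<lambda>t. exp t *\<^sub>R \<phi> (exp t))"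
    "integral\<^sup>L M0 \<phi> = (LINT t|lborel. exp t *\<^sub>R \<phi> (exp t))"
proof -
  have ind: "indicator {0<..} = (\<lambda>x::real. ennreal (indicator {0<..} x))" by (auto simp: indicator_def)
  have "integrable M0 \<phi> \<longleftrightarrow> integrable lborel (\<lambda>x. indicator {0<..} x *\<^sub>R \<phi> x)"
    by (simp add: integrable_restrict_space integrable_completion)
  also have "\<dots> \<longleftrightarrow> integrable (density lborel (indicator {0<..})) \<phi>"
    unfolding ind by (subst integrable_density) auto
  also have "\<dots> \<longleftrightarrow> integrable lborel (\<lambda>t. exp t *\<^sub>R \<phi> (exp t))"
    unfolding distr_exp[symmetric] by (subst integrable_distr_eq) (auto simp: integrable_density)
  finally show "integrable M0 \<phi> \<longleftrightarrow> integrable lborel (\<lambda>t. exp t *\<^sub>R \<phi> (exp t))" .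
  have "integral\<^sup>L M0 \<phi> = (LINT x|lborel. indicator {0<..} x *\<^sub>R \<phi> x)"
    by (simp add: integral_restrict_space integral_completion)
  also have "\<dots> = (LINT x|density lborel (indicator {0<..}). \<phi> x)"
    unfolding ind by (subst integral_density) auto
  also have "\<dots> = (LINT t|lborel. exp t *\<^sub>R \<phi> (exp t))"
    unfolding distr_exp[symmetric] by (subst integral_distr) (auto simp: integral_density)
  finally show "integral\<^sup>L M0 \<phi> = (LINT t|lborel. exp t *\<^sub>R \<phi> (exp t))" .
qed

section \<open>The core and the Mellin transform on it\<close>

text \<open>The weight \<open>exp (t / 2)\<close> is the square root of the Jacobian of
  \<open>x = exp t\<close>, so that \<open>lift\<close> preserves \<open>L2\<close> norms.\<close>

definition lift :: "(real \<Rightarrow> complex) \<Rightarrow> real \<Rightarrow> complex" where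
  "lift f t = f (exp t) * of_real (exp (t / 2))"

definition core :: "(real \<Rightarrow> complex) set" where
  "core = {f. lift f \<in> BCI}"

text \<open>This is the classical integral of \<open>x powr (s - 1) * f x\<close> over the half-line
  at \<open>s = 1/2 - \<i> * \<tau>\<close>.\<close>

definition mellin :: "(real \<Rightarrow> complex) \<Rightarrow> real \<Rightarrow> complex" where
  "mellin f = fourier (lift f)"

lemma lift_inverse: "x > 0 \<Longrightarrow> f x = lift f (ln x) / of_real (sqrt x)"
proof -
  assume x: "x > 0"
  have "exp (ln x / 2) = sqrt x" using x by (simp add: ln_sqrt[symmetric])
  thus ?thesis using x by (simp add: lift_def)
qed

lemma lift_linear:
  "lift (\<lambda>x. f x + g x) = (\<lambda>t. lift f t + lift g t)"
  "lift (\<lambda>x. f x - g x) = (\<lambda>t. lift f t - lift g t)"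
  "lift (\<lambda>x. c * f x) = (\<lambda>t. c * lift f t)"
  by (auto simp: lift_def algebra_simps)

lemma BCI_linear:
  assumes "f \<in> BCI" "g \<in> BCI"
  shows "(\<lambda>t. f t + g t) \<in> BCI" "(\<lambda>t. c * f t) \<in> BCI"
proof -
  obtain A B where AB: "\<And>t. cmod (f t) \<le> A" "\<And>t. cmod (g t) \<le> B"
    using BCI_bound[OF assms(1)] BCI_bound[OF assms(2)] by metis
  show "(\<lambda>t. f t + g t) \<in> BCI"
    using assms by (intro BCI_I[where B="A+B"] continuous_intros norm_triangle_mono AB) (auto dest: BCI_D)
  show "(\<lambda>t. c * f t) \<in> BCI"
    using assms by (intro BCI_I[where B="cmod c * A"] continuous_intros) (auto dest: BCI_D simp: norm_mult AB mult_left_mono)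
qed

lemma core_add: "f \<in> core \<Longrightarrow> g \<in> core \<Longrightarrow> (\<lambda>x. f x + g x) \<in> core"
  and core_cmult: "f \<in> core \<Longrightarrow> (\<lambda>x. c * f x) \<in> core"
  by (auto simp: core_def lift_linear intro: BCI_linear)

lemma core_diff: "f \<in> core \<Longrightarrow> g \<in> core \<Longrightarrow> (\<lambda>x. f x - g x) \<in> core"
  using core_add[of f "\<lambda>x. -1 * g x"] core_cmult[of g "-1"] by simp

lemma fourier_linear:
  assumes "integrable lborel f" "integrable lborel g"
  shows "fourier (\<lambda>t. f t + g t) \<tau> = fourier f \<tau> + fourier g \<tau>"
    "fourier (\<lambda>t. c * f t) \<tau> = c * fourier f \<tau>"
  using assms[THEN integrable_times_iexp, of \<tau>] unfolding fourier_def by (simp_all add: distrib_right mult.assoc)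

lemma core_lift: "f \<in> core \<Longrightarrow> lift f \<in> BCI" by (simp add: core_def)

lemma mellin_add: "f \<in> core \<Longrightarrow> g \<in> core \<Longrightarrow> mellin (\<lambda>x. f x + g x) \<tau> = mellin f \<tau> + mellin g \<tau>"
  unfolding mellin_def lift_linear by (intro fourier_linear BCI_D(2) core_lift)

lemma mellin_cmult: "f \<in> core \<Longrightarrow> mellin (\<lambda>x. c * f x) \<tau> = c * mellin f \<tau>"
  unfolding mellin_def lift_linear by (rule fourier_linear(2)[where g="lift f"]) (auto intro: BCI_D(2) core_lift)

lemma mellin_diff: "f \<in> core \<Longrightarrow> g \<in> core \<Longrightarrow> mellin (\<lambda>x. f x - g x) \<tau> = mellin f \<tau> - mellin g \<tau>"
  using mellin_add[of f "\<lambda>x. -1 * g x" \<tau>] core_cmult[of g "-1"] mellin_cmult[of g "-1" \<tau>] by simp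

lemma continuous_mellin: "f \<in> core \<Longrightarrow> continuous_on UNIV (mellin f)"
  unfolding mellin_def by (intro continuous_fourier BCI_D(2) core_lift)

lemma measurable_mellin: "f \<in> core \<Longrightarrow> mellin f \<in> borel_measurable borel"
  by (intro borel_measurable_continuous_onI continuous_mellin)

text \<open>Membership in \<open>core\<close> says nothing about \<open>f\<close> at
  \<open>x \<le> 0\<close>, so \<open>f\<close> need not be Borel on the line. The second function
  is a Borel representative that agrees with \<open>f\<close> for \<open>x > 0\<close>, as the
  substitution \<open>M0_exp_subst\<close> requires.\<close>

lemma core_measurable:
  assumes "f \<in> core"
  shows "f \<in> borel_measurable M0" "(\<lambda>x. lift f (ln x) / of_real (sqrt x)) \<in> borel_measurable borel"
proof -
  have [measurable]: "lift f \<in> borel_measurable borel" using assms by (simp add: core_def BCI_D)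
  show *: "(\<lambda>x. lift f (ln x) / of_real (sqrt x)) \<in> borel_measurable borel" by measurable
  hence "(\<lambda>x. lift f (ln x) / of_real (sqrt x)) \<in> borel_measurable M0"
    by (intro measurable_restrict_space1 measurable_completion) simp
  thus "f \<in> borel_measurable M0"
    by (rule measurable_cong[THEN iffD1, rotated]) (simp add: lift_inverse[symmetric])
qed

theorem mellin_isometry:
  assumes "f \<in> core"
  shows "f \<in> L2" "integrable lborel (\<lambda>\<tau>. (cmod (mellin f \<tau>))\<^sup>2)"
    "(LINT \<tau>|lborel. (cmod (mellin f \<tau>))\<^sup>2) = 2 * pi * (L2norm f)\<^sup>2"
proof -
  let ?\<phi> = "\<lambda>x. lift f (ln x) / of_real (sqrt x)"
  note [measurable] = core_measurable[OF assms]
  have b: "lift f \<in> BCI" by (rule core_lift[OF assms])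
  have eq: "exp t *\<^sub>R (cmod (?\<phi> (exp t)))\<^sup>2 = (cmod (lift f t))\<^sup>2" for t
    by (simp add: norm_divide power_divide)
  have "integrable M0 (\<lambda>x. (cmod (?\<phi> x))\<^sup>2) \<longleftrightarrow> integrable lborel (\<lambda>t. (cmod (lift f t))\<^sup>2)"
    by (subst M0_exp_subst) (use eq in auto)
  moreover have "integrable lborel (\<lambda>t. (cmod (lift f t))\<^sup>2)"
    using integrable_norm[OF BCI_square_integrable[OF b b]] by (simp add: norm_mult power2_eq_square)
  ultimately have "integrable M0 (\<lambda>x. (cmod (?\<phi> x))\<^sup>2)" by simp
  hence "integrable M0 (\<lambda>x. (cmod (f x))\<^sup>2)"
    by (rule Bochner_Integration.integrable_cong[THEN iffD1, rotated 2]) (simp_all add: lift_inverse[symmetric])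
  thus "f \<in> L2" by (intro L2_I) auto
  show "integrable lborel (\<lambda>\<tau>. (cmod (mellin f \<tau>))\<^sup>2)"
    unfolding mellin_def by (rule plancherel_BCI[OF b])
  have "(LINT x|M0. (cmod (f x))\<^sup>2) = (LINT x|M0. (cmod (?\<phi> x))\<^sup>2)"
    by (intro Bochner_Integration.integral_cong) (simp_all add: lift_inverse[symmetric])
  also have "\<dots> = (LINT t|lborel. (cmod (lift f t))\<^sup>2)"
    by (subst M0_exp_subst) (use eq in auto)
  finally show "(LINT \<tau>|lborel. (cmod (mellin f \<tau>))\<^sup>2) = 2 * pi * (L2norm f)\<^sup>2"
    unfolding mellin_def plancherel_BCI(2)[OF b] L2norm_sq by simp
qed

section \<open>Density of the core in \<open>L2\<close>\<close>

text \<open>On the positive axis this is a trapezoid in the coordinate \<open>ln x\<close>: it is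
  \<open>1\<close> where \<open>|ln x| \<le> k - 1\<close> and \<open>0\<close> where
  \<open>|ln x| \<ge> k\<close>.\<close>

definition cutoff :: "nat \<Rightarrow> real \<Rightarrow> real" where
  "cutoff k x = max 0 (min 1 (real k - \<bar>ln x\<bar>))"

text \<open>For \<open>k > 0\<close> this is the radial retraction onto the disc of radius
  \<open>k\<close>. Unlike setting large values to \<open>0\<close> it is continuous, so truncating
  a continuous function leaves it continuous.\<close>

definition clamp_norm :: "real \<Rightarrow> complex \<Rightarrow> complex" where
  "clamp_norm k z = z * of_real (k / max k (cmod z))"

lemma cutoff_bounds: "0 \<le> cutoff k x" "cutoff k x \<le> 1"
  by (auto simp: cutoff_def)

lemma cutoff_tendsto: "(\<lambda>k. cutoff k x) \<longlonglongrightarrow> 1"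
proof (rule tendsto_eventually)
  show "\<forall>\<^sub>F k in sequentially. cutoff k x = 1"
    using eventually_ge_at_top[of "nat \<lceil>\<bar>ln x\<bar> + 1\<rceil>"]
  proof eventually_elim
    case (elim k)
    hence "\<bar>ln x\<bar> + 1 \<le> real k" by linarith
    thus ?case by (simp add: cutoff_def)
  qed
qed

lemma clamp_norm_bounds:
  assumes "k \<ge> 0" shows "cmod (clamp_norm k z) \<le> k" "cmod (clamp_norm k z) \<le> cmod z"
  using assms
  by (auto simp: clamp_norm_def norm_mult norm_divide max_def field_simps mult_left_mono mult_right_mono abs_mult)

lemma clamp_norm_tendsto: "(\<lambda>k. clamp_norm (real k) z) \<longlonglongrightarrow> z"
proof (rule tendsto_eventually)
  show "\<forall>\<^sub>F k in sequentially. clamp_norm (real k) z = z"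
    using eventually_ge_at_top[of "nat \<lceil>cmod z + 1\<rceil>"]
  proof eventually_elim
    case (elim k)
    hence "real k \<ge> cmod z + 1" by linarith
    moreover have "cmod z \<ge> 0" by simp
    ultimately have "real k > 0" "real k \<ge> cmod z" by linarith+
    thus ?case by (simp add: clamp_norm_def max_def)
  qed
qed

lemma continuous_clamp_norm [continuous_intros]:
  assumes "k > 0" "continuous_on A f"
  shows "continuous_on A (\<lambda>x. clamp_norm k (f x))"
  unfolding clamp_norm_def using assms
  by (intro continuous_intros) (auto simp: max_def)

lemma measurable_cutoff [measurable]: "cutoff k \<in> borel_measurable borel"
  unfolding cutoff_def by measurable

lemma borel_measurable_M0: "f \<in> borel_measurable borel \<Longrightarrow> f \<in> borel_measurable M0"
  by (intro measurable_restrict_space1 measurable_completion) simp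

lemma truncation_in_core:
  assumes g: "continuous_on UNIV g" and k: "k > 0"
  shows "(\<lambda>x. of_real (cutoff k x) * clamp_norm (real k) (g x)) \<in> core"
proof -
  let ?F = "lift (\<lambda>x. of_real (cutoff k x) * clamp_norm (real k) (g x))"
  have eq: "?F = (\<lambda>t. of_real (max 0 (min 1 (real k - \<bar>t\<bar>))) * clamp_norm (real k) (g (exp t)) * of_real (exp (t / 2)))"
    by (simp add: lift_def cutoff_def fun_eq_iff)
  have c: "continuous_on UNIV ?F"
    unfolding eq using k
    by (intro continuous_intros continuous_on_compose2[OF g]) auto
  have z: "?F t = 0" if "t \<notin> {- real k..real k}" for t
    using that by (auto simp: lift_def cutoff_def)
  have cb: "compact (?F ` {- real k..real k})"
    by (intro compact_continuous_image continuous_on_subset[OF c]) auto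
  from compact_imp_bounded[OF cb] obtain B where "\<forall>z\<in>?F ` {- real k..real k}. cmod z \<le> B"
    unfolding bounded_iff by blast
  hence B: "cmod (?F t) \<le> B" if "t \<in> {- real k..real k}" for t using that by blast
  have "cmod (?F 0) \<le> B" by (rule B) auto
  hence B0: "B \<ge> 0" using norm_ge_zero[of "?F 0"] by linarith
  have "integrable lborel ?F"
  proof (rule Bochner_Integration.integrable_bound)
    show "integrable lborel (\<lambda>t. B * indicator {- real k..real k} t)" by simp
    show "?F \<in> borel_measurable lborel" using borel_measurable_continuous_onI[OF c] by simp
    show "AE t in lborel. norm (?F t) \<le> norm (B * indicator {- real k..real k} t)"
      using B z B0 by (intro AE_I2) (auto simp: indicator_def)
  qed
  moreover have "cmod (?F t) \<le> B" for t
    using B[of t] z[of t] B0 by (cases "t \<in> {- real k..real k}") auto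
  ultimately show ?thesis
    unfolding core_def using c by (auto intro: BCI_I)
qed

lemma L2norm_tendsto_0:
  assumes "(\<lambda>n. LINT x|M0. (cmod (F n x))\<^sup>2) \<longlonglongrightarrow> 0"
  shows "(\<lambda>n. L2norm (F n)) \<longlonglongrightarrow> 0"
  unfolding L2norm_def using tendsto_real_sqrt[OF assms] by simp

text \<open>There are two approximations, each by dominated convergence: \<open>f\<close> by its
  truncation \<open>G k\<close> in size and support, then \<open>G k\<close> by the same truncation
  of continuous functions converging to \<open>f\<close> almost everywhere. Truncating before
  passing to continuous functions provides the majorant that their almost everywhere convergence
  alone does not give.\<close>

theorem core_dense:
  assumes f: "f \<in> L2" and e: "e > 0"
  obtains g where "g \<in> core" "L2norm (\<lambda>x. f x - g x) < e"
proof -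
  note [measurable] = L2_meas[OF f]
  define f' where "f' = (\<lambda>x. if x \<in> {0<..} then f x else 0)"
  have "f' \<in> borel_measurable lebesgue"
    unfolding f'_def using L2_meas[OF f] by (intro borel_measurable_if_I) auto
  \<comment> \<open>This notion of measurability supplies continuous functions converging to
    \<open>f'\<close> off a negligible set; it serves in place of Lusin's theorem.\<close>
  hence "f' measurable_on UNIV" by (intro lebesgue_measurable_imp_measurable_on) auto
  then obtain N g where N: "negligible N" and g: "\<And>n. continuous_on UNIV (g n)"
    and lim: "\<And>x. x \<notin> N \<Longrightarrow> (\<lambda>n. g n x) \<longlonglongrightarrow> f' x"
    unfolding measurable_on_def by auto
  have AEN: "AE x in M0. x \<notin> N"
  proof -
    have "AE x in lebesgue. x \<notin> N" using N by (auto simp: negligible_iff_null_sets intro: AE_not_in)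
    thus ?thesis by (auto simp: AE_restrict_space_iff elim: eventually_mono)
  qed
  have gm [measurable]: "g n \<in> borel_measurable M0" for n
    by (intro borel_measurable_M0 borel_measurable_continuous_onI g)
  have cm [measurable]: "clamp_norm (real k) \<in> borel_measurable borel" for k
    unfolding clamp_norm_def by measurable
  have cut [measurable]: "cutoff k \<in> borel_measurable M0" for k
    by (intro borel_measurable_M0) measurable
  define G where "G = (\<lambda>k x. of_real (cutoff k x) * clamp_norm (real k) (f x))"
  have "(\<lambda>k. L2norm (\<lambda>x. f x - G k x)) \<longlonglongrightarrow> 0"
  proof (rule L2norm_tendsto_0)
    have "(\<lambda>k. LINT x|M0. (cmod (f x - G k x))\<^sup>2) \<longlonglongrightarrow> (LINT x|M0. 0)"
    proof (rule integral_dominated_convergence[where w="\<lambda>x. 4 * (cmod (f x))\<^sup>2"])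
      show "AE x in M0. (\<lambda>k. (cmod (f x - G k x))\<^sup>2) \<longlonglongrightarrow> 0"
      proof (intro AE_I2)
        fix x
        have "(\<lambda>k. (cmod (f x - G k x))\<^sup>2) \<longlonglongrightarrow> (cmod (f x - of_real 1 * f x))\<^sup>2"
          unfolding G_def by (intro tendsto_intros clamp_norm_tendsto cutoff_tendsto)
        thus "(\<lambda>k. (cmod (f x - G k x))\<^sup>2) \<longlonglongrightarrow> 0" by simp
      qed
      show "AE x in M0. norm ((cmod (f x - G k x))\<^sup>2) \<le> 4 * (cmod (f x))\<^sup>2" for k
      proof (intro AE_I2)
        fix x
        have "cmod (G k x) \<le> 1 * cmod (f x)"
          unfolding G_def norm_mult using cutoff_bounds[of k x] clamp_norm_bounds(2)[of "real k" "f x"]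
          by (intro mult_mono) auto
        hence "cmod (f x - G k x) \<le> 2 * cmod (f x)" using norm_triangle_ineq4[of "f x" "G k x"] by simp
        hence "(cmod (f x - G k x))\<^sup>2 \<le> (2 * cmod (f x))\<^sup>2" by (intro power_mono) auto
        thus "norm ((cmod (f x - G k x))\<^sup>2) \<le> 4 * (cmod (f x))\<^sup>2" by (simp add: power_mult_distrib)
      qed
    qed (use L2_int[OF f] in \<open>auto simp: G_def\<close>)
    thus "(\<lambda>k. LINT x|M0. (cmod (f x - G k x))\<^sup>2) \<longlonglongrightarrow> 0" by simp
  qed
  hence "\<forall>\<^sub>F k in sequentially. L2norm (\<lambda>x. f x - G k x) < e / 2"
    using e by (intro order_tendstoD) auto
  with eventually_gt_at_top[of 0] have "\<forall>\<^sub>F k in sequentially. k > 0 \<and> L2norm (\<lambda>x. f x - G k x) < e / 2"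
    by eventually_elim simp
  then obtain k where k: "k > 0" "L2norm (\<lambda>x. f x - G k x) < e / 2"
    by (metis (no_types, lifting) eventually_sequentially order.refl)
  define H where "H = (\<lambda>n x. of_real (cutoff k x) * clamp_norm (real k) (g n x))"
  have Hc: "H n \<in> core" for n unfolding H_def by (rule truncation_in_core[OF g k(1)])
  have GL: "G k \<in> L2"
  proof (rule L2_I)
    show "integrable M0 (\<lambda>x. (cmod (G k x))\<^sup>2)"
    proof (rule Bochner_Integration.integrable_bound[OF L2_int[OF f]])
      have "cmod (G k x) \<le> 1 * cmod (f x)" for x
          unfolding G_def norm_mult using cutoff_bounds[of k x] clamp_norm_bounds(2)[of "real k" "f x"]
          by (intro mult_mono) auto
      thus "AE x in M0. norm ((cmod (G k x))\<^sup>2) \<le> norm ((cmod (f x))\<^sup>2)"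
        by (intro AE_I2) (simp add: power_mono)
    qed (auto simp: G_def)
  qed (auto simp: G_def)
  \<comment> \<open>The constant \<open>2 * real k\<close> is clamped to \<open>real k\<close>, so
    the majorant is twice the modulus of a truncated constant, which belongs to the core and hence
    to \<open>L2\<close>.\<close>
  have ci: "integrable M0 (\<lambda>x. (2 * real k * cutoff k x)\<^sup>2)"
  proof -
    have "integrable M0 (\<lambda>x. (cmod (of_real (cutoff k x) * clamp_norm (real k) (of_real (2 * real k))))\<^sup>2)"
      by (rule L2_int[OF mellin_isometry(1)[OF truncation_in_core[OF continuous_on_const k(1)]]])
    moreover have "(cmod (of_real (cutoff k x) * clamp_norm (real k) (of_real (2 * real k))))\<^sup>2 = (cutoff k x * real k)\<^sup>2" for x
      using k by (simp add: clamp_norm_def norm_mult max_def power_mult_distrib)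
    ultimately have "integrable M0 (\<lambda>x. 4 * (cutoff k x * real k)\<^sup>2)" by simp
    thus ?thesis by (simp add: power_mult_distrib mult_ac)
  qed
  have "(\<lambda>n. L2norm (\<lambda>x. G k x - H n x)) \<longlonglongrightarrow> 0"
  proof (rule L2norm_tendsto_0)
    have "(\<lambda>n. LINT x|M0. (cmod (G k x - H n x))\<^sup>2) \<longlonglongrightarrow> (LINT x|M0. 0)"
    proof (rule integral_dominated_convergence[where w="\<lambda>x. (2 * real k * cutoff k x)\<^sup>2"])
      show "AE x in M0. (\<lambda>n. (cmod (G k x - H n x))\<^sup>2) \<longlonglongrightarrow> 0"
        using AEN AE_space
      proof eventually_elim
        case (elim x)
        have "isCont (clamp_norm (real k)) (f x)"
          using continuous_clamp_norm[of "real k" UNIV "\<lambda>x. x"] k by (auto simp: continuous_on_eq_continuous_at)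
        moreover have "(\<lambda>n. g n x) \<longlonglongrightarrow> f x" using lim[of x] elim by (simp add: f'_def)
        ultimately have "(\<lambda>n. clamp_norm (real k) (g n x)) \<longlonglongrightarrow> clamp_norm (real k) (f x)"
          by (rule isCont_tendsto_compose)
        hence "(\<lambda>n. (cmod (G k x - H n x))\<^sup>2) \<longlonglongrightarrow> (cmod (G k x - of_real (cutoff k x) * clamp_norm (real k) (f x)))\<^sup>2"
          unfolding H_def by (intro tendsto_intros)
        thus ?case by (simp add: G_def)
      qed
      show "AE x in M0. norm ((cmod (G k x - H n x))\<^sup>2) \<le> (2 * real k * cutoff k x)\<^sup>2" for n
      proof (intro AE_I2)
        fix x
        have *: "cmod (of_real (cutoff k x) * clamp_norm (real k) z) \<le> cutoff k x * real k" for z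
          unfolding norm_mult using cutoff_bounds[of k x] clamp_norm_bounds(1)[of "real k" z]
          by (auto intro!: mult_mono)
        have "cmod (G k x - H n x) \<le> 2 * real k * cutoff k x"
          using norm_triangle_ineq4[of "G k x" "H n x"] *[of "f x"] *[of "g n x"]
          unfolding G_def H_def mult.commute[of "cutoff k x"] mult.assoc by linarith
        thus "norm ((cmod (G k x - H n x))\<^sup>2) \<le> (2 * real k * cutoff k x)\<^sup>2"
          by (simp add: power_mono)
      qed
    qed (use ci in \<open>auto simp: G_def H_def\<close>)
    thus "(\<lambda>n. LINT x|M0. (cmod (G k x - H n x))\<^sup>2) \<longlonglongrightarrow> 0" by simp
  qed
  hence "\<forall>\<^sub>F n in sequentially. L2norm (\<lambda>x. G k x - H n x) < e / 2"
    using e by (intro order_tendstoD) auto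
  then obtain n where n: "L2norm (\<lambda>x. G k x - H n x) < e / 2"
    by (metis (no_types, lifting) eventually_sequentially order.refl)
  have "L2norm (\<lambda>x. f x - H n x) \<le> L2norm (\<lambda>x. f x - G k x) + L2norm (\<lambda>x. G k x - H n x)"
    by (rule L2norm_diff_triangle[OF f GL mellin_isometry(1)[OF Hc]])
  also have "\<dots> < e" using k n by simp
  finally show ?thesis using that[OF Hc] by blast
qed

lemma core_sequence:
  assumes f: "f \<in> L2" and e: "\<And>n::nat. e n > 0"
  obtains F where "\<And>n. F n \<in> core" "\<And>n. L2norm (\<lambda>x. f x - F n x) < e n"
proof -
  have "\<exists>g. g \<in> core \<and> L2norm (\<lambda>x. f x - g x) < e n" for n
    using core_dense[OF f e[of n]] by metis
  then obtain F where "\<And>n. F n \<in> core \<and> L2norm (\<lambda>x. f x - F n x) < e n" by metis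
  thus ?thesis using that by blast
qed

section \<open>Dilation-invariant operators and their symbols\<close>

text \<open>Convolution with \<open>k\<close> on the line, pulled back through \<open>lift\<close>;
  the factor \<open>1 / sqrt (x * t)\<close> collects the two half-density weights and the
  Jacobian.\<close>

definition conv_op :: "(real \<Rightarrow> complex) \<Rightarrow> op" where
  "conv_op k f x = (LINT t|M0. k (ln (x / t)) / of_real (sqrt (x * t)) * f t)"

text \<open>Integrability bounds the operator norm. Square integrability makes
  \<open>conv_op k f x\<close> an inner product of \<open>f\<close> with an \<open>L2\<close>
  function, hence meaningful at every \<open>x > 0\<close> for every \<open>f\<close> in
  \<open>L2\<close>.\<close>

definition kernel :: "(real \<Rightarrow> complex) \<Rightarrow> bool" where
  "kernel k \<longleftrightarrow> k \<in> borel_measurable borel \<and> integrable lborel k \<and> integrable lborel (\<lambda>t. (cmod (k t))\<^sup>2)"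

lemma L2_ae:
  assumes "f \<in> L2" "g \<in> borel_measurable M0" "ae_eq f g"
  shows "g \<in> L2"
proof (rule L2_I)
  note [measurable] = L2_meas[OF assms(1)] assms(2)
  show "integrable M0 (\<lambda>x. (cmod (g x))\<^sup>2)"
  proof (rule integrable_cong_AE_imp[OF L2_int[OF assms(1)]])
    show "AE x in M0. (cmod (f x))\<^sup>2 = (cmod (g x))\<^sup>2"
      using assms(3) unfolding ae_eq_def by eventually_elim simp
  qed measurable
qed (rule assms)

lemma L2_cong:
  assumes "f \<in> L2" "\<And>x. x > 0 \<Longrightarrow> g x = f x"
  shows "g \<in> L2"
proof (rule L2_ae[OF assms(1)])
  show "g \<in> borel_measurable M0"
    by (rule measurable_cong[THEN iffD2, OF _ L2_meas[OF assms(1)]]) (simp add: assms)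
qed (simp add: ae_eq_I assms)

text \<open>Used to pass norm bounds from the core to \<open>L2\<close>: for an integral operator
  only pointwise convergence of the images is known beforehand, and Fatou's lemma yields both
  membership and the bound in the limit.\<close>

lemma L2_Fatou:
  assumes h: "\<And>n. h n \<in> L2" and lim: "\<And>x. x > 0 \<Longrightarrow> (\<lambda>n. h n x) \<longlonglongrightarrow> g x"
    and c: "\<And>n. L2norm (h n) \<le> c n" "c \<longlonglongrightarrow> C"
  shows "g \<in> L2" "L2norm g \<le> C"
proof -
  note [measurable] = L2_meas[OF h]
  have gm [measurable]: "g \<in> borel_measurable M0"
    by (rule borel_measurable_LIMSEQ_metric[of h]) (use lim in auto)
  have "c n \<ge> 0" for n using c(1)[of n] L2norm_nonneg[of "h n"] by linarith
  hence C0: "C \<ge> 0" by (intro LIMSEQ_le_const[OF c(2)]) auto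
  have "(\<integral>\<^sup>+x. ennreal ((cmod (g x))\<^sup>2) \<partial>M0) = (\<integral>\<^sup>+x. liminf (\<lambda>n. ennreal ((cmod (h n x))\<^sup>2)) \<partial>M0)"
  proof (intro nn_integral_cong)
    fix x assume "x \<in> space M0"
    hence "(\<lambda>n. ennreal ((cmod (h n x))\<^sup>2)) \<longlonglongrightarrow> ennreal ((cmod (g x))\<^sup>2)"
      by (intro tendsto_intros lim) simp
    thus "ennreal ((cmod (g x))\<^sup>2) = liminf (\<lambda>n. ennreal ((cmod (h n x))\<^sup>2))"
      by (intro lim_imp_Liminf[symmetric]) auto
  qed
  also have "\<dots> \<le> liminf (\<lambda>n. \<integral>\<^sup>+x. ennreal ((cmod (h n x))\<^sup>2) \<partial>M0)"
    by (rule nn_integral_liminf) measurable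
  also have "\<dots> \<le> liminf (\<lambda>n. ennreal ((c n)\<^sup>2))"
  proof (intro Liminf_mono always_eventually allI)
    fix n
    have "(\<integral>\<^sup>+x. ennreal ((cmod (h n x))\<^sup>2) \<partial>M0) = ennreal ((L2norm (h n))\<^sup>2)"
      using L2_int[OF h[of n]] by (subst nn_integral_eq_integral) (auto simp: L2norm_sq)
    also have "\<dots> \<le> ennreal ((c n)\<^sup>2)" by (intro ennreal_leI power_mono c L2norm_nonneg)
    finally show "(\<integral>\<^sup>+x. ennreal ((cmod (h n x))\<^sup>2) \<partial>M0) \<le> ennreal ((c n)\<^sup>2)" .
  qed
  also have "(\<lambda>n. ennreal ((c n)\<^sup>2)) \<longlonglongrightarrow> ennreal (C\<^sup>2)" by (intro tendsto_intros c)
  hence "liminf (\<lambda>n. ennreal ((c n)\<^sup>2)) = ennreal (C\<^sup>2)" by (simp add: lim_imp_Liminf)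
  finally have le: "(\<integral>\<^sup>+x. ennreal ((cmod (g x))\<^sup>2) \<partial>M0) \<le> ennreal (C\<^sup>2)" .
  show "g \<in> L2"
    by (intro L2_I integrableI_bounded) (use le le_less_trans[OF le ennreal_less_top] in auto)
  hence "ennreal ((L2norm g)\<^sup>2) \<le> ennreal (C\<^sup>2)"
    using le by (subst (asm) nn_integral_eq_integral) (auto simp: L2norm_sq L2_int)
  hence "(L2norm g)\<^sup>2 \<le> C\<^sup>2" by (simp add: ennreal_le_iff)
  thus "L2norm g \<le> C" using C0 by (rule power2_le_imp_le)
qed

lemma kernel_section:
  assumes k: "kernel k" and x: "x > 0"
  shows "(\<lambda>t. cnj (k (ln (x / t)) / of_real (sqrt (x * t)))) \<in> L2"
proof (rule L2_I)
  have [measurable]: "k \<in> borel_measurable borel" using k by (simp add: kernel_def)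
  let ?K = "\<lambda>t. cnj (k (ln (x / t)) / of_real (sqrt (x * t)))"
  show "?K \<in> borel_measurable M0"
    by (intro borel_measurable_M0) measurable
  have "integrable lborel (\<lambda>u. (cmod (k u))\<^sup>2)" using k by (simp add: kernel_def)
  hence "integrable lborel (\<lambda>u. (1 / x) * (cmod (k (ln x + (-1) * u)))\<^sup>2)"
    using lborel_integrable_real_affine_iff[of "-1" "\<lambda>u. (cmod (k u))\<^sup>2" "ln x"] by simp
  moreover have "exp u *\<^sub>R (cmod (?K (exp u)))\<^sup>2 = (1 / x) * (cmod (k (ln x + (-1) * u)))\<^sup>2" for u
    using x by (simp add: norm_divide norm_mult power_divide ln_div real_sqrt_mult power_mult_distrib)
  ultimately show "integrable M0 (\<lambda>t. (cmod (?K t))\<^sup>2)"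
    by (subst M0_exp_subst) simp_all
qed

lemma conv_op_ip: "conv_op k f x = ip f (\<lambda>t. cnj (k (ln (x / t)) / of_real (sqrt (x * t))))"
  by (simp add: conv_op_def ip_def mult.commute)

lemma conv_op_core:
  assumes k: "kernel k" and f: "f \<in> core"
  shows "conv_op k f \<in> core" "mellin (conv_op k f) \<tau> = fourier k \<tau> * mellin f \<tau>"
proof -
  have [measurable]: "k \<in> borel_measurable borel" and ki: "integrable lborel k" using k by (simp_all add: kernel_def)
  note [measurable] = core_measurable(2)[OF f]
  have "lift (conv_op k f) t = conv k (lift f) t" for t
  proof -
    let ?\<phi> = "\<lambda>x. lift f (ln x) / of_real (sqrt x)"
    have "lift (conv_op k f) t = (LINT y|M0. k (ln (exp t / y)) / of_real (sqrt (exp t * y)) * f y) * of_real (exp (t / 2))"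
      by (simp add: lift_def conv_op_def)
    also have "(LINT y|M0. k (ln (exp t / y)) / of_real (sqrt (exp t * y)) * f y) =
      (LINT y|M0. k (ln (exp t / y)) / of_real (sqrt (exp t * y)) * ?\<phi> y)"
      by (intro Bochner_Integration.integral_cong) (simp_all add: lift_inverse[symmetric])
    also have "\<dots> = (LINT u|lborel. exp u *\<^sub>R (k (ln (exp t / exp u)) / of_real (sqrt (exp t * exp u)) * ?\<phi> (exp u)))"
      by (rule M0_exp_subst) measurable
    also have "\<dots> * of_real (exp (t / 2)) = (LINT u|lborel. k (t - u) * lift f u)"
    proof -
      have s: "sqrt (exp v) = exp (v / 2)" for v :: real
        by (rule real_sqrt_unique) (simp_all add: power2_eq_square mult_exp_exp)
      have e: "complex_of_real (exp u) = of_real (exp (u / 2)) * of_real (exp (u / 2))" for u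
        unfolding of_real_mult[symmetric] mult_exp_exp by simp
      show ?thesis
        unfolding integral_mult_left_zero[symmetric]
      proof (intro Bochner_Integration.integral_cong refl)
        fix u
        show "exp u *\<^sub>R (k (ln (exp t / exp u)) / of_real (sqrt (exp t * exp u)) *
            (lift f (ln (exp u)) / of_real (sqrt (exp u)))) * of_real (exp (t / 2)) = k (t - u) * lift f u"
          by (simp add: s real_sqrt_mult scaleR_conv_of_real ln_div e[of u] del: of_real_exp)
      qed
    qed
    also have "\<dots> = (LINT u|lborel. k u * lift f (t - u))"
      by (subst lborel_integral_real_affine[of "-1" _ t]) auto
    finally show ?thesis by (simp add: conv_def)
  qed
  hence eq: "lift (conv_op k f) = conv k (lift f)" by auto
  show "conv_op k f \<in> core" "mellin (conv_op k f) \<tau> = fourier k \<tau> * mellin f \<tau>"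
    unfolding core_def mellin_def mem_Collect_eq eq by (intro fourier_conv ki core_lift[OF f])+
qed

lemma L2norm_le_of_mellin:
  assumes f: "f \<in> core" and g: "g \<in> core" and b: "\<And>\<tau>. cmod (mellin f \<tau>) \<le> C * cmod (mellin g \<tau>)" and C: "C \<ge> 0"
  shows "L2norm f \<le> C * L2norm g"
proof (rule power2_le_imp_le)
  have "(cmod (mellin f \<tau>))\<^sup>2 \<le> C\<^sup>2 * (cmod (mellin g \<tau>))\<^sup>2" for \<tau>
    using power_mono[OF b[of \<tau>], of 2] by (simp add: power_mult_distrib)
  hence "2 * pi * (L2norm f)\<^sup>2 \<le> (LINT \<tau>|lborel. C\<^sup>2 * (cmod (mellin g \<tau>))\<^sup>2)"
    unfolding mellin_isometry(3)[OF f, symmetric]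
    using mellin_isometry(2)[OF f] mellin_isometry(2)[OF g]
    by (intro integral_mono) auto
  also have "\<dots> = 2 * pi * (C * L2norm g)\<^sup>2" by (simp add: mellin_isometry(3)[OF g] power_mult_distrib)
  finally show "(L2norm f)\<^sup>2 \<le> (C * L2norm g)\<^sup>2" by simp
qed (intro mult_nonneg_nonneg C L2norm_nonneg)

section \<open>Operators given by a symbol\<close>

text \<open>The symbol relation is required at every \<open>\<tau>\<close>, which makes sense
  because transforms of core functions are genuine functions. Off the core nothing is said about
  transforms; there boundedness and density determine \<open>B\<close>.\<close>

definition Mult :: "op \<Rightarrow> (real \<Rightarrow> complex) \<Rightarrow> bool" where
  "Mult B b \<longleftrightarrow> bounded_op_on L2 B \<and> (\<forall>f\<in>core. B f \<in> core \<and> (\<forall>\<tau>. mellin (B f) \<tau> = b \<tau> * mellin f \<tau>))"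

lemma MultD:
  assumes "Mult B b"
  shows "bounded_op_on L2 B" "f \<in> core \<Longrightarrow> B f \<in> core" "f \<in> core \<Longrightarrow> mellin (B f) \<tau> = b \<tau> * mellin f \<tau>"
  using assms by (auto simp: Mult_def)

text \<open>On the core the bound is \<open>|fourier k| \<le> \<integral> |k|\<close> combined with
  the isometry. For general \<open>f\<close>, approximants from the core have images converging at
  each \<open>x > 0\<close>, because \<open>conv_op k f x\<close> is an inner product against a
  fixed section of the kernel; \<open>L2_Fatou\<close> then transfers the bound.\<close>

lemma Mult_conv_op:
  assumes k: "kernel k"
  shows "Mult (conv_op k) (fourier k)"
proof -
  let ?B = "conv_op k"
  let ?C = "LINT t|lborel. cmod (k t)"
  have ki: "integrable lborel k" using k by (simp add: kernel_def)
  have bd: "?B f \<in> L2 \<and> L2norm (?B f) \<le> ?C * L2norm f" if f: "f \<in> L2" for f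
  proof -
    obtain F where F: "\<And>n. F n \<in> core" "\<And>n. L2norm (\<lambda>x. f x - F n x) < 1 / real (Suc n)"
      by (rule core_sequence[OF f, of "\<lambda>n. 1 / real (Suc n)"]) auto
    note FL = mellin_isometry(1)[OF F(1)]
    have e0: "(\<lambda>n. 1 / real (Suc n)) \<longlonglongrightarrow> 0" by (rule LIMSEQ_Suc[OF lim_const_over_n])
    have lim: "(\<lambda>n. ?B (F n) x) \<longlonglongrightarrow> ?B f x" if x: "x > 0" for x
    proof -
      let ?K = "\<lambda>t. cnj (k (ln (x / t)) / of_real (sqrt (x * t)))"
      have K: "?K \<in> L2" by (rule kernel_section[OF k x])
      have "cmod (?B f x - ?B (F n) x) \<le> 1 / real (Suc n) * L2norm ?K" for n
      proof -
        have "?B f x - ?B (F n) x = ip (\<lambda>x. f x - F n x) ?K"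
          unfolding conv_op_ip by (rule ip_diff_left[OF f FL K, symmetric])
        also have "cmod \<dots> \<le> L2norm (\<lambda>x. f x - F n x) * L2norm ?K"
          by (rule ip_bound[OF L2_diff[OF f FL] K])
        also have "\<dots> \<le> 1 / real (Suc n) * L2norm ?K"
          by (intro mult_right_mono less_imp_le F L2norm_nonneg)
        finally show ?thesis .
      qed
      moreover have "(\<lambda>n. 1 / real (Suc n) * L2norm ?K) \<longlonglongrightarrow> 0"
        using tendsto_mult_left_zero[OF e0] .
      ultimately have "(\<lambda>n. ?B f x - ?B (F n) x) \<longlonglongrightarrow> 0"
        by (intro Lim_null_comparison[where f="\<lambda>n. ?B f x - ?B (F n) x"]) (auto intro: always_eventually)
      hence "(\<lambda>n. ?B f x - (?B f x - ?B (F n) x)) \<longlonglongrightarrow> ?B f x - 0" by (intro tendsto_intros)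
      thus ?thesis by simp
    qed
    have C0: "?C \<ge> 0" by simp
    have c: "L2norm (?B (F n)) \<le> ?C * (L2norm f + 1 / real (Suc n))" for n
    proof -
      have "L2norm (?B (F n)) \<le> ?C * L2norm (F n)"
        using fourier_norm_le[OF ki] conv_op_core[OF k F(1)]
        by (intro L2norm_le_of_mellin F C0) (auto simp: norm_mult intro!: mult_right_mono)
      also have "L2norm (F n) \<le> L2norm f + L2norm (\<lambda>x. F n x - f x)"
        using L2norm_triangle[OF f L2_diff[OF FL f, of n]] by simp
      hence "L2norm (F n) \<le> L2norm f + 1 / real (Suc n)"
        using F(2)[of n] L2norm_minus_commute[of f "F n"] by simp
      finally show ?thesis using C0 by (simp add: mult_left_mono)
    qed
    have "(\<lambda>n. ?C * (L2norm f + 1 / real (Suc n))) \<longlonglongrightarrow> ?C * (L2norm f + 0)"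
      by (intro tendsto_intros e0)
    from L2_Fatou[OF mellin_isometry(1)[OF conv_op_core(1)[OF k F(1)]] lim c this]
    show ?thesis by simp
  qed
  have "bounded_op_on L2 ?B"
    unfolding bounded_op_on_def
  proof (intro conjI ballI allI impI exI[of _ ?C])
    fix f g assume fg: "f \<in> L2" "g \<in> L2"
    show "?B f \<in> L2" "L2norm (?B f) \<le> ?C * L2norm f" using bd[OF fg(1)] by auto
    show "ae_eq (?B f) (?B g)" if "ae_eq f g"
      by (rule ae_eq_I) (unfold conv_op_ip, intro ip_cong_ae fg that kernel_section[OF k], auto)
    show "ae_eq (?B (\<lambda>x. f x + g x)) (\<lambda>x. ?B f x + ?B g x)"
      by (rule ae_eq_I) (unfold conv_op_ip, intro ip_add_left fg kernel_section[OF k], auto)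
    fix c show "ae_eq (?B (\<lambda>x. c * f x)) (\<lambda>x. c * ?B f x)"
      by (rule ae_eq_I) (unfold conv_op_ip, rule ip_cmult_left)
  qed
  thus ?thesis unfolding Mult_def using conv_op_core[OF k] by auto
qed

lemma null_sequence_le:
  fixes f :: "nat \<Rightarrow> 'a::real_normed_vector"
  assumes "\<And>n. norm (f n) \<le> g n" "g \<longlonglongrightarrow> 0"
  shows "f \<longlonglongrightarrow> 0"
  by (rule Lim_null_comparison[OF always_eventually assms(2)]) (simp add: assms(1))

section \<open>Bounded operators modulo null sets and the algebra of symbols\<close>

lemma bounded_opD:
  assumes "bounded_op_on L2 B"
  shows "f \<in> L2 \<Longrightarrow> B f \<in> L2"
    "f \<in> L2 \<Longrightarrow> g \<in> L2 \<Longrightarrow> ae_eq f g \<Longrightarrow> ae_eq (B f) (B g)"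
    "f \<in> L2 \<Longrightarrow> g \<in> L2 \<Longrightarrow> ae_eq (B (\<lambda>x. f x + g x)) (\<lambda>x. B f x + B g x)"
    "f \<in> L2 \<Longrightarrow> ae_eq (B (\<lambda>x. c * f x)) (\<lambda>x. c * B f x)"
  using assms by (auto simp: bounded_op_on_def)

lemma bounded_op_norm:
  assumes "bounded_op_on L2 B"
  obtains C where "C > 0" "\<And>f. f \<in> L2 \<Longrightarrow> L2norm (B f) \<le> C * L2norm f"
proof -
  obtain C where C: "\<And>f. f \<in> L2 \<Longrightarrow> L2norm (B f) \<le> C * L2norm f"
    using assms unfolding bounded_op_on_def by blast
  have "L2norm (B f) \<le> max C 1 * L2norm f" if "f \<in> L2" for f
  proof -
    have "L2norm (B f) \<le> C * L2norm f" by (rule C[OF that])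
    also have "\<dots> \<le> max C 1 * L2norm f" by (intro mult_right_mono L2norm_nonneg) auto
    finally show ?thesis .
  qed
  thus ?thesis by (intro that[of "max C 1"]) auto
qed

lemma ae_eq_add: "ae_eq f f' \<Longrightarrow> ae_eq g g' \<Longrightarrow> ae_eq (\<lambda>x. f x + g x) (\<lambda>x. f' x + g' x)"
  unfolding ae_eq_def by (auto elim: eventually_elim2)

lemma ae_eq_cmult: "ae_eq f f' \<Longrightarrow> ae_eq (\<lambda>x. c * f x) (\<lambda>x. c * f' x)"
  unfolding ae_eq_def by (auto elim: eventually_mono)

lemma bounded_op_diff:
  assumes B: "bounded_op_on L2 B" and "f \<in> L2" "g \<in> L2"
  shows "ae_eq (B (\<lambda>x. f x - g x)) (\<lambda>x. B f x - B g x)"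
proof -
  have "ae_eq (B (\<lambda>x. f x + (-1) * g x)) (\<lambda>x. B f x + B (\<lambda>x. (-1) * g x) x)"
    by (intro bounded_opD(3)[OF B] assms L2_cmult)
  moreover have "ae_eq (\<lambda>x. B f x + B (\<lambda>x. (-1) * g x) x) (\<lambda>x. B f x + (-1) * B g x)"
    by (intro ae_eq_add bounded_opD(4)[OF B] assms ae_eq_refl)
  ultimately have "ae_eq (B (\<lambda>x. f x + (-1) * g x)) (\<lambda>x. B f x + (-1) * B g x)"
    by (rule ae_eq_trans)
  thus ?thesis by simp
qed

lemma bounded_op_diff_norm:
  assumes B: "bounded_op_on L2 B" and C: "\<And>f. f \<in> L2 \<Longrightarrow> L2norm (B f) \<le> C * L2norm f"
    and fg: "f \<in> L2" "g \<in> L2"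
  shows "L2norm (\<lambda>x. B f x - B g x) \<le> C * L2norm (\<lambda>x. f x - g x)"
  using L2norm_cong_ae[OF _ _ bounded_op_diff[OF B fg]] C[OF L2_diff[OF fg]]
  by (simp add: fg L2_diff bounded_opD(1)[OF B])

lemma bounded_op_cong:
  assumes B: "bounded_op_on L2 B" and eq: "\<And>f x. f \<in> L2 \<Longrightarrow> x > 0 \<Longrightarrow> C f x = B f x"
  shows "bounded_op_on L2 C"
proof -
  have ae: "ae_eq (C f) (B f)" if "f \<in> L2" for f by (intro ae_eq_I eq that)
  have CL: "C f \<in> L2" if "f \<in> L2" for f using bounded_opD(1)[OF B that] eq[OF that] by (rule L2_cong)
  obtain K where K: "\<And>f. f \<in> L2 \<Longrightarrow> L2norm (B f) \<le> K * L2norm f" using bounded_op_norm[OF B] by metis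
  show ?thesis
    unfolding bounded_op_on_def
  proof (intro conjI ballI allI impI exI[of _ K])
    fix f g assume fg: "f \<in> L2" "g \<in> L2"
    show "C f \<in> L2" by (rule CL[OF fg(1)])
    show "ae_eq (C f) (C g)" if "ae_eq f g"
      using bounded_opD(2)[OF B fg that] ae[OF fg(1)] ae[OF fg(2)] ae_eq_trans ae_eq_sym by meson
    show "ae_eq (C (\<lambda>x. f x + g x)) (\<lambda>x. C f x + C g x)"
      using bounded_opD(3)[OF B fg] ae_eq_add[OF ae ae, OF fg] ae[OF L2_add[OF fg]] ae_eq_trans ae_eq_sym by meson
    show "L2norm (C f) \<le> K * L2norm f"
      using K[OF fg(1)] L2norm_cong_ae[OF CL[OF fg(1)] bounded_opD(1)[OF B fg(1)] ae[OF fg(1)]] by simp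
    fix c show "ae_eq (C (\<lambda>x. c * f x)) (\<lambda>x. c * C f x)"
      using bounded_opD(4)[OF B fg(1)] ae_eq_cmult[OF ae[OF fg(1)]] ae[OF L2_cmult[OF fg(1)]] ae_eq_trans ae_eq_sym by meson
  qed
qed

lemma bounded_op_comp:
  assumes B: "bounded_op_on L2 B" and C: "bounded_op_on L2 C"
  shows "bounded_op_on L2 (\<lambda>f. B (C f))"
proof -
  obtain K where K: "K > 0" "\<And>f. f \<in> L2 \<Longrightarrow> L2norm (B f) \<le> K * L2norm f" using bounded_op_norm[OF B] by metis
  obtain K' where K': "K' > 0" "\<And>f. f \<in> L2 \<Longrightarrow> L2norm (C f) \<le> K' * L2norm f" using bounded_op_norm[OF C] by metis
  note CL = bounded_opD(1)[OF C] and BL = bounded_opD(1)[OF B]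
  show ?thesis
    unfolding bounded_op_on_def
  proof (intro conjI ballI allI impI exI[of _ "K * K'"])
    fix f g assume fg: "f \<in> L2" "g \<in> L2"
    show "B (C f) \<in> L2" by (intro BL CL fg)
    show "ae_eq (B (C f)) (B (C g))" if "ae_eq f g"
      by (intro bounded_opD(2)[OF B] bounded_opD(2)[OF C] CL fg that)
    show "ae_eq (B (C (\<lambda>x. f x + g x))) (\<lambda>x. B (C f) x + B (C g) x)"
      by (rule ae_eq_trans[OF bounded_opD(2)[OF B _ _ bounded_opD(3)[OF C fg]] bounded_opD(3)[OF B]])
         (intro CL L2_add fg)+
    show "L2norm (B (C f)) \<le> K * K' * L2norm f"
      using order_trans[OF K(2)[OF CL[OF fg(1)]] mult_left_mono[OF K'(2)[OF fg(1)] less_imp_le[OF K(1)]]]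
      by (simp add: mult.assoc)
    fix c show "ae_eq (B (C (\<lambda>x. c * f x))) (\<lambda>x. c * B (C f) x)"
      by (rule ae_eq_trans[OF bounded_opD(2)[OF B _ _ bounded_opD(4)[OF C fg(1)]] bounded_opD(4)[OF B]])
         (intro CL L2_cmult fg)+
  qed
qed

lemma bounded_op_add:
  assumes B: "bounded_op_on L2 B" and C: "bounded_op_on L2 C"
  shows "bounded_op_on L2 (\<lambda>f x. B f x + C f x)"
proof -
  obtain K where K: "K > 0" "\<And>f. f \<in> L2 \<Longrightarrow> L2norm (B f) \<le> K * L2norm f" using bounded_op_norm[OF B] by metis
  obtain K' where K': "K' > 0" "\<And>f. f \<in> L2 \<Longrightarrow> L2norm (C f) \<le> K' * L2norm f" using bounded_op_norm[OF C] by metis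
  note CL = bounded_opD(1)[OF C] and BL = bounded_opD(1)[OF B]
  show ?thesis
    unfolding bounded_op_on_def
  proof (intro conjI ballI allI impI exI[of _ "K + K'"])
    fix f g assume fg: "f \<in> L2" "g \<in> L2"
    show "(\<lambda>x. B f x + C f x) \<in> L2" by (intro L2_add BL CL fg)
    show "ae_eq (\<lambda>x. B f x + C f x) (\<lambda>x. B g x + C g x)" if "ae_eq f g"
      by (intro ae_eq_add bounded_opD(2)[OF B] bounded_opD(2)[OF C] fg that)
    show "ae_eq (\<lambda>x. B (\<lambda>x. f x + g x) x + C (\<lambda>x. f x + g x) x) (\<lambda>x. B f x + C f x + (B g x + C g x))"
      using ae_eq_add[OF bounded_opD(3)[OF B fg] bounded_opD(3)[OF C fg]] by (simp add: algebra_simps)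
    show "L2norm (\<lambda>x. B f x + C f x) \<le> (K + K') * L2norm f"
      using L2norm_triangle[OF BL[OF fg(1)] CL[OF fg(1)]] K(2)[OF fg(1)] K'(2)[OF fg(1)]
      by (simp add: distrib_right)
    fix c show "ae_eq (\<lambda>x. B (\<lambda>x. c * f x) x + C (\<lambda>x. c * f x) x) (\<lambda>x. c * (B f x + C f x))"
      using ae_eq_add[OF bounded_opD(4)[OF B fg(1), of c] bounded_opD(4)[OF C fg(1), of c]] by (simp add: algebra_simps)
  qed
qed

lemma bounded_op_scalar: "bounded_op_on L2 (\<lambda>f x. c * f x)"
  unfolding bounded_op_on_def
  by (auto simp: L2_cmult L2norm_cmult ae_eq_cmult algebra_simps intro!: exI[of _ "cmod c"])

lemma Mult_scalar: "Mult (\<lambda>f x. c * f x) (\<lambda>\<tau>. c)"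
  by (simp add: Mult_def bounded_op_scalar core_cmult mellin_cmult)

lemma Mult_comp: "Mult B b \<Longrightarrow> Mult C c \<Longrightarrow> Mult (\<lambda>f. B (C f)) (\<lambda>\<tau>. b \<tau> * c \<tau>)"
  by (simp add: Mult_def bounded_op_comp)

lemma Mult_add: "Mult B b \<Longrightarrow> Mult C c \<Longrightarrow> Mult (\<lambda>f x. B f x + C f x) (\<lambda>\<tau>. b \<tau> + c \<tau>)"
  by (simp add: Mult_def bounded_op_add core_add mellin_add distrib_right)

lemma Mult_id: "Mult (\<lambda>f. f) (\<lambda>\<tau>. 1)"
  using Mult_scalar[of 1] by simp

lemma Mult_minus_scalar:
  assumes "Mult B b" shows "Mult (\<lambda>f x. B f x - l * f x) (\<lambda>\<tau>. b \<tau> - l)"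
  using Mult_add[OF assms Mult_scalar[of "-l"]] by simp

lemma Mult_power:
  assumes "Mult B b" shows "Mult (B ^^ j) (\<lambda>\<tau>. b \<tau> ^ j)"
proof (induction j)
  case 0 thus ?case using Mult_id by (simp add: id_def)
next
  case (Suc j) thus ?case using Mult_comp[OF assms Suc] by (simp add: comp_def)
qed

lemma Mult_cong:
  assumes B: "Mult B b" and eq: "\<And>f x. f \<in> L2 \<Longrightarrow> x > 0 \<Longrightarrow> C f x = B f x"
  shows "Mult C b"
proof -
  have l: "lift (C f) = lift (B f)" if "f \<in> core" for f
    using mellin_isometry(1)[OF that] by (auto simp: lift_def eq)
  have "bounded_op_on L2 C" using MultD(1)[OF B] eq by (rule bounded_op_cong)
  moreover have "C f \<in> core \<and> (\<forall>\<tau>. mellin (C f) \<tau> = b \<tau> * mellin f \<tau>)" if "f \<in> core" for f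
    using MultD(2,3)[OF B that] by (simp add: core_def mellin_def l[OF that])
  ultimately show ?thesis by (simp add: Mult_def)
qed

lemma L2norm_eq_0_if_mellin:
  assumes "f \<in> core" "\<And>\<tau>. mellin f \<tau> = 0" shows "L2norm f = 0"
  using mellin_isometry(3)[OF assms(1)] by (simp add: assms(2))

lemma zero_if_le_all:
  assumes "\<And>e::real. e > 0 \<Longrightarrow> x \<le> C * e" "x \<ge> 0" "C > 0"
  shows "x = 0"
proof (rule ccontr)
  assume "x \<noteq> 0"
  hence "x > 0" using assms by simp
  hence "x \<le> C * (x / (2 * C))" using assms by (intro assms) auto
  thus False using \<open>x > 0\<close> assms(3) by (simp add: field_simps)
qed

text \<open>On the core the difference of the images has transform \<open>0\<close>, so it vanishes
  by the isometry; an approximant within \<open>e\<close> costs only the two operator norms times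
  \<open>e\<close>.\<close>

theorem Mult_unique:
  assumes B: "Mult B b" and C: "Mult C b" and f: "f \<in> L2"
  shows "ae_eq (B f) (C f)"
proof -
  note b = MultD(1)[OF B] and c = MultD(1)[OF C]
  note BL = bounded_opD(1)[OF b] and CL = bounded_opD(1)[OF c]
  obtain K where K: "K > 0" "\<And>f. f \<in> L2 \<Longrightarrow> L2norm (B f) \<le> K * L2norm f" using bounded_op_norm[OF b] by metis
  obtain K' where K': "K' > 0" "\<And>f. f \<in> L2 \<Longrightarrow> L2norm (C f) \<le> K' * L2norm f" using bounded_op_norm[OF c] by metis
  have "L2norm (\<lambda>x. B f x - C f x) = 0"
  proof (rule zero_if_le_all[where C="K + K'"])
    fix e :: real assume "e > 0"
    then obtain g where g: "g \<in> core" "L2norm (\<lambda>x. f x - g x) < e" using core_dense[OF f] by metis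
    note gL = mellin_isometry(1)[OF g(1)]
    have "L2norm (\<lambda>x. B f x - C f x) \<le> L2norm (\<lambda>x. B f x - B g x) + L2norm (\<lambda>x. B g x - C f x)"
      by (intro L2norm_diff_triangle BL CL f gL)
    also have "L2norm (\<lambda>x. B g x - C f x) \<le> L2norm (\<lambda>x. B g x - C g x) + L2norm (\<lambda>x. C g x - C f x)"
      by (intro L2norm_diff_triangle BL CL f gL)
    also have "L2norm (\<lambda>x. B g x - C g x) = 0"
      using MultD(2,3)[OF B g(1)] MultD(2,3)[OF C g(1)]
      by (intro L2norm_eq_0_if_mellin core_diff) (auto simp: mellin_diff)
    also have "L2norm (\<lambda>x. B f x - B g x) \<le> K * L2norm (\<lambda>x. f x - g x)"
      by (rule bounded_op_diff_norm[OF b K(2) f gL])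
    also have "L2norm (\<lambda>x. C g x - C f x) \<le> K' * L2norm (\<lambda>x. g x - f x)"
      by (rule bounded_op_diff_norm[OF c K'(2) gL f])
    also have "L2norm (\<lambda>x. g x - f x) = L2norm (\<lambda>x. f x - g x)" by (rule L2norm_minus_commute)
    also have "K * L2norm (\<lambda>x. f x - g x) + (0 + K' * L2norm (\<lambda>x. f x - g x)) = (K + K') * L2norm (\<lambda>x. f x - g x)"
      by (simp add: distrib_right)
    also have "\<dots> \<le> (K + K') * e" using K(1) K'(1) g(2) by (intro mult_left_mono) auto
    finally show "L2norm (\<lambda>x. B f x - C f x) \<le> (K + K') * e" by simp
  qed (use K K' L2norm_nonneg in auto)
  thus ?thesis using ae_eq_iff_L2norm[OF BL[OF f] CL[OF f]] by simp
qed

section \<open>Inner products, limits and adjoints\<close>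

lemma polarization:
  "4 * (a * cnj b) = of_real ((cmod (a + b))\<^sup>2) - of_real ((cmod (a - b))\<^sup>2)
    + \<i> * of_real ((cmod (a + \<i> * b))\<^sup>2) - \<i> * of_real ((cmod (a - \<i> * b))\<^sup>2)"
  unfolding complex_norm_square by (simp add: algebra_simps)

lemma ip_polarization:
  assumes "f \<in> L2" "g \<in> L2"
  shows "4 * ip f g = of_real ((L2norm (\<lambda>x. f x + g x))\<^sup>2) - of_real ((L2norm (\<lambda>x. f x - g x))\<^sup>2)
    + \<i> * of_real ((L2norm (\<lambda>x. f x + \<i> * g x))\<^sup>2) - \<i> * of_real ((L2norm (\<lambda>x. f x - \<i> * g x))\<^sup>2)"
proof -
  note L = L2_add[OF assms] L2_diff[OF assms] L2_add[OF assms(1) L2_cmult[OF assms(2), of \<i>]]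
    L2_diff[OF assms(1) L2_cmult[OF assms(2), of \<i>]]
  have "4 * ip f g = (LINT x|M0. 4 * (f x * cnj (g x)))" unfolding ip_def by simp
  also have "\<dots> = of_real ((L2norm (\<lambda>x. f x + g x))\<^sup>2) - of_real ((L2norm (\<lambda>x. f x - g x))\<^sup>2)
    + \<i> * of_real ((L2norm (\<lambda>x. f x + \<i> * g x))\<^sup>2) - \<i> * of_real ((L2norm (\<lambda>x. f x - \<i> * g x))\<^sup>2)"
    unfolding polarization L2norm_sq integral_complex_of_real[symmetric]
    using L[THEN L2_int, THEN integrable_of_real[where 'a=complex]]
    by (simp del: of_real_power integral_complex_of_real add: Bochner_Integration.integral_diff)
  finally show ?thesis .
qed

text \<open>Polarization on both sides reduces this to the norm identity for
  \<open>f + c * g\<close> with \<open>c\<close> a fourth root of unity.\<close>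

lemma mellin_ip:
  assumes f: "f \<in> core" and g: "g \<in> core"
  shows "integrable lborel (\<lambda>\<tau>. mellin f \<tau> * cnj (mellin g \<tau>))"
    "(LINT \<tau>|lborel. mellin f \<tau> * cnj (mellin g \<tau>)) = 2 * pi * ip f g"
proof -
  show "integrable lborel (\<lambda>\<tau>. mellin f \<tau> * cnj (mellin g \<tau>))"
    using mellin_isometry(2)[OF f] mellin_isometry(2)[OF g] measurable_mellin[OF f] measurable_mellin[OF g]
    by (intro integrable_mult_square) auto
  note ig = core_cmult[OF g, of \<i>]
  note L = core_add[OF f g] core_diff[OF f g] core_add[OF f ig] core_diff[OF f ig]
  note I = L[THEN mellin_isometry(2), THEN integrable_of_real[where 'a=complex]]
  note E = L[THEN mellin_isometry(3)]
  have "4 * (LINT \<tau>|lborel. mellin f \<tau> * cnj (mellin g \<tau>)) = (LINT \<tau>|lborel. 4 * (mellin f \<tau> * cnj (mellin g \<tau>)))"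
    by simp
  also have "\<dots> = 2 * pi * (4 * ip f g)"
    unfolding polarization ip_polarization[OF mellin_isometry(1)[OF f] mellin_isometry(1)[OF g]]
    using I E[THEN arg_cong[where f=complex_of_real]]
    by (simp add: mellin_add mellin_diff mellin_cmult f g ig algebra_simps Bochner_Integration.integral_diff
        del: of_real_power)
  finally show "(LINT \<tau>|lborel. mellin f \<tau> * cnj (mellin g \<tau>)) = 2 * pi * ip f g" by simp
qed

lemma ip_diff_bound:
  assumes "f \<in> L2" "f' \<in> L2" "g \<in> L2" "g' \<in> L2"
  shows "cmod (ip f g - ip f' g') \<le> L2norm (\<lambda>x. f x - f' x) * L2norm g + L2norm f' * L2norm (\<lambda>x. g x - g' x)"
proof -
  have "ip f g - ip f' g' = ip (\<lambda>x. f x - f' x) g + ip f' (\<lambda>x. g x - g' x)"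
    using assms by (simp add: ip_diff_left ip_diff_right)
  also have "cmod \<dots> \<le> L2norm (\<lambda>x. f x - f' x) * L2norm g + L2norm f' * L2norm (\<lambda>x. g x - g' x)"
    by (intro norm_triangle_mono ip_bound L2_diff assms)
  finally show ?thesis .
qed

lemma L2norm_tendsto_bounded:
  assumes "f \<in> L2" "\<And>n. F n \<in> L2" "(\<lambda>n. L2norm (\<lambda>x. F n x - f x)) \<longlonglongrightarrow> 0"
  shows "(\<lambda>n. L2norm (F n)) \<longlonglongrightarrow> L2norm f"
proof -
  have "\<bar>L2norm (F n) - L2norm f\<bar> \<le> L2norm (\<lambda>x. F n x - f x)" for n
    using L2norm_triangle[OF L2_diff[OF assms(2) assms(1), of n] assms(1)]
      L2norm_triangle[OF L2_diff[OF assms(1) assms(2), of n] assms(2)[of n]] L2norm_minus_commute[of "F n" f]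
    by simp
  hence "(\<lambda>n. L2norm (F n) - L2norm f) \<longlonglongrightarrow> 0"
    by (intro null_sequence_le[OF _ assms(3)]) simp
  thus ?thesis by (simp add: LIM_zero_iff)
qed

lemma ip_tendsto:
  assumes "f \<in> L2" "\<And>n. F n \<in> L2" "(\<lambda>n. L2norm (\<lambda>x. F n x - f x)) \<longlonglongrightarrow> 0"
    "g \<in> L2" "\<And>n. G n \<in> L2" "(\<lambda>n. L2norm (\<lambda>x. G n x - g x)) \<longlonglongrightarrow> 0"
  shows "(\<lambda>n. ip (F n) (G n)) \<longlonglongrightarrow> ip f g"
proof -
  have "(\<lambda>n. L2norm (\<lambda>x. F n x - f x) * L2norm (G n) + L2norm f * L2norm (\<lambda>x. G n x - g x)) \<longlonglongrightarrow>
     0 * L2norm g + L2norm f * 0"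
    by (intro tendsto_intros assms L2norm_tendsto_bounded)
  hence lim: "(\<lambda>n. L2norm (\<lambda>x. F n x - f x) * L2norm (G n) + L2norm f * L2norm (\<lambda>x. G n x - g x)) \<longlonglongrightarrow> 0"
    by simp
  have "(\<lambda>n. ip (F n) (G n) - ip f g) \<longlonglongrightarrow> 0"
    using ip_diff_bound[OF assms(2) assms(1) assms(5) assms(4)] by (rule null_sequence_le[OF _ lim])
  thus ?thesis by (simp add: LIM_zero_iff)
qed

lemma bounded_op_tendsto:
  assumes B: "bounded_op_on L2 B" and f: "f \<in> L2" "\<And>n. F n \<in> L2" "(\<lambda>n. L2norm (\<lambda>x. F n x - f x)) \<longlonglongrightarrow> 0"
  shows "(\<lambda>n. L2norm (\<lambda>x. B (F n) x - B f x)) \<longlonglongrightarrow> 0"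
proof -
  obtain K where K: "K > 0" "\<And>f. f \<in> L2 \<Longrightarrow> L2norm (B f) \<le> K * L2norm f" using bounded_op_norm[OF B] by metis
  have lim: "(\<lambda>n. K * L2norm (\<lambda>x. F n x - f x)) \<longlonglongrightarrow> 0" by (intro tendsto_mult_right_zero f)
  have "norm (L2norm (\<lambda>x. B (F n) x - B f x)) \<le> K * L2norm (\<lambda>x. F n x - f x)" for n
    using bounded_op_diff_norm[OF B K(2) f(2) f(1), of n] L2norm_nonneg by simp
  thus ?thesis by (rule null_sequence_le[OF _ lim])
qed

text \<open>The geometric rate makes successive differences summable, which is what almost
  everywhere convergence of the associated densities will need.\<close>

lemma core_approx:
  assumes f: "f \<in> L2"
  obtains F where "\<And>n::nat. F n \<in> core" "\<And>n. L2norm (\<lambda>x. F n x - f x) < (1/2) ^ n"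
    "(\<lambda>n. L2norm (\<lambda>x. F n x - f x)) \<longlonglongrightarrow> 0"
proof -
  obtain F where F: "\<And>n::nat. F n \<in> core" "\<And>n. L2norm (\<lambda>x. f x - F n x) < (1/2) ^ n"
    by (rule core_sequence[OF f, of "\<lambda>n. (1/2) ^ n"]) auto
  have *: "L2norm (\<lambda>x. F n x - f x) < (1/2) ^ n" for n
    using F(2)[of n] L2norm_minus_commute[of f "F n"] by simp
  have "(\<lambda>n. L2norm (\<lambda>x. F n x - f x)) \<longlonglongrightarrow> 0"
    by (rule null_sequence_le[where g="\<lambda>n. (1/2) ^ n"])
       (use less_imp_le[OF *] L2norm_nonneg in \<open>auto intro!: LIMSEQ_power_zero\<close>)
  thus ?thesis using that F(1) * by blast
qed

text \<open>On the core both sides are, up to the factor \<open>2 * pi\<close>, the integral of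
  \<open>b\<close> times one transform times the conjugate of the other; both sides are continuous
  in \<open>f\<close> and \<open>g\<close>.\<close>

theorem Mult_adjoint:
  assumes B: "Mult B b" and C: "Mult C (\<lambda>\<tau>. cnj (b \<tau>))" and f: "f \<in> L2" and g: "g \<in> L2"
  shows "ip (B f) g = ip f (C g)"
proof -
  note b = MultD(1)[OF B] and c = MultD(1)[OF C]
  obtain F where F: "\<And>n::nat. F n \<in> core" "(\<lambda>n. L2norm (\<lambda>x. F n x - f x)) \<longlonglongrightarrow> 0"
    using core_approx[OF f] by metis
  obtain G where G: "\<And>n::nat. G n \<in> core" "(\<lambda>n. L2norm (\<lambda>x. G n x - g x)) \<longlonglongrightarrow> 0"
    using core_approx[OF g] by metis
  note FL = mellin_isometry(1)[OF F(1)] and GL = mellin_isometry(1)[OF G(1)]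
  have "2 * pi * ip (B (F n)) (G n) = 2 * pi * ip (F n) (C (G n))" for n
    unfolding mellin_ip(2)[OF MultD(2)[OF B F(1)] G(1), symmetric] mellin_ip(2)[OF F(1) MultD(2)[OF C G(1)], symmetric]
    by (intro Bochner_Integration.integral_cong) (simp_all add: MultD(3)[OF B F(1)] MultD(3)[OF C G(1)])
  hence eq: "ip (B (F n)) (G n) = ip (F n) (C (G n))" for n by simp
  have "(\<lambda>n. ip (B (F n)) (G n)) \<longlonglongrightarrow> ip (B f) g"
    by (intro ip_tendsto bounded_op_tendsto[OF b] f FL F g GL G bounded_opD(1)[OF b])
  moreover have "(\<lambda>n. ip (F n) (C (G n))) \<longlonglongrightarrow> ip f (C g)"
    by (intro ip_tendsto bounded_op_tendsto[OF c] f FL F g GL G bounded_opD(1)[OF c])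
  ultimately show ?thesis unfolding eq by (rule LIMSEQ_unique)
qed

section \<open>Densities of spectral measures\<close>

text \<open>The Riesz-Fischer argument: with summable increments the telescoping series converges
  absolutely almost everywhere, and its sum of absolute values gives an integrable majorant
  \<open>w\<close> of the whole sequence, available for later dominated convergence.\<close>

lemma L1_fast_limit:
  fixes r :: "nat \<Rightarrow> 'a \<Rightarrow> real"
  assumes r: "\<And>n. integrable M (r n)" and s: "summable (\<lambda>n. LINT x|M. \<bar>r (Suc n) x - r n x\<bar>)"
  obtains \<rho> w where "\<rho> \<in> borel_measurable M" "integrable M w"
    "AE x in M. (\<lambda>n. r n x) \<longlonglongrightarrow> \<rho> x" "AE x in M. \<forall>n. \<bar>r n x\<bar> \<le> w x"
proof -
  have [measurable]: "r n \<in> borel_measurable M" for n using r[of n] by simp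
  define d where "d = (\<lambda>n x. r (Suc n) x - r n x)"
  have [measurable]: "d n \<in> borel_measurable M" for n unfolding d_def by measurable
  have di: "integrable M (\<lambda>x. \<bar>d n x\<bar>)" for n unfolding d_def using r by simp
  have "(\<integral>\<^sup>+x. (\<Sum>n. ennreal \<bar>d n x\<bar>) \<partial>M) = (\<Sum>n. \<integral>\<^sup>+x. ennreal \<bar>d n x\<bar> \<partial>M)"
    by (intro nn_integral_suminf) measurable
  also have "\<dots> = (\<Sum>n. ennreal (LINT x|M. \<bar>d n x\<bar>))"
    using di by (simp add: nn_integral_eq_integral)
  also have "\<dots> < top" using s unfolding d_def by (subst suminf_ennreal2) auto
  finally have "AE x in M. (\<Sum>n. ennreal \<bar>d n x\<bar>) \<noteq> \<infinity>"
    by (intro nn_integral_PInf_AE) auto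
  hence sm: "AE x in M. summable (\<lambda>n. \<bar>d n x\<bar>)"
    by eventually_elim (auto intro: summable_suminf_not_top)
  define w where "w = (\<lambda>x. \<bar>r 0 x\<bar> + (\<Sum>n. \<bar>d n x\<bar>))"
  have tel: "r n x = r 0 x + (\<Sum>i<n. d i x)" for n x
    unfolding d_def by (subst sum_lessThan_telescope) simp
  show ?thesis
  proof (rule that[of "\<lambda>x. r 0 x + (\<Sum>n. d n x)" w])
    show "integrable M w"
      unfolding w_def using sm di s r unfolding d_def
      by (intro Bochner_Integration.integrable_add integrable_abs r integrable_suminf) auto
    show "AE x in M. (\<lambda>n. r n x) \<longlonglongrightarrow> r 0 x + (\<Sum>n. d n x)"
      using sm
    proof eventually_elim
      case (elim x)
      hence "summable (\<lambda>n. d n x)" by (rule summable_rabs_cancel)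
      hence "(\<lambda>n. r 0 x + (\<Sum>i<n. d i x)) \<longlonglongrightarrow> r 0 x + (\<Sum>n. d n x)"
        by (intro tendsto_intros summable_LIMSEQ)
      thus ?case by (subst tel)
    qed
    show "AE x in M. \<forall>n. \<bar>r n x\<bar> \<le> w x"
      using sm
    proof (eventually_elim, intro allI)
      fix x n assume *: "summable (\<lambda>n. \<bar>d n x\<bar>)"
      have "\<bar>r n x\<bar> \<le> \<bar>r 0 x\<bar> + \<bar>\<Sum>i<n. d i x\<bar>" by (subst tel) (rule abs_triangle_ineq)
      also have "\<bar>\<Sum>i<n. d i x\<bar> \<le> (\<Sum>i<n. \<bar>d i x\<bar>)" by (rule sum_abs)
      also have "\<dots> \<le> (\<Sum>n. \<bar>d n x\<bar>)" by (intro sum_le_suminf *) auto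
      finally show "\<bar>r n x\<bar> \<le> w x" by (simp add: w_def)
    qed
  qed measurable
qed

lemma cmod_square_diff: "\<bar>(cmod a)\<^sup>2 - (cmod b)\<^sup>2\<bar> \<le> cmod (a - b) * cmod a + cmod (a - b) * cmod b"
proof -
  have "\<bar>(cmod a)\<^sup>2 - (cmod b)\<^sup>2\<bar> = \<bar>cmod a - cmod b\<bar> * (cmod a + cmod b)"
    by (simp add: power2_eq_square square_diff_square_factored abs_mult)
  also have "\<dots> \<le> cmod (a - b) * (cmod a + cmod b)"
    by (intro mult_right_mono norm_triangle_ineq3) auto
  finally show ?thesis by (simp add: distrib_left)
qed

text \<open>This is the continuity of \<open>f \<mapsto> |mellin f|^2\<close> from \<open>L2\<close>
  to \<open>L1\<close>: factor the difference of squares, then apply Cauchy-Schwarz and the isometry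
  to each term.\<close>

lemma mellin_square_diff:
  assumes f: "f \<in> core" and g: "g \<in> core"
  shows "(LINT \<tau>|lborel. \<bar>(cmod (mellin f \<tau>))\<^sup>2 - (cmod (mellin g \<tau>))\<^sup>2\<bar>) \<le>
     2 * pi * (L2norm (\<lambda>x. f x - g x) * (L2norm f + L2norm g))"
proof -
  note d = core_diff[OF f g]
  note I = f[THEN mellin_isometry(2)] g[THEN mellin_isometry(2)] d[THEN mellin_isometry(2)]
  note m = f[THEN measurable_mellin] g[THEN measurable_mellin] d[THEN measurable_mellin]
  note m' = m[unfolded measurable_lborel2[symmetric]]
  have n: "sqrt (LINT \<tau>|lborel. (cmod (mellin h \<tau>))\<^sup>2) = sqrt (2 * pi) * L2norm h" if "h \<in> core" for h
    using mellin_isometry(3)[OF that] L2norm_nonneg[of h] by (simp add: real_sqrt_mult)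
  have i: "integrable lborel (\<lambda>\<tau>. cmod (mellin (\<lambda>x. f x - g x) \<tau>) * cmod (mellin f \<tau>))"
     "integrable lborel (\<lambda>\<tau>. cmod (mellin (\<lambda>x. f x - g x) \<tau>) * cmod (mellin g \<tau>))"
    using I m by (auto intro!: integrable_mult_square(1))
  have "(LINT \<tau>|lborel. \<bar>(cmod (mellin f \<tau>))\<^sup>2 - (cmod (mellin g \<tau>))\<^sup>2\<bar>) \<le>
    (LINT \<tau>|lborel. cmod (mellin (\<lambda>x. f x - g x) \<tau>) * cmod (mellin f \<tau>) +
       cmod (mellin (\<lambda>x. f x - g x) \<tau>) * cmod (mellin g \<tau>))"
    using I i by (intro integral_mono integrable_abs Bochner_Integration.integrable_diff Bochner_Integration.integrable_add)
      (auto simp: mellin_diff[OF f g] cmod_square_diff)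
  also have "\<dots> = (LINT \<tau>|lborel. cmod (mellin (\<lambda>x. f x - g x) \<tau>) * cmod (mellin f \<tau>)) +
     (LINT \<tau>|lborel. cmod (mellin (\<lambda>x. f x - g x) \<tau>) * cmod (mellin g \<tau>))"
    by (rule Bochner_Integration.integral_add[OF i])
  also have "\<dots> \<le> (sqrt (2 * pi) * L2norm (\<lambda>x. f x - g x)) * (sqrt (2 * pi) * L2norm f) +
      (sqrt (2 * pi) * L2norm (\<lambda>x. f x - g x)) * (sqrt (2 * pi) * L2norm g)"
    unfolding n[OF f, symmetric] n[OF g, symmetric] n[OF d, symmetric]
    by (intro add_mono Cauchy_Schwarz_integral I m')
  also have "\<dots> = (sqrt (2 * pi) * sqrt (2 * pi)) * (L2norm (\<lambda>x. f x - g x) * (L2norm f + L2norm g))"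
    by (simp only: algebra_simps)
  also have "sqrt (2 * pi) * sqrt (2 * pi) = 2 * pi" by (subst real_sqrt_mult_self) simp
  finally show ?thesis .
qed

text \<open>Only the density of the spectral measure is extended from the core to all of \<open>L2\<close>, not the
  Mellin transform itself: it is the \<open>L1\<close> limit of the densities of approximants in the core.\<close>

theorem spectral_density:
  assumes f: "f \<in> L2"
  obtains \<rho> :: "real \<Rightarrow> real" where "\<And>\<tau>. \<rho> \<tau> \<ge> 0" "\<rho> \<in> borel_measurable borel" "integrable lborel \<rho>"
    "\<And>B b K. Mult B b \<Longrightarrow> b \<in> borel_measurable borel \<Longrightarrow> (\<And>\<tau>. cmod (b \<tau>) \<le> K) \<Longrightarrow>
       ip (B f) f = (LINT \<tau>|lborel. b \<tau> * of_real (\<rho> \<tau>))"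
proof -
  obtain F where F: "\<And>n::nat. F n \<in> core" "\<And>n. L2norm (\<lambda>x. F n x - f x) < (1/2) ^ n"
    "(\<lambda>n. L2norm (\<lambda>x. F n x - f x)) \<longlonglongrightarrow> 0"
    by (rule core_approx[OF f]) blast
  note FL = mellin_isometry(1)[OF F(1)]
  \<comment> \<open>Division by \<open>2 * pi\<close> absorbs the Plancherel constant:
    \<open>r n\<close> has total mass equal to the square of \<open>L2norm (F n)\<close>.\<close>
  define r where "r = (\<lambda>n \<tau>. (cmod (mellin (F n) \<tau>))\<^sup>2 / (2 * pi))"
  have ri: "integrable lborel (r n)" for n
    unfolding r_def using mellin_isometry(2)[OF F(1)] by simp
  have [measurable]: "r n \<in> borel_measurable borel" for n using ri[of n] by simp
  have Fb: "L2norm (F n) \<le> L2norm f + 1" for n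
  proof -
    have "L2norm (F n) \<le> L2norm (\<lambda>x. F n x - f x) + L2norm f"
      using L2norm_triangle[OF L2_diff[OF FL f] f, of n] by simp
    moreover have "(1/2::real) ^ n \<le> 1" by (intro power_le_one) auto
    ultimately show ?thesis using F(2)[of n] by linarith
  qed
  have dd: "(LINT \<tau>|lborel. \<bar>r (Suc n) \<tau> - r n \<tau>\<bar>) \<le> (4 * (L2norm f + 1)) * (1/2) ^ n" for n
  proof -
    have "(LINT \<tau>|lborel. \<bar>r (Suc n) \<tau> - r n \<tau>\<bar>) =
      (LINT \<tau>|lborel. \<bar>(cmod (mellin (F (Suc n)) \<tau>))\<^sup>2 - (cmod (mellin (F n) \<tau>))\<^sup>2\<bar> / (2 * pi))"
      unfolding r_def diff_divide_distrib[symmetric] abs_divide by simp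
    also have "\<dots> = (LINT \<tau>|lborel. \<bar>(cmod (mellin (F (Suc n)) \<tau>))\<^sup>2 - (cmod (mellin (F n) \<tau>))\<^sup>2\<bar>) / (2 * pi)"
      by (rule integral_divide_zero)
    also have "\<dots> \<le> (2 * pi * (L2norm (\<lambda>x. F (Suc n) x - F n x) * (L2norm (F (Suc n)) + L2norm (F n)))) / (2 * pi)"
      by (intro divide_right_mono mellin_square_diff F) simp
    also have "\<dots> = L2norm (\<lambda>x. F (Suc n) x - F n x) * (L2norm (F (Suc n)) + L2norm (F n))"
      by simp
    also have "\<dots> \<le> (2 * (1/2) ^ n) * (2 * (L2norm f + 1))"
    proof (intro mult_mono)
      have "L2norm (\<lambda>x. F (Suc n) x - F n x) \<le> L2norm (\<lambda>x. F (Suc n) x - f x) + L2norm (\<lambda>x. f x - F n x)"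
        by (intro L2norm_diff_triangle f FL)
      also have "\<dots> \<le> (1/2) ^ Suc n + (1/2) ^ n"
        using F(2)[of "Suc n"] F(2)[of n] L2norm_minus_commute[of f "F n"] by linarith
      also have "\<dots> \<le> 2 * (1/2) ^ n" by simp
      finally show "L2norm (\<lambda>x. F (Suc n) x - F n x) \<le> 2 * (1/2) ^ n" .
      show "L2norm (F (Suc n)) + L2norm (F n) \<le> 2 * (L2norm f + 1)" using Fb[of n] Fb[of "Suc n"] by simp
    qed (auto intro!: add_nonneg_nonneg L2norm_nonneg)
    also have "\<dots> = (4 * (L2norm f + 1)) * (1/2) ^ n" by (simp add: algebra_simps)
    finally show ?thesis .
  qed
  have "summable (\<lambda>n. LINT \<tau>|lborel. \<bar>r (Suc n) \<tau> - r n \<tau>\<bar>)"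
    by (rule summable_comparison_test'[where N=0 and g="\<lambda>n. (4 * (L2norm f + 1)) * (1/2) ^ n"])
       (use dd in \<open>auto intro!: summable_mult summable_geometric\<close>)
  then obtain \<rho>0 w where \<rho>0 [measurable]: "\<rho>0 \<in> borel_measurable lborel" and w: "integrable lborel w"
    and lim: "AE \<tau> in lborel. (\<lambda>n. r n \<tau>) \<longlonglongrightarrow> \<rho>0 \<tau>" and bd: "AE \<tau> in lborel. \<forall>n. \<bar>r n \<tau>\<bar> \<le> w \<tau>"
    by (rule L1_fast_limit[OF ri])
  \<comment> \<open>The limit \<open>\<rho>0\<close> is nonnegative only almost everywhere; the
    absolute value makes the density nonnegative at every point.\<close>
  define \<rho> where "\<rho> = (\<lambda>\<tau>. \<bar>\<rho>0 \<tau>\<bar>)"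
  have [measurable]: "\<rho> \<in> borel_measurable borel" using \<rho>0 unfolding \<rho>_def by simp
  have lim': "AE \<tau> in lborel. (\<lambda>n. r n \<tau>) \<longlonglongrightarrow> \<rho> \<tau>"
    using lim
  proof eventually_elim
    case (elim \<tau>)
    have "\<rho>0 \<tau> \<ge> 0" by (rule LIMSEQ_le_const[OF elim]) (simp add: r_def)
    thus ?case using elim by (simp add: \<rho>_def)
  qed
  show ?thesis
  proof (rule that[of \<rho>])
    show "integrable lborel \<rho>"
    proof (rule integrable_dominated_convergence[of \<rho> lborel r w])
      show "AE \<tau> in lborel. norm (r n \<tau>) \<le> w \<tau>" for n using bd by eventually_elim simp
    qed (use w lim' in auto)
    fix B b K assume B: "Mult B b" and b [measurable]: "b \<in> borel_measurable borel" and K: "\<And>\<tau>. cmod (b \<tau>) \<le> K"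
    have "(\<lambda>n. ip (B (F n)) (F n)) \<longlonglongrightarrow> ip (B f) f"
      by (intro ip_tendsto bounded_op_tendsto[OF MultD(1)[OF B]] f FL F bounded_opD(1)[OF MultD(1)[OF B]])
    moreover have "ip (B (F n)) (F n) = (LINT \<tau>|lborel. b \<tau> * of_real (r n \<tau>))" for n
    proof -
      have "2 * pi * ip (B (F n)) (F n) = (LINT \<tau>|lborel. mellin (B (F n)) \<tau> * cnj (mellin (F n) \<tau>))"
        by (rule mellin_ip(2)[OF MultD(2)[OF B F(1)] F(1), symmetric])
      also have "\<dots> = (LINT \<tau>|lborel. 2 * pi * (b \<tau> * of_real (r n \<tau>)))"
        by (intro Bochner_Integration.integral_cong refl)
           (simp add: r_def MultD(3)[OF B F(1)] complex_norm_square del: of_real_power)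
      also have "\<dots> = 2 * pi * (LINT \<tau>|lborel. b \<tau> * of_real (r n \<tau>))" by simp
      finally show ?thesis by simp
    qed
    moreover have "(\<lambda>n. LINT \<tau>|lborel. b \<tau> * of_real (r n \<tau>)) \<longlonglongrightarrow> (LINT \<tau>|lborel. b \<tau> * of_real (\<rho> \<tau>))"
    proof (rule integral_dominated_convergence[where w="\<lambda>\<tau>. K * w \<tau>"])
      show "AE \<tau> in lborel. (\<lambda>n. b \<tau> * of_real (r n \<tau>)) \<longlonglongrightarrow> b \<tau> * of_real (\<rho> \<tau>)"
        using lim' by eventually_elim (intro tendsto_intros)
      show "AE \<tau> in lborel. norm (b \<tau> * of_real (r n \<tau>)) \<le> K * w \<tau>" for n
        using bd by eventually_elim (auto simp: norm_mult intro!: mult_mono K order.trans[OF norm_ge_zero K])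
    qed (use w in auto)
    ultimately show "ip (B f) f = (LINT \<tau>|lborel. b \<tau> * of_real (\<rho> \<tau>))"
      using LIMSEQ_unique by simp
  qed (auto simp: \<rho>_def)
qed

section \<open>The symbol of the iterated averaging operators\<close>

text \<open>For \<open>a = k + 1/2\<close> the operator \<open>conv_op (exp_kernel a)\<close> sends
  \<open>f\<close> to \<open>x^(-k-1) \<integral>_0^x t^k f(t) dt\<close>; support in
  \<open>u \<ge> 0\<close> corresponds to integrating over \<open>t \<le> x\<close> only.\<close>

definition exp_kernel :: "complex \<Rightarrow> real \<Rightarrow> complex" where
  "exp_kernel a u = (if u \<ge> 0 then exp (- a * of_real u) else 0)"

lemma exp_decay: "r > 0 \<Longrightarrow> ((\<lambda>u::real. exp (- (r * u))) \<longlongrightarrow> 0) at_top"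
  by real_asymp

lemma exp_integral_halfline:
  assumes a: "Re a > 0"
  shows "integrable lborel (exp_kernel a)" "(LINT u|lborel. exp_kernel a u) = 1 / a"
proof -
  have [measurable]: "exp_kernel a \<in> borel_measurable borel" unfolding exp_kernel_def by measurable
  have set: "set_integrable lborel {0<..} (\<lambda>u. exp (- a * of_real u))"
  proof -
    have "set_integrable lborel {0<..} (\<lambda>x. exp (-(x * Re a)))"
      by (rule integrable_I0i_exp_mscale[OF a])
    thus ?thesis
      unfolding set_integrable_def
      by (rule Bochner_Integration.integrable_bound) (auto simp: indicator_def mult.commute)
  qed
  have ae: "AE u in lborel. exp_kernel a u = indicator {0<..} u *\<^sub>R exp (- a * of_real u)"
    using AE_lborel_singleton[of "0::real"] by eventually_elim (auto simp: exp_kernel_def indicator_def)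
  show "integrable lborel (exp_kernel a)"
    by (subst integrable_cong_AE[OF _ _ ae]) (use set in \<open>auto simp: set_integrable_def\<close>)
  have a0: "a \<noteq> 0" using a by auto
  have "(LBINT u=0..\<infinity>. exp (- a * of_real u)) = 0 - (- 1 / a)"
  proof (rule interval_integral_FTC_integrable[where F="\<lambda>u. - exp (- a * of_real u) / a"])
    show "((\<lambda>u. - exp (- a * of_real u) / a) has_vector_derivative exp (- a * of_real x)) (at x)" for x :: real
    proof -
      have "((\<lambda>z. - exp (- a * z) / a) has_field_derivative exp (- a * of_real x)) (at (of_real x))"
        using a0 by (auto intro!: derivative_eq_intros)
      from has_vector_derivative_real_field[OF this] show ?thesis by (simp add: o_def)
    qed
    have "((\<lambda>u. - exp (- a * of_real u) / a) \<longlongrightarrow> - exp (- a * of_real 0) / a) (at_right (0::real))"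
      by (intro tendsto_intros a0)
    thus "(((\<lambda>u. - exp (- a * of_real u) / a) \<circ> real_of_ereal) \<longlongrightarrow> - 1 / a) (at_right 0)"
      by (simp add: zero_ereal_def ereal_tendsto_simps1)
    have "((\<lambda>u. exp (- (Re a * u)) / cmod a) \<longlongrightarrow> 0 / cmod a) at_top"
    proof (intro tendsto_divide tendsto_const)
      show "((\<lambda>u. exp (- (Re a * u))) \<longlongrightarrow> 0) at_top"
        by (rule exp_decay[OF a])
    qed (use a0 in simp)
    hence "((\<lambda>u. - exp (- a * of_real u) / a) \<longlongrightarrow> 0) at_top"
      by (subst tendsto_norm_zero_iff[symmetric]) (simp add: norm_divide)
    thus "(((\<lambda>u. - exp (- a * of_real u) / a) \<circ> real_of_ereal) \<longlongrightarrow> 0) (at_left \<infinity>)"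
      by (simp add: ereal_tendsto_simps1)
    show "set_integrable lborel (einterval 0 \<infinity>) (\<lambda>u. exp (- a * of_real u))"
      using set by (simp add: zero_ereal_def)
  qed (auto intro!: continuous_intros)
  hence "1 / a = (LINT u|lborel. indicator {0<..} u *\<^sub>R exp (- a * of_real u))"
    by (simp add: zero_ereal_def interval_integral_to_infinity_eq set_lebesgue_integral_def)
  also have "\<dots> = (LINT u|lborel. exp_kernel a u)"
    by (intro integral_cong_AE) (use ae in \<open>auto elim: eventually_mono\<close>)
  finally show "(LINT u|lborel. exp_kernel a u) = 1 / a" by simp
qed

lemma kernel_exp_kernel:
  assumes a: "Re a > 0"
  shows "kernel (exp_kernel a)" "fourier (exp_kernel a) \<tau> = 1 / (a + \<i> * of_real \<tau>)"
proof -
  have [measurable]: "exp_kernel a \<in> borel_measurable borel" unfolding exp_kernel_def by measurable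
  have "(cmod (exp_kernel a u))\<^sup>2 = cmod (exp_kernel (2 * a) u)" for u
    by (simp add: exp_kernel_def power2_eq_square mult_exp_exp)
  thus "kernel (exp_kernel a)"
    using exp_integral_halfline(1)[OF a] integrable_norm[OF exp_integral_halfline(1)[of "2 * a"]] a
    by (simp add: kernel_def)
  have "exp_kernel a t * iexp (- (\<tau> * t)) = exp_kernel (a + \<i> * of_real \<tau>) t" for t
    by (simp add: exp_kernel_def mult_exp_exp algebra_simps)
  thus "fourier (exp_kernel a) \<tau> = 1 / (a + \<i> * of_real \<tau>)"
    using exp_integral_halfline(2)[of "a + \<i> * of_real \<tau>"] a by (simp add: fourier_def)
qed

lemma kernel_reflect:
  assumes k: "kernel k"
  shows "kernel (\<lambda>u. k (- u))" "fourier (\<lambda>u. k (- u)) \<tau> = fourier k (- \<tau>)"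
proof -
  have [measurable]: "k \<in> borel_measurable borel" using k by (simp add: kernel_def)
  show "kernel (\<lambda>u. k (- u))"
    using k lborel_integrable_real_affine_iff[of "-1" k 0]
      lborel_integrable_real_affine_iff[of "-1" "\<lambda>t. (cmod (k t))\<^sup>2" 0] by (simp add: kernel_def)
  show "fourier (\<lambda>u. k (- u)) \<tau> = fourier k (- \<tau>)"
    unfolding fourier_def by (subst lborel_integral_real_affine[of "-1" _ 0]) auto
qed

lemma Mult_symbol_cong: "Mult B b \<Longrightarrow> (\<And>\<tau>. b \<tau> = c \<tau>) \<Longrightarrow> Mult B c"
  by (simp add: Mult_def)

text \<open>These are the resolvents of the generator \<open>x d/dx + 1/2\<close> of dilations, whose symbol is \<open>i \<tau>\<close>.\<close>

lemma resolvent_exists: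
  assumes "Re a \<noteq> 0"
  obtains B where "Mult B (\<lambda>\<tau>. 1 / (a + \<i> * of_real \<tau>))"
proof (cases "Re a > 0")
  case True
  have "Mult (conv_op (exp_kernel a)) (\<lambda>\<tau>. 1 / (a + \<i> * of_real \<tau>))"
    by (rule Mult_symbol_cong[OF Mult_conv_op[OF kernel_exp_kernel(1)[OF True]] kernel_exp_kernel(2)[OF True]])
  thus ?thesis by (rule that)
next
  case False
  hence a: "Re (- a) > 0" using assms by simp
  note k = kernel_exp_kernel[OF a]
  \<comment> \<open>With negative real part the kernel must live on the other half-line. Reflecting
    \<open>exp_kernel (- a)\<close> replaces \<open>\<tau>\<close> by \<open>- \<tau>\<close>, and
    \<open>1 / (a + \<i> * \<tau>)\<close> is minus
    \<open>1 / (- a - \<i> * \<tau>)\<close>.\<close>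
  have "Mult (\<lambda>f x. (-1) * conv_op (\<lambda>u. exp_kernel (- a) (- u)) f x) (\<lambda>\<tau>. (-1) * fourier (\<lambda>u. exp_kernel (- a) (- u)) \<tau>)"
    by (intro Mult_comp[OF Mult_scalar] Mult_conv_op kernel_reflect k)
  moreover have "(-1) * fourier (\<lambda>u. exp_kernel (- a) (- u)) \<tau> = 1 / (a + \<i> * of_real \<tau>)" for \<tau>
  proof -
    have "fourier (\<lambda>u. exp_kernel (- a) (- u)) \<tau> = 1 / (- (a + \<i> * of_real \<tau>))"
      by (simp add: kernel_reflect(2)[OF k(1)] k(2))
    thus ?thesis by (simp only: divide_minus_right) simp
  qed
  ultimately have "Mult (\<lambda>f x. (-1) * conv_op (\<lambda>u. exp_kernel (- a) (- u)) f x) (\<lambda>\<tau>. 1 / (a + \<i> * of_real \<tau>))"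
    by (rule Mult_symbol_cong)
  thus ?thesis by (rule that)
qed

section \<open>The operators \<open>Tn\<close> and their symbols\<close>

definition symbol :: "nat \<Rightarrow> real \<Rightarrow> complex" where
  "symbol n \<tau> = (\<Prod>k<n. 1 / (of_nat k + 1/2 + \<i> * of_real \<tau>))"

text \<open>For \<open>t > 0\<close> the \<open>n\<close>-fold primitive is
  \<open>t ^ n * Tn n f t\<close>, so one further integration followed by division by
  \<open>x ^ Suc n\<close> is an average of \<open>Tn n f\<close> with weight
  \<open>t ^ n / x ^ Suc n\<close>, an exponential kernel in \<open>ln (x / t)\<close>.\<close>

lemma Tn_Suc:
  assumes f: "Tn n f \<in> L2" and x: "x > 0"
  shows "Tn (Suc n) f x = conv_op (exp_kernel (of_nat n + 1/2)) (Tn n f) x"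
proof -
  define h where "h = (Iop ^^ n) f"
  \<comment> \<open>Measurability of the \<open>n\<close>-fold primitive is known only on the
    positive axis, so it is replaced by \<open>0\<close> elsewhere. The interval
    \<open>{0..x}\<close> contains the origin, whose value is kept as a separate term until it is
    discarded as a null set.\<close>
  define h' where "h' = (\<lambda>t. if t \<in> {0<..} then of_real (t ^ n) * Tn n f t else 0)"
  have Th: "Tn n f t = h t / of_real (t ^ n)" for t by (simp add: Tn_def h_def)
  have h: "h t = of_real (t ^ n) * Tn n f t" if "t > 0" for t
    using that by (simp add: Th)
  have h'_meas [measurable]: "h' \<in> borel_measurable lebesgue"
    unfolding h'_def
  proof (intro borel_measurable_if_I)
    note [measurable] = L2_meas[OF f]
    have "(\<lambda>t. complex_of_real (t ^ n)) \<in> borel_measurable M0" by (intro borel_measurable_M0) measurable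
    thus "(\<lambda>t. complex_of_real (t ^ n) * Tn n f t) \<in> borel_measurable M0" by measurable
  qed simp
  have ind: "indicat_real S \<in> borel_measurable lebesgue" if "S \<in> sets borel" for S :: "real set"
    using that by (intro measurable_completion) simp
  have [measurable]: "indicat_real {..x} \<in> borel_measurable lebesgue" "indicat_real {0::real} \<in> borel_measurable lebesgue"
    "indicat_real {0::real<..} \<in> borel_measurable lebesgue" by (auto intro!: ind)
  have "(LINT t:{0..x}|lebesgue. h t) = (LINT t|lebesgue. indicator {..x} t *\<^sub>R (h' t + indicator {0} t *\<^sub>R h 0))"
    unfolding set_lebesgue_integral_def
    by (intro Bochner_Integration.integral_cong) (auto simp: indicator_def h'_def h)
  also have "\<dots> = (LINT t|lebesgue. indicator {0<..} t *\<^sub>R (indicator {..x} t *\<^sub>R h' t))"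
  proof (rule integral_cong_AE)
    show "AE t in lebesgue. indicator {..x} t *\<^sub>R (h' t + indicator {0} t *\<^sub>R h 0) =
        indicator {0<..} t *\<^sub>R (indicator {..x} t *\<^sub>R h' t)"
      using AE_lborel_singleton[of "0::real", THEN AE_completion]
      by eventually_elim (auto simp: indicator_def h'_def)
  qed measurable
  also have "\<dots> = (LINT t|M0. indicator {..x} t *\<^sub>R h' t)"
    by (subst integral_restrict_space) auto
  finally have I: "(LINT t:{0..x}|lebesgue. h t) = (LINT t|M0. indicator {..x} t *\<^sub>R h' t)" .
  have "Tn (Suc n) f x = (LINT t|M0. indicator {..x} t *\<^sub>R h' t) / of_real (x ^ Suc n)"
    using I by (simp add: Tn_def Iop_def h_def)
  also have "\<dots> = (LINT t|M0. (indicator {..x} t *\<^sub>R h' t) / of_real (x ^ Suc n))" by simp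
  also have "\<dots> = conv_op (exp_kernel (of_nat n + 1/2)) (Tn n f) x"
    unfolding conv_op_def
  proof (intro Bochner_Integration.integral_cong refl)
    fix t assume "t \<in> space M0"
    hence t: "t > 0" by simp
    show "(indicator {..x} t *\<^sub>R h' t) / of_real (x ^ Suc n) =
      exp_kernel (of_nat n + 1 / 2) (ln (x / t)) / of_real (sqrt (x * t)) * Tn n f t"
    proof (cases "t \<le> x")
      case True
      hence l: "ln (x / t) \<ge> 0" using t x by simp
      have "- (of_nat n + 1 / 2) * complex_of_real (ln (x / t)) = of_real (- (real n + 1 / 2) * ln (x / t))"
        by simp
      hence "exp_kernel (of_nat n + 1 / 2) (ln (x / t)) = of_real (exp (- (real n + 1 / 2) * ln (x / t)))"
        using l unfolding exp_kernel_def by (simp only: exp_of_real if_True)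
      also have "exp (- (real n + 1 / 2) * ln (x / t)) = exp (real n * ln (t / x)) * exp (ln (t / x) / 2)"
        using t x by (simp add: ln_div mult_exp_exp algebra_simps add_divide_distrib diff_divide_distrib)
      also have "exp (real n * ln (t / x)) = (t / x) ^ n" using t x by (simp add: exp_of_nat_mult)
      also have "exp (ln (t / x) / 2) = sqrt (t / x)" using t x by (simp add: ln_sqrt[symmetric])
      finally have k: "exp_kernel (of_nat n + 1 / 2) (ln (x / t)) = of_real ((t / x) ^ n * sqrt (t / x))" .
      have "(t / x) ^ n * sqrt (t / x) / sqrt (x * t) = t ^ n / x ^ Suc n"
        using t x by (simp add: real_sqrt_divide real_sqrt_mult power_divide field_simps)
      hence "exp_kernel (of_nat n + 1 / 2) (ln (x / t)) / of_real (sqrt (x * t)) = of_real (t ^ n / x ^ Suc n)"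
        unfolding k by (simp only: of_real_divide[symmetric])
      thus ?thesis using t True by (simp add: h'_def)
    next
      case False
      hence "ln (x / t) < 0" using t x by simp
      thus ?thesis using False by (simp add: exp_kernel_def)
    qed
  qed
  finally show ?thesis .
qed

theorem Mult_Tn: "Mult (Tn n) (symbol n)"
proof (induction n)
  case 0
  have "Mult (Tn 0) (\<lambda>\<tau>. 1)" by (rule Mult_cong[OF Mult_id]) (simp add: Tn_def)
  thus ?case by (simp add: symbol_def[abs_def])
next
  case (Suc n)
  have "Re (of_nat n + 1 / 2) > 0" by (simp add: add_nonneg_pos)
  note k = kernel_exp_kernel[OF this]
  have "Mult (Tn (Suc n)) (\<lambda>\<tau>. fourier (exp_kernel (of_nat n + 1/2)) \<tau> * symbol n \<tau>)"
    by (rule Mult_cong[OF Mult_comp[OF Mult_conv_op[OF k(1)] Suc]])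
       (intro Tn_Suc bounded_opD(1)[OF MultD(1)[OF Suc]])
  thus ?case by (rule Mult_symbol_cong) (simp add: k(2) symbol_def mult.commute)
qed

text \<open>The conjugate of \<open>1 / (k + 1/2 + \<i> * \<tau>)\<close> is
  \<open>- 1 / (- (k + 1/2) + \<i> * \<tau>)\<close>, a resolvent at a point of the opposite
  half-plane. The adjoint is thus a product of reflected exponential kernels.\<close>

lemma Mult_cnj_symbol:
  obtains A where "Mult A (\<lambda>\<tau>. cnj (symbol n \<tau>))"
proof -
  have "\<exists>A. Mult A (\<lambda>\<tau>. cnj (symbol n \<tau>))"
  proof (induction n)
    case 0
    show ?case using Mult_id by (auto simp: symbol_def)
  next
    case (Suc n)
    then obtain A where A: "Mult A (\<lambda>\<tau>. cnj (symbol n \<tau>))" by blast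
    let ?a = "- (of_nat n + 1 / 2) :: complex"
    have "Re ?a = - (real n + 1 / 2)" by simp
    hence "Re ?a \<noteq> 0" using of_nat_0_le_iff[of n, where 'a=real] by linarith
    then obtain R where R: "Mult R (\<lambda>\<tau>. 1 / (?a + \<i> * of_real \<tau>))" by (rule resolvent_exists)
    have eq: "(-1) * (1 / (?a + \<i> * of_real \<tau>)) * cnj (symbol n \<tau>) = cnj (symbol (Suc n) \<tau>)" for \<tau>
    proof -
      have "(-1) * (1 / (?a + \<i> * of_real \<tau>)) = 1 / (- (?a + \<i> * of_real \<tau>))"
        unfolding divide_minus_right by simp
      also have "\<dots> = cnj (1 / (of_nat n + 1 / 2 + \<i> * of_real \<tau>))" by simp
      finally show ?thesis by (simp add: symbol_def mult.commute)
    qed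
    show ?case
      by (rule exI, rule Mult_symbol_cong[OF Mult_comp[OF Mult_comp[OF Mult_scalar R] A] eq])
  qed
  thus ?thesis using that by blast
qed

lemma symbol_denominator: "cmod (of_nat k + 1/2 + \<i> * of_real \<tau>) ^ 2 = (real k + 1/2)\<^sup>2 + \<tau>\<^sup>2"
  by (simp add: cmod_power2)

lemma symbol_denominator_ne_0: "of_nat k + 1/2 + \<i> * of_real \<tau> \<noteq> (0::complex)"
proof
  assume "of_nat k + 1/2 + \<i> * of_real \<tau> = (0::complex)"
  hence "Re (of_nat k + 1/2 + \<i> * of_real \<tau>) = Re 0" by (rule arg_cong)
  thus False using of_nat_0_le_iff[of k, where 'a=real] by simp
qed

lemma continuous_symbol: "continuous_on UNIV (symbol n)"
  unfolding symbol_def using symbol_denominator_ne_0 by (intro continuous_intros) auto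

lemma measurable_symbol [measurable]: "symbol n \<in> borel_measurable borel"
  by (intro borel_measurable_continuous_onI continuous_symbol)

lemma symbol_factor_le: "cmod (1 / (of_nat k + 1/2 + \<i> * of_real \<tau>)) \<le> 2"
proof -
  have "1/2 \<le> Re (of_nat k + 1/2 + \<i> * of_real \<tau>)" by simp
  also have "\<dots> \<le> cmod (of_nat k + 1/2 + \<i> * of_real \<tau>)" by (rule complex_Re_le_cmod)
  finally show ?thesis by (simp add: norm_divide divide_simps)
qed

lemma symbol_bound: "cmod (symbol n \<tau>) \<le> 2 ^ n"
proof -
  have "cmod (symbol n \<tau>) \<le> (\<Prod>k<n. 2)"
    unfolding symbol_def prod_norm[symmetric] by (intro prod_mono conjI symbol_factor_le) auto
  thus ?thesis by simp
qed

lemma symbol_ne_0: "symbol n \<tau> \<noteq> 0"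
  unfolding symbol_def using symbol_denominator_ne_0 by simp

lemma symbol_minus: "symbol n (- \<tau>) = cnj (symbol n \<tau>)"
  by (simp add: symbol_def)

section \<open>Growth of the modulus and preimages of Hausdorff null sets\<close>

text \<open>This is \<open>1 / |symbol n \<tau>|^2\<close>. As a product of terms increasing in
  \<open>\<tau>^2\<close> it makes strict monotonicity of the modulus quantitative without
  differentiation.\<close>

definition inv_modulus :: "nat \<Rightarrow> real \<Rightarrow> real" where
  "inv_modulus n \<tau> = (\<Prod>k<n. (real k + 1/2)\<^sup>2 + \<tau>\<^sup>2)"

lemma symbol_modulus: "(cmod (symbol n \<tau>))\<^sup>2 * inv_modulus n \<tau> = 1"
proof -
  have nz: "(real k + 1/2)\<^sup>2 + \<tau>\<^sup>2 \<noteq> 0" for k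
    using of_nat_0_le_iff[of k, where 'a=real] by (simp add: sum_power2_eq_zero_iff)
  have "(cmod (symbol n \<tau>))\<^sup>2 = (\<Prod>k<n. 1 / ((real k + 1/2)\<^sup>2 + \<tau>\<^sup>2))"
    unfolding symbol_def prod_norm[symmetric] prod_power_distrib
    by (simp add: norm_divide power_divide symbol_denominator)
  hence "(cmod (symbol n \<tau>))\<^sup>2 * inv_modulus n \<tau> =
      (\<Prod>k<n. 1 / ((real k + 1/2)\<^sup>2 + \<tau>\<^sup>2) * ((real k + 1/2)\<^sup>2 + \<tau>\<^sup>2))"
    unfolding inv_modulus_def by (simp only: prod.distrib)
  also have "\<dots> = 1" using nz by simp
  finally show ?thesis .
qed

text \<open>The factor \<open>k = 0\<close> is \<open>1/4 + \<tau>^2\<close>, whose increment is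
  \<open>(\<tau> - \<sigma>) * (\<tau> + \<sigma>)\<close> with
  \<open>\<tau> + \<sigma> \<ge> 2 * \<delta>\<close>. The remaining factors are at least
  \<open>1\<close> and nondecreasing, so they can only enlarge it.\<close>

lemma inv_modulus_growth:
  assumes "0 < \<delta>" "\<delta> \<le> \<sigma>" "\<sigma> \<le> \<tau>"
  shows "2 * \<delta> * (\<tau> - \<sigma>) \<le> inv_modulus (Suc n) \<tau> - inv_modulus (Suc n) \<sigma>"
proof -
  let ?R = "\<lambda>\<tau>. (\<Prod>k<n. (real (Suc k) + 1/2)\<^sup>2 + \<tau>\<^sup>2)"
  let ?q = "\<lambda>\<tau>::real. (1/2)\<^sup>2 + \<tau>\<^sup>2"
  have split: "inv_modulus (Suc n) t = ?q t * ?R t" for t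
    unfolding inv_modulus_def by (subst prod.lessThan_Suc_shift) simp
  have q: "?q \<tau> - ?q \<sigma> = (\<tau> - \<sigma>) * (\<tau> + \<sigma>)" by (simp add: algebra_simps power2_eq_square)
  have "?R \<sigma> \<ge> 1"
  proof (intro prod_ge_1)
    fix k
    have "1\<^sup>2 \<le> (real (Suc k) + 1/2)\<^sup>2" by (intro power_mono) auto
    with zero_le_power2[of \<sigma>] show "1 \<le> (real (Suc k) + 1/2)\<^sup>2 + \<sigma>\<^sup>2"
      unfolding power_one by linarith
  qed
  moreover have "?R \<sigma> \<le> ?R \<tau>" using assms by (intro prod_mono) (auto intro!: power_mono)
  moreover have "2 * \<delta> * (\<tau> - \<sigma>) \<le> ?q \<tau> - ?q \<sigma>"
    unfolding q using assms by (subst mult.commute) (intro mult_left_mono, auto)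
  moreover have "0 \<le> 2 * \<delta> * (\<tau> - \<sigma>)" using assms by simp
  ultimately have "2 * \<delta> * (\<tau> - \<sigma>) * 1 \<le> (?q \<tau> - ?q \<sigma>) * ?R \<sigma>" by (intro mult_mono) auto
  also have "\<dots> \<le> ?q \<tau> * ?R \<tau> - ?q \<sigma> * ?R \<sigma>"
    unfolding left_diff_distrib by (intro diff_right_mono mult_left_mono \<open>?R \<sigma> \<le> ?R \<tau>\<close>) simp
  finally show ?thesis by (simp add: split)
qed

lemma inv_modulus_mono: "0 \<le> \<sigma> \<Longrightarrow> \<sigma> \<le> \<tau> \<Longrightarrow> inv_modulus n \<sigma> \<le> inv_modulus n \<tau>"
  unfolding inv_modulus_def by (intro prod_mono) (auto intro!: power_mono)

lemma inv_modulus_nonneg: "0 \<le> inv_modulus n \<tau>"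
  unfolding inv_modulus_def by (intro prod_nonneg) auto

lemma symbol_expanding_le:
  assumes "0 < \<delta>" "\<delta> \<le> \<sigma>" "\<sigma> \<le> \<tau>" "\<tau> \<le> R"
  shows "2 * \<delta> * (\<tau> - \<sigma>) \<le> (2 * 2 ^ Suc n * (inv_modulus (Suc n) R)\<^sup>2) * cmod (symbol (Suc n) \<sigma> - symbol (Suc n) \<tau>)"
proof -
  let ?m = "symbol (Suc n)" and ?Q = "inv_modulus (Suc n)"
  note sm = symbol_modulus[of "Suc n"]
  have "2 * \<delta> * (\<tau> - \<sigma>) \<le> ?Q \<tau> - ?Q \<sigma>" by (rule inv_modulus_growth[OF assms(1-3)])
  \<comment> \<open>Both inserted products equal \<open>1\<close> by \<open>sm\<close>; they turn a
    difference of reciprocals into a difference of squared moduli, which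
    \<open>|m \<sigma> - m \<tau>|\<close> controls.\<close>
  also have "\<dots> = ?Q \<tau> * ((cmod (?m \<sigma>))\<^sup>2 * ?Q \<sigma>) - ((cmod (?m \<tau>))\<^sup>2 * ?Q \<tau>) * ?Q \<sigma>" by (simp add: sm)
  also have "\<dots> = ((cmod (?m \<sigma>))\<^sup>2 - (cmod (?m \<tau>))\<^sup>2) * (?Q \<sigma> * ?Q \<tau>)" by (simp add: algebra_simps)
  also have "\<dots> \<le> (2 * 2 ^ Suc n * cmod (?m \<sigma> - ?m \<tau>)) * (?Q R * ?Q R)"
  proof (intro mult_mono)
    have "(cmod (?m \<sigma>))\<^sup>2 - (cmod (?m \<tau>))\<^sup>2 \<le> cmod (?m \<sigma> - ?m \<tau>) * cmod (?m \<sigma>) + cmod (?m \<sigma> - ?m \<tau>) * cmod (?m \<tau>)"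
      using cmod_square_diff[of "?m \<sigma>" "?m \<tau>"] by linarith
    also have "\<dots> \<le> cmod (?m \<sigma> - ?m \<tau>) * 2 ^ Suc n + cmod (?m \<sigma> - ?m \<tau>) * 2 ^ Suc n"
      by (intro add_mono mult_left_mono symbol_bound) auto
    finally show "(cmod (?m \<sigma>))\<^sup>2 - (cmod (?m \<tau>))\<^sup>2 \<le> 2 * 2 ^ Suc n * cmod (?m \<sigma> - ?m \<tau>)" by simp
    show "?Q \<sigma> \<le> ?Q R" "?Q \<tau> \<le> ?Q R" using assms by (auto intro!: inv_modulus_mono)
  qed (auto intro!: inv_modulus_nonneg mult_nonneg_nonneg)
  finally show ?thesis by (simp add: power2_eq_square mult_ac)
qed

text \<open>The interval has to stay away from \<open>0\<close>: the modulus is even and has a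
  stationary point there, and the constant obtained grows like \<open>1 / \<delta>\<close>.\<close>

lemma symbol_expanding:
  assumes n: "n \<ge> 1" and d: "0 < \<delta>"
  obtains L where "L > 0" "\<And>\<sigma> \<tau>. \<sigma> \<in> {\<delta>..R} \<Longrightarrow> \<tau> \<in> {\<delta>..R} \<Longrightarrow> \<bar>\<sigma> - \<tau>\<bar> \<le> L * cmod (symbol n \<sigma> - symbol n \<tau>)"
proof -
  obtain m where m: "n = Suc m" using n by (cases n) auto
  define C where "C = 2 * 2 ^ n * (inv_modulus n R)\<^sup>2 / (2 * \<delta>)"
  have C: "C \<ge> 0" unfolding C_def using d by simp
  have *: "\<tau> - \<sigma> \<le> C * cmod (symbol n \<sigma> - symbol n \<tau>)" if "\<delta> \<le> \<sigma>" "\<sigma> \<le> \<tau>" "\<tau> \<le> R" for \<sigma> \<tau>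
    using symbol_expanding_le[OF d that, of m] d unfolding C_def m by (simp add: field_simps)
  show ?thesis
  proof (rule that[of "C + 1"])
    fix \<sigma> \<tau> assume s: "\<sigma> \<in> {\<delta>..R}" "\<tau> \<in> {\<delta>..R}"
    have "\<bar>\<sigma> - \<tau>\<bar> \<le> C * cmod (symbol n \<sigma> - symbol n \<tau>)"
      using *[of \<sigma> \<tau>] *[of \<tau> \<sigma>] s by (cases "\<sigma> \<le> \<tau>") (auto simp: norm_minus_commute)
    also have "\<dots> \<le> (C + 1) * cmod (symbol n \<sigma> - symbol n \<tau>)" by (intro mult_right_mono) auto
    finally show "\<bar>\<sigma> - \<tau>\<bar> \<le> (C + 1) * cmod (symbol n \<sigma> - symbol n \<tau>)" .
  qed (use C in simp)
qed

text \<open>Since \<open>h\<close> contracts distances by at most the factor \<open>L\<close>, the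
  preimage of a piece \<open>C i\<close> lies within \<open>L * diameter (C i)\<close> of any of its
  points, hence in an interval of length \<open>2 * L * diameter (C i)\<close>. This also dictates
  the threshold \<open>e / (2 * L)\<close> for the cover.\<close>

lemma H1_null_preimage:
  fixes h :: "real \<Rightarrow> complex"
  assumes L: "L > 0" and exp: "\<And>\<sigma> \<tau>. \<sigma> \<in> S \<Longrightarrow> \<tau> \<in> S \<Longrightarrow> \<bar>\<sigma> - \<tau>\<bar> \<le> L * cmod (h \<sigma> - h \<tau>)"
    and A: "H1_null A"
  shows "emeasure lborel {\<tau> \<in> S. h \<tau> \<in> A} = 0"
proof -
  have le: "emeasure lborel {\<tau> \<in> S. h \<tau> \<in> A} \<le> ennreal e" if e: "e > 0" for e
  proof -
    have "e / (2 * L) > 0" using e L by simp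
    from A[unfolded H1_null_def, rule_format, OF this] obtain C :: "nat \<Rightarrow> complex set" where C: "A \<subseteq> (\<Union>i. C i)" "\<And>i. bounded (C i)"
      "summable (\<lambda>i. diameter (C i))" "(\<Sum>i. diameter (C i)) < e / (2 * L)"
      by (elim exE conjE) blast
    define t where "t = (\<lambda>i. SOME \<tau>. \<tau> \<in> S \<and> h \<tau> \<in> C i)"
    define J where "J = (\<lambda>i. {t i - L * diameter (C i)..t i + L * diameter (C i)})"
    have dn: "diameter (C i) \<ge> 0" for i by (rule diameter_ge_0[OF C(2)])
    have "{\<tau> \<in> S. h \<tau> \<in> A} \<subseteq> (\<Union>i. J i)"
    proof safe
      fix \<tau> assume \<tau>: "\<tau> \<in> S" "h \<tau> \<in> A"
      then obtain i where i: "h \<tau> \<in> C i" using C(1) by blast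
      hence t: "t i \<in> S \<and> h (t i) \<in> C i" 
        unfolding t_def using someI[of "\<lambda>\<tau>. \<tau> \<in> S \<and> h \<tau> \<in> C i" \<tau>] \<tau> by blast
      have "\<bar>\<tau> - t i\<bar> \<le> L * cmod (h \<tau> - h (t i))" using exp \<tau> t by blast
      also have "\<dots> \<le> L * diameter (C i)"
        using diameter_bounded_bound[OF C(2) i, of "h (t i)"] t L by (intro mult_left_mono) (auto simp: dist_norm)
      finally have "\<tau> \<in> J i" by (auto simp: J_def abs_le_iff)
      thus "\<tau> \<in> (\<Union>i. J i)" by blast
    qed
    hence "emeasure lborel {\<tau> \<in> S. h \<tau> \<in> A} \<le> emeasure lborel (\<Union>i. J i)"
      by (intro emeasure_mono) (auto simp: J_def)
    also have "\<dots> \<le> (\<Sum>i. emeasure lborel (J i))"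
      by (intro emeasure_subadditive_countably) (auto simp: J_def)
    also have "\<dots> = (\<Sum>i. ennreal (2 * L * diameter (C i)))"
      using dn L by (intro suminf_cong) (simp add: J_def)
    also have "\<dots> = ennreal (\<Sum>i. 2 * L * diameter (C i))"
      using dn L C(3) by (intro suminf_ennreal2) (auto intro: summable_mult)
    also have "(\<Sum>i. 2 * L * diameter (C i)) = 2 * L * (\<Sum>i. diameter (C i))"
      by (rule suminf_mult[OF C(3)])
    also have "\<dots> \<le> e" using C(4) L by (simp add: field_simps)
    finally show ?thesis by (simp add: ennreal_leI)
  qed
  show ?thesis
  proof (rule ccontr)
    assume nz: "emeasure lborel {\<tau> \<in> S. h \<tau> \<in> A} \<noteq> 0"
    have "emeasure lborel {\<tau> \<in> S. h \<tau> \<in> A} \<le> 0"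
      by (rule ennreal_le_epsilon) (use le in auto)
    thus False using nz by simp
  qed
qed

text \<open>The expansion constants degenerate at \<open>0\<close> and at infinity, so the line is
  exhausted by the intervals \<open>[1 / Suc j, Suc j]\<close>, their mirror images and the origin.
  The mirror images are handled by \<open>symbol_minus\<close>, as conjugation preserves
  distances.\<close>

theorem symbol_preimage_null:
  assumes n: "n \<ge> 1" and A: "A \<in> sets borel" "H1_null A"
  shows "emeasure lborel (symbol n -` A) = 0"
proof -
  define P where "P = (\<lambda>j::nat. {\<tau> \<in> {1 / real (Suc j)..real (Suc j)}. symbol n \<tau> \<in> A})"
  define N where "N = (\<lambda>j::nat. {\<tau> \<in> {- real (Suc j).. - 1 / real (Suc j)}. symbol n \<tau> \<in> A})"
  have [measurable]: "A \<in> sets borel" by (rule A(1))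
  have Ps: "P j \<in> sets lborel" "N j \<in> sets lborel" for j unfolding P_def N_def by measurable
  have Pn: "emeasure lborel (P j) = 0" and Nn: "emeasure lborel (N j) = 0" for j
  proof -
    obtain L where L: "L > 0" "\<And>\<sigma> \<tau>. \<sigma> \<in> {1 / real (Suc j)..real (Suc j)} \<Longrightarrow> \<tau> \<in> {1 / real (Suc j)..real (Suc j)}
        \<Longrightarrow> \<bar>\<sigma> - \<tau>\<bar> \<le> L * cmod (symbol n \<sigma> - symbol n \<tau>)"
      by (rule symbol_expanding[OF n, of "1 / real (Suc j)" "real (Suc j)"]) auto
    show "emeasure lborel (P j) = 0" unfolding P_def by (rule H1_null_preimage[OF L A(2)])
    show "emeasure lborel (N j) = 0" unfolding N_def
    proof (rule H1_null_preimage[OF L(1) _ A(2)])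
      fix \<sigma> \<tau> assume "\<sigma> \<in> {- real (Suc j).. - 1 / real (Suc j)}" "\<tau> \<in> {- real (Suc j).. - 1 / real (Suc j)}"
      hence "\<bar>- \<sigma> - - \<tau>\<bar> \<le> L * cmod (symbol n (- \<sigma>) - symbol n (- \<tau>))"
        by (intro L(2)) auto
      thus "\<bar>\<sigma> - \<tau>\<bar> \<le> L * cmod (symbol n \<sigma> - symbol n \<tau>)"
        unfolding symbol_minus complex_cnj_diff[symmetric] complex_mod_cnj by simp
    qed
  qed
  have "P j \<in> null_sets lborel" "N j \<in> null_sets lborel" for j
    using Ps Pn Nn by (auto simp: null_sets_def)
  hence "(\<Union>j. P j) \<in> null_sets lborel" "(\<Union>j. N j) \<in> null_sets lborel"
    by (auto intro!: null_sets_UN)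
  hence U: "{0} \<union> (\<Union>j. P j) \<union> (\<Union>j. N j) \<in> null_sets lborel"
    by (intro null_sets.Un) auto
  have "symbol n -` A \<subseteq> {0} \<union> (\<Union>j. P j) \<union> (\<Union>j. N j)"
  proof
    fix \<tau> assume \<tau>: "\<tau> \<in> symbol n -` A"
    show "\<tau> \<in> {0} \<union> (\<Union>j. P j) \<union> (\<Union>j. N j)"
    proof (cases "\<tau> = 0")
      case False
      \<comment> \<open>One bound on the sum takes care of large and of small
        \<open>|\<tau>|\<close> simultaneously.\<close>
      obtain j where j: "\<bar>\<tau>\<bar> + 1 / \<bar>\<tau>\<bar> \<le> real j" using real_arch_simple by blast
      have "0 \<le> 1 / \<bar>\<tau>\<bar>" by simp
      hence 1: "\<bar>\<tau>\<bar> \<le> real (Suc j)" and "1 / \<bar>\<tau>\<bar> \<le> real (Suc j)" using j by linarith+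
      hence 2: "1 / real (Suc j) \<le> \<bar>\<tau>\<bar>" using False by (simp add: field_simps)
      have "\<tau> \<in> P j \<or> \<tau> \<in> N j"
        using 1 2 \<tau> False by (cases "\<tau> > 0") (auto simp: P_def N_def)
      thus ?thesis by blast
    qed simp
  qed
  thus ?thesis using null_sets_subset[OF U, of "symbol n -` A"] measurable_sets_borel[OF measurable_symbol A(1)]
    by auto
qed

section \<open>Spectral measures\<close>

text \<open>Polynomials in \<open>z\<close> and \<open>cnj z\<close>. They are generated by
  multiplication with one variable at a time, so that an induction over them merely shifts the
  exponents of a moment.\<close>

inductive zpoly :: "(complex \<Rightarrow> complex) \<Rightarrow> bool" where
  zpoly_const: "zpoly (\<lambda>z. c)"
| zpoly_z: "zpoly p \<Longrightarrow> zpoly (\<lambda>z. z * p z)"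
| zpoly_cnj: "zpoly p \<Longrightarrow> zpoly (\<lambda>z. cnj z * p z)"
| zpoly_add: "zpoly p \<Longrightarrow> zpoly q \<Longrightarrow> zpoly (\<lambda>z. p z + q z)"

lemma zpoly_cmult: "zpoly p \<Longrightarrow> zpoly (\<lambda>z. c * p z)"
proof (induction rule: zpoly.induct)
  case (zpoly_const d)
  show ?case by (rule zpoly.zpoly_const)
next
  case (zpoly_z p)
  from zpoly.zpoly_z[OF zpoly_z.IH] show ?case by (simp add: mult_ac)
next
  case (zpoly_cnj p)
  from zpoly.zpoly_cnj[OF zpoly_cnj.IH] show ?case by (simp add: mult_ac)
next
  case (zpoly_add p q)
  from zpoly.zpoly_add[OF zpoly_add.IH] show ?case by (simp add: distrib_left)
qed

lemma zpoly_mult: "zpoly p \<Longrightarrow> zpoly q \<Longrightarrow> zpoly (\<lambda>z. p z * q z)"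
proof (induction rule: zpoly.induct)
  case (zpoly_const d)
  thus ?case by (rule zpoly_cmult)
next
  case (zpoly_z p)
  from zpoly.zpoly_z[OF zpoly_z.IH[OF zpoly_z.prems]] show ?case by (simp add: mult_ac)
next
  case (zpoly_cnj p)
  from zpoly.zpoly_cnj[OF zpoly_cnj.IH[OF zpoly_cnj.prems]] show ?case by (simp add: mult_ac)
next
  case (zpoly_add p r)
  from zpoly.zpoly_add[OF zpoly_add.IH(1)[OF zpoly_add.prems] zpoly_add.IH(2)[OF zpoly_add.prems]]
  show ?case by (simp add: distrib_right)
qed

text \<open>A real linear form is \<open>f 1 * Re z + f \<i> * Im z\<close>, and
  \<open>Re z\<close>, \<open>Im z\<close> are complex combinations of \<open>z\<close> and
  \<open>cnj z\<close>; sums and products follow. This links the moments with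
  Stone-Weierstrass.\<close>

lemma zpoly_of_real_polynomial:
  "real_polynomial_function p \<Longrightarrow> zpoly (\<lambda>z. of_real (p z))"
proof (induction rule: real_polynomial_function.induct)
  case (linear f)
  interpret bounded_linear f by fact
  have eq: "of_real (f z) = (of_real (f 1) / 2 + - \<i> * of_real (f \<i>) / 2) * z +
     (of_real (f 1) / 2 + \<i> * of_real (f \<i>) / 2) * cnj z" for z
  proof -
    have "f z = f (Re z *\<^sub>R 1 + Im z *\<^sub>R \<i>)" by (rule arg_cong[where f=f]) (simp add: complex_eq_iff)
    also have "\<dots> = Re z * f 1 + Im z * f \<i>" by (simp only: add scaleR real_scaleR_def)
    finally show ?thesis by (simp add: complex_eq_iff algebra_simps)
  qed
  have z: "zpoly (\<lambda>z. z)" "zpoly cnj"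
    using zpoly_z[OF zpoly_const[of 1]] zpoly_cnj[OF zpoly_const[of 1]] by simp_all
  show ?case
    by (rule subst[of _ _ zpoly, OF ext[OF eq[symmetric]]]) (intro zpoly_add zpoly_cmult z)
qed (auto intro: zpoly_const zpoly_add zpoly_mult)

lemma zpoly_continuous: "zpoly p \<Longrightarrow> continuous_on UNIV p"
  by (induction rule: zpoly.induct) (auto intro!: continuous_intros)

text \<open>Support in a centred ball, in place of an arbitrary compact set, lets two measures be
  brought under one radius by enlarging it.\<close>

locale compact_measure =
  fixes \<mu> :: "complex measure" and R :: real
  assumes sets_eq [measurable_cong]: "sets \<mu> = sets borel" and fin: "finite_measure \<mu>"
    and supp: "emeasure \<mu> (UNIV - cball 0 R) = 0"
begin

sublocale finite_measure \<mu> by (rule fin)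

lemma space_eq: "space \<mu> = UNIV"
  using sets_eq_imp_space_eq[OF sets_eq] by simp

lemma AE_supp: "AE z in \<mu>. z \<in> cball 0 R"
  by (rule AE_I[where N="UNIV - cball 0 R"]) (auto simp: supp sets_eq)

lemma integrable_continuous:
  fixes \<phi> :: "complex \<Rightarrow> 'b::{banach, second_countable_topology}"
  assumes "continuous_on UNIV \<phi>"
  shows "integrable \<mu> \<phi>"
proof -
  have "compact (\<phi> ` cball 0 R)"
    by (intro compact_continuous_image continuous_on_subset[OF assms]) auto
  from compact_imp_bounded[OF this] obtain B where B: "\<forall>z\<in>\<phi> ` cball 0 R. norm z \<le> B"
    unfolding bounded_iff by blast
  show ?thesis
  proof (rule integrable_const_bound[of _ B])
    show "AE z in \<mu>. norm (\<phi> z) \<le> B" using AE_supp by eventually_elim (use B in blast)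
    show "\<phi> \<in> borel_measurable \<mu>"
      using borel_measurable_continuous_onI[OF assms] by (simp add: sets_eq cong: measurable_cong_sets)
  qed
qed

end

lemma compact_measure_of_spectral:
  assumes "is_spectral_measure T f \<mu>"
  obtains R where "\<And>R'. R' \<ge> R \<Longrightarrow> compact_measure \<mu> R'"
proof -
  obtain K where K: "compact K" "emeasure \<mu> (UNIV - K) = 0" and m: "sets \<mu> = sets borel" "finite_measure \<mu>"
    using assms unfolding is_spectral_measure_def by auto
  obtain R where R: "\<forall>z\<in>K. cmod z \<le> R"
    using compact_imp_bounded[OF K(1)] by (auto simp: bounded_iff)
  have "emeasure \<mu> (UNIV - cball 0 R') = 0" if "R' \<ge> R" for R'
  proof -
    have "emeasure \<mu> (UNIV - cball 0 R') \<le> emeasure \<mu> (UNIV - K)"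
      using R that compact_imp_closed[OF K(1)] m(1)
      by (intro emeasure_mono) (auto intro: order.trans)
    thus ?thesis using K by simp
  qed
  thus ?thesis using m that by (auto simp: compact_measure_def)
qed

text \<open>The equality is extended from moments to polynomials in \<open>z\<close> and
  \<open>cnj z\<close>, by uniform approximation on the ball to continuous functions, by increasing
  limits to open sets, and finally to Borel sets because the open sets form an intersection-stable
  generator. The moments with \<open>cnj z\<close> are essential, as powers of \<open>z\<close>
  alone are not dense.\<close>

theorem compact_measure_eqI:
  assumes M: "compact_measure \<mu> R" and N: "compact_measure \<nu> R"
    and mom: "\<And>j k::nat. (\<integral>z. z ^ j * cnj z ^ k \<partial>\<mu>) = (\<integral>z. z ^ j * cnj z ^ k \<partial>\<nu>)"
  shows "\<mu> = \<nu>"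
proof -
  interpret M: compact_measure \<mu> R by (rule M)
  interpret N: compact_measure \<nu> R by (rule N)
  have zp: "(\<integral>z. p z * (z ^ j * cnj z ^ k) \<partial>\<mu>) = (\<integral>z. p z * (z ^ j * cnj z ^ k) \<partial>\<nu>)" if "zpoly p" for p and j k :: nat
    using that
  proof (induction arbitrary: j k rule: zpoly.induct)
    case (zpoly_z p)
    from zpoly_z.IH[of "Suc j" k] show ?case by (simp add: mult_ac)
  next
    case (zpoly_cnj p)
    from zpoly_cnj.IH[of j "Suc k"] show ?case by (simp add: mult_ac)
  next
    case (zpoly_add p q)
    note c = zpoly_add.hyps[THEN zpoly_continuous]
    have "integrable \<mu> (\<lambda>z. p z * (z ^ j * cnj z ^ k))" "integrable \<mu> (\<lambda>z. q z * (z ^ j * cnj z ^ k))"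
      "integrable \<nu> (\<lambda>z. p z * (z ^ j * cnj z ^ k))" "integrable \<nu> (\<lambda>z. q z * (z ^ j * cnj z ^ k))"
      by (auto intro!: M.integrable_continuous N.integrable_continuous continuous_intros c)
    thus ?case using zpoly_add.IH by (simp add: distrib_right)
  qed (simp add: mom)
  have rp: "(\<integral>z. p z \<partial>\<mu>) = (\<integral>z. p z \<partial>\<nu>)" if "real_polynomial_function p" for p :: "complex \<Rightarrow> real"
  proof -
    have "complex_of_real (\<integral>z. p z \<partial>\<mu>) = complex_of_real (\<integral>z. p z \<partial>\<nu>)"
      using zp[OF zpoly_of_real_polynomial[OF that], of 0 0] by simp
    thus ?thesis by (simp only: of_real_eq_iff)
  qed
  have cont: "(\<integral>z. \<phi> z \<partial>\<mu>) = (\<integral>z. \<phi> z \<partial>\<nu>)" if \<phi>: "continuous_on UNIV \<phi>" for \<phi> :: "complex \<Rightarrow> real"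
  proof -
    let ?C = "measure \<mu> UNIV + measure \<nu> UNIV + 1"
    have C: "?C > 0" using measure_nonneg[of \<mu> UNIV] measure_nonneg[of \<nu> UNIV] by linarith
    have "\<bar>(\<integral>z. \<phi> z \<partial>\<mu>) - (\<integral>z. \<phi> z \<partial>\<nu>)\<bar> = 0"
    proof (rule zero_if_le_all[OF _ _ C])
      fix e :: real assume e: "e > 0"
      obtain p where p: "real_polynomial_function p" "\<And>z. z \<in> cball 0 R \<Longrightarrow> \<bar>\<phi> z - p z\<bar> < e"
        by (rule Stone_Weierstrass_real_polynomial_function[OF _ continuous_on_subset[OF \<phi>] e, of "cball 0 R"]) auto
      have pc: "continuous_on UNIV p" using p(1) continuous_real_polymonial_function
        by (auto simp: continuous_on_eq_continuous_at)
      have d: "\<bar>(\<integral>z. \<phi> z \<partial>\<kappa>) - (\<integral>z. p z \<partial>\<kappa>)\<bar> \<le> measure \<kappa> UNIV * e" if "compact_measure \<kappa> R" for \<kappa>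
      proof -
        interpret K: compact_measure \<kappa> R by (rule that)
        have i: "integrable \<kappa> \<phi>" "integrable \<kappa> p" by (intro K.integrable_continuous \<phi> pc)+
        have "\<bar>(\<integral>z. \<phi> z \<partial>\<kappa>) - (\<integral>z. p z \<partial>\<kappa>)\<bar> = \<bar>\<integral>z. \<phi> z - p z \<partial>\<kappa>\<bar>" using i by simp
        also have "\<dots> \<le> (\<integral>z. \<bar>\<phi> z - p z\<bar> \<partial>\<kappa>)" by (rule integral_abs_bound)
        also have "\<dots> \<le> (\<integral>z. e \<partial>\<kappa>)"
        proof (rule integral_mono_AE)
          show "AE z in \<kappa>. \<bar>\<phi> z - p z\<bar> \<le> e"
            using K.AE_supp by eventually_elim (use p(2) in \<open>auto intro: less_imp_le\<close>)
        qed (use i in auto)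
        finally show ?thesis by (simp add: K.space_eq)
      qed
      have "\<bar>(\<integral>z. \<phi> z \<partial>\<mu>) - (\<integral>z. \<phi> z \<partial>\<nu>)\<bar> \<le> measure \<mu> UNIV * e + measure \<nu> UNIV * e"
        using d[OF M] d[OF N] rp[OF p(1)] by linarith
      also have "\<dots> \<le> ?C * e" using e by (simp add: algebra_simps)
      finally show "\<bar>(\<integral>z. \<phi> z \<partial>\<mu>) - (\<integral>z. \<phi> z \<partial>\<nu>)\<bar> \<le> ?C * e" .
    qed simp
    thus ?thesis by simp
  qed
  have op: "emeasure \<mu> S = emeasure \<nu> S" if S: "open S" for S
  proof -
    \<comment> \<open>The case \<open>S = UNIV\<close> is separate because the distance to the empty
      complement is \<open>0\<close> by convention.\<close>
    define \<phi> where "\<phi> = (\<lambda>(n::nat) z. if S = UNIV then 1 else min 1 (real n * infdist z (- S)))"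
    have \<phi>c: "continuous_on UNIV (\<phi> n)" for n
      unfolding \<phi>_def by (cases "S = UNIV") (auto intro!: continuous_intros)
    have \<phi>l: "(\<lambda>n. \<phi> n z) \<longlonglongrightarrow> indicator S z" for z
    proof (cases "S = UNIV")
      case False
      hence ne: "- S \<noteq> {}" by blast
      show ?thesis
      proof (cases "z \<in> S")
        case True
        have d: "infdist z (- S) > 0"
          using infdist_pos_not_in_closed[of "- S" z] S ne True by (auto simp: closed_def)
        obtain N where N: "1 / infdist z (- S) \<le> real N" using real_arch_simple by blast
        have "\<forall>\<^sub>F n in sequentially. \<phi> n z = indicator S z"
          using eventually_ge_at_top[of N]
        proof eventually_elim
          case (elim n)
          hence "1 / infdist z (- S) \<le> real n" using N by simp
          hence "1 \<le> real n * infdist z (- S)" using d by (simp add: field_simps)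
          thus ?case using True by (simp add: \<phi>_def)
        qed
        thus ?thesis by (rule tendsto_eventually)
      qed (simp add: \<phi>_def False)
    qed (simp add: \<phi>_def)
    have lim: "(\<lambda>n. \<integral>z. \<phi> n z \<partial>\<kappa>) \<longlonglongrightarrow> measure \<kappa> S" if "compact_measure \<kappa> R" for \<kappa>
    proof -
      interpret K: compact_measure \<kappa> R by (rule that)
      have "S \<in> sets \<kappa>" using S by (simp add: K.sets_eq)
      hence "(\<lambda>n. \<integral>z. \<phi> n z \<partial>\<kappa>) \<longlonglongrightarrow> (\<integral>z. indicator S z \<partial>\<kappa>)"
        using \<phi>l K.integrable_continuous[OF \<phi>c]
        by (intro integral_dominated_convergence[where w="\<lambda>_. 1"]) (auto simp: \<phi>_def infdist_nonneg)
      thus ?thesis using \<open>S \<in> sets \<kappa>\<close> by (simp add: K.space_eq)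
    qed
    have "measure \<mu> S = measure \<nu> S"
      using LIMSEQ_unique[OF lim[OF M] ] lim[OF N] cont[OF \<phi>c] by simp
    thus ?thesis by (simp add: M.emeasure_eq_measure N.emeasure_eq_measure)
  qed
  show ?thesis
  proof (rule measure_eqI_generator_eq[where E="{S. open S}" and \<Omega>=UNIV and A="\<lambda>_. UNIV"])
    show "Int_stable {S::complex set. open S}" by (auto simp: Int_stable_def)
  qed (auto simp: op M.sets_eq N.sets_eq borel_def)
qed

lemma adjoint_unique:
  assumes T: "bounded_op_on L2 T" and A: "is_adjoint T A" and B: "is_adjoint T B" and g: "g \<in> L2"
  shows "ae_eq (A g) (B g)"
proof (rule ae_eq_from_ip)
  show "A g \<in> L2" "B g \<in> L2" using A B g by (auto simp: is_adjoint_def dest: bounded_opD(1))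
  show "ip h (A g) = ip h (B g)" if "h \<in> L2" for h
    using A B g that unfolding is_adjoint_def by metis
qed

lemma bounded_op_power: "bounded_op_on L2 B \<Longrightarrow> bounded_op_on L2 (B ^^ k)"
proof (induction k)
  case 0 thus ?case using bounded_op_scalar[of 1] by (simp add: id_def)
next
  case (Suc k) thus ?case using bounded_op_comp[of B "B ^^ k"] by (simp add: comp_def)
qed

text \<open>The moment condition on a spectral measure ranges over every adjoint, and adjoints are
  unique only almost everywhere; this makes the moments independent of the choice.\<close>

lemma adjoint_power_unique:
  assumes T: "bounded_op_on L2 T" and A: "is_adjoint T A" and B: "is_adjoint T B" and g: "g \<in> L2"
  shows "ae_eq ((A ^^ k) g) ((B ^^ k) g)"
proof (induction k)
  case (Suc k)
  have a: "bounded_op_on L2 A" and b: "bounded_op_on L2 B" using A B by (simp_all add: is_adjoint_def)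
  have L: "(A ^^ k) g \<in> L2" "(B ^^ k) g \<in> L2"
    by (intro bounded_opD(1)[OF bounded_op_power] a b g)+
  have "ae_eq (A ((A ^^ k) g)) (A ((B ^^ k) g))" by (rule bounded_opD(2)[OF a L Suc])
  from ae_eq_trans[OF this adjoint_unique[OF T A B L(2)]] show ?case by simp
qed simp

lemma H1_null_empty: "H1_null {}"
  unfolding H1_null_def by (intro allI impI exI[of _ "\<lambda>_. {}"]) auto

lemma H1_null_singleton: "H1_null {z}"
  unfolding H1_null_def by (intro allI impI exI[of _ "\<lambda>_. {z}"]) auto

section \<open>Normality, spectral measures and eigenvalues\<close>

lemma Tn_adjoint:
  obtains A where "Mult A (\<lambda>\<tau>. cnj (symbol n \<tau>))" "is_adjoint (Tn n) A"
proof -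
  obtain A where A: "Mult A (\<lambda>\<tau>. cnj (symbol n \<tau>))" by (rule Mult_cnj_symbol)
  have "is_adjoint (Tn n) A"
    unfolding is_adjoint_def using MultD(1)[OF A] Mult_adjoint[OF Mult_Tn A] by auto
  thus ?thesis using that A by blast
qed

text \<open>Both orders of composition have the symbol \<open>|m|^2\<close>.\<close>

theorem normal_Tn: "normal_op (Tn n)"
proof -
  obtain A where A: "Mult A (\<lambda>\<tau>. cnj (symbol n \<tau>))" "is_adjoint (Tn n) A" by (rule Tn_adjoint)
  have "Mult (\<lambda>f. Tn n (A f)) (\<lambda>\<tau>. cnj (symbol n \<tau>) * symbol n \<tau>)"
    by (rule Mult_symbol_cong[OF Mult_comp[OF Mult_Tn A(1)]]) simp
  hence "ae_eq (Tn n (A f)) (A (Tn n f))" if "f \<in> L2" for f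
    using Mult_unique[OF _ Mult_comp[OF A(1) Mult_Tn] that] by blast
  thus ?thesis unfolding normal_op_def using MultD(1)[OF Mult_Tn] A(2) by blast
qed

text \<open>The image of \<open>\<rho> d\<tau>\<close> under the symbol has the required moments,
  since products of powers of the operator and of its adjoint have symbols
  \<open>m ^ j * cnj m ^ k\<close>. Uniqueness identifies it with the definite description, and
  absolute continuity follows because preimages of \<open>H1_null\<close> sets are Lebesgue
  null.\<close>

theorem Tn_spectral_measure:
  assumes n: "n \<ge> 1" and f: "f \<in> L2"
  shows "is_spectral_measure (Tn n) f (spectral_measure (Tn n) f)" "abs_cont_meas (spectral_measure (Tn n) f)"
proof -
  obtain A where A: "Mult A (\<lambda>\<tau>. cnj (symbol n \<tau>))" "is_adjoint (Tn n) A" by (rule Tn_adjoint)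
  note b = MultD(1)[OF Mult_Tn[of n]]
  obtain \<rho> :: "real \<Rightarrow> real" where \<rho>: "\<And>\<tau>. \<rho> \<tau> \<ge> 0" "\<rho> \<in> borel_measurable borel" "integrable lborel \<rho>"
    "\<And>B b K. Mult B b \<Longrightarrow> b \<in> borel_measurable borel \<Longrightarrow> (\<And>\<tau>. cmod (b \<tau>) \<le> K) \<Longrightarrow>
       ip (B f) f = (LINT \<tau>|lborel. b \<tau> * of_real (\<rho> \<tau>))"
    by (rule spectral_density[OF f]) blast
  note [measurable] = \<rho>(2)
  define D where "D = density lborel (\<lambda>\<tau>. ennreal (\<rho> \<tau>))"
  define \<mu> where "\<mu> = distr D borel (symbol n)"
  have Dm: "sets D = sets borel" "space D = UNIV" by (simp_all add: D_def)
  have sm [measurable]: "symbol n \<in> D \<rightarrow>\<^sub>M borel"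
    unfolding D_def by simp
  have em: "emeasure \<mu> X = (\<integral>\<^sup>+\<tau>. ennreal (\<rho> \<tau>) * indicator (symbol n -` X) \<tau> \<partial>lborel)" if "X \<in> sets borel" for X
  proof -
    have "symbol n -` X \<in> sets borel" using measurable_sets_borel[OF measurable_symbol that] .
    thus ?thesis unfolding \<mu>_def using that
      by (subst emeasure_distr) (auto simp: D_def emeasure_density)
  qed
  have ip_sym: "(\<integral>z. z ^ j * cnj z ^ k \<partial>\<mu>) = ip ((Tn n ^^ j) ((A ^^ k) f)) f" for j k
  proof -
    have "ip ((Tn n ^^ j) ((A ^^ k) f)) f = (LINT \<tau>|lborel. (symbol n \<tau> ^ j * cnj (symbol n \<tau>) ^ k) * of_real (\<rho> \<tau>))"
    proof (rule \<rho>(4)[OF Mult_comp[OF Mult_power[OF Mult_Tn] Mult_power[OF A(1)]]])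
      show "cmod (symbol n \<tau> ^ j * cnj (symbol n \<tau>) ^ k) \<le> (2 ^ n) ^ j * (2 ^ n) ^ k" for \<tau>
        unfolding norm_mult norm_power complex_mod_cnj by (intro mult_mono power_mono symbol_bound) auto
    qed measurable
    also have "\<dots> = (LINT \<tau>|lborel. \<rho> \<tau> *\<^sub>R (symbol n \<tau> ^ j * cnj (symbol n \<tau>) ^ k))"
      by (simp add: scaleR_conv_of_real mult.commute)
    also have "\<dots> = (LINT \<tau>|D. symbol n \<tau> ^ j * cnj (symbol n \<tau>) ^ k)"
      unfolding D_def using \<rho>(1) by (subst integral_density) auto
    also have "\<dots> = (\<integral>z. z ^ j * cnj z ^ k \<partial>\<mu>)"
      unfolding \<mu>_def by (subst integral_distr) auto
    finally show ?thesis by simp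
  qed
  have spec: "is_spectral_measure (Tn n) f \<mu>"
    unfolding is_spectral_measure_def
  proof (intro conjI allI impI exI[of _ "cball 0 (2 ^ n)"])
    show "sets \<mu> = sets borel" by (simp add: \<mu>_def)
    have "emeasure \<mu> UNIV = (\<integral>\<^sup>+\<tau>. ennreal (\<rho> \<tau>) \<partial>lborel)" by (simp add: em)
    also have "\<dots> < \<infinity>" using \<rho>(1,3) by (simp add: nn_integral_eq_integral)
    finally show "finite_measure \<mu>" by (intro finite_measureI) (simp add: \<mu>_def)
    have e: "symbol n -` (UNIV - cball 0 (2 ^ n)) = {}" using symbol_bound by (auto simp: not_le[symmetric])
    have "UNIV - cball (0::complex) (2 ^ n) \<in> sets borel" by measurable
    thus "emeasure \<mu> (UNIV - cball 0 (2 ^ n)) = 0" by (simp add: em e)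
    fix A' j k assume A': "is_adjoint (Tn n) A'"
    hence a': "bounded_op_on L2 A'" by (simp add: is_adjoint_def)
    note L = bounded_opD(1)[OF bounded_op_power[OF a'] f] bounded_opD(1)[OF bounded_op_power[OF MultD(1)[OF A(1)]] f]
    have "ae_eq ((Tn n ^^ j) ((A' ^^ k) f)) ((Tn n ^^ j) ((A ^^ k) f))"
      by (intro bounded_opD(2)[OF bounded_op_power[OF b]] L adjoint_power_unique[OF b A' A(2) f])
    hence "ip ((Tn n ^^ j) ((A' ^^ k) f)) f = ip ((Tn n ^^ j) ((A ^^ k) f)) f"
      by (intro ip_cong_ae bounded_opD(1)[OF bounded_op_power[OF b]] L f ae_eq_refl)
    thus "(\<integral>z. z ^ j * cnj z ^ k \<partial>\<mu>) = ip ((Tn n ^^ j) ((A' ^^ k) f)) f" by (simp add: ip_sym)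
  qed simp
  have uniq: "\<nu> = \<mu>" if \<nu>: "is_spectral_measure (Tn n) f \<nu>" for \<nu>
  proof -
    obtain R1 where R1: "\<And>R'. R' \<ge> R1 \<Longrightarrow> compact_measure \<nu> R'" using compact_measure_of_spectral[OF \<nu>] by blast
    obtain R2 where R2: "\<And>R'. R' \<ge> R2 \<Longrightarrow> compact_measure \<mu> R'" using compact_measure_of_spectral[OF spec] by blast
    show ?thesis
    proof (rule compact_measure_eqI[OF R1[of "max R1 R2"] R2[of "max R1 R2"]])
      show "(\<integral>z. z ^ j * cnj z ^ k \<partial>\<nu>) = (\<integral>z. z ^ j * cnj z ^ k \<partial>\<mu>)" for j k
        using \<nu> spec A(2) unfolding is_spectral_measure_def by metis
    qed auto
  qed
  have eq: "spectral_measure (Tn n) f = \<mu>"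
    unfolding spectral_measure_def using spec uniq by (rule the_equality)
  show "is_spectral_measure (Tn n) f (spectral_measure (Tn n) f)" unfolding eq by (rule spec)
  show "abs_cont_meas (spectral_measure (Tn n) f)"
    unfolding eq abs_cont_meas_def
  proof (intro ballI impI)
    fix X :: "complex set" assume X: "X \<in> sets borel" "H1_null X"
    have pre: "symbol n -` X \<in> sets borel" using measurable_sets_borel[OF measurable_symbol X(1)] .
    hence "symbol n -` X \<in> null_sets lborel"
      using symbol_preimage_null[OF n X] by (auto simp: null_sets_def)
    hence "AE \<tau> in lborel. \<tau> \<notin> symbol n -` X" by (rule AE_not_in)
    hence "AE \<tau> in lborel. ennreal (\<rho> \<tau>) * indicator (symbol n -` X) \<tau> = 0"
      by eventually_elim (simp add: indicator_def)
    thus "emeasure \<mu> X = 0" unfolding em[OF X(1)] using pre by (subst nn_integral_0_iff_AE) auto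
  qed
qed

text \<open>The moment with \<open>j = k = 0\<close>. It is what converts a vanishing spectral
  measure into a vanishing function.\<close>

lemma Tn_spectral_measure_mass:
  assumes n: "n \<ge> 1" and f: "f \<in> L2"
  shows "emeasure (spectral_measure (Tn n) f) UNIV = ennreal ((L2norm f)\<^sup>2)"
proof -
  let ?\<mu> = "spectral_measure (Tn n) f"
  note s = Tn_spectral_measure(1)[OF n f]
  obtain A where A: "is_adjoint (Tn n) A" using Tn_adjoint by metis
  interpret finite_measure ?\<mu> using s by (simp add: is_spectral_measure_def)
  have sp: "space ?\<mu> = UNIV" using s sets_eq_imp_space_eq[of ?\<mu> borel] by (simp add: is_spectral_measure_def)
  have "(\<integral>z. z ^ 0 * cnj z ^ 0 \<partial>?\<mu>) = ip ((Tn n ^^ 0) ((A ^^ 0) f)) f"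
    using s A unfolding is_spectral_measure_def by blast
  hence "complex_of_real (measure ?\<mu> UNIV) = of_real ((L2norm f)\<^sup>2)" by (simp add: sp ip_self scaleR_conv_of_real)
  hence "measure ?\<mu> UNIV = (L2norm f)\<^sup>2" by (simp only: of_real_eq_iff)
  thus ?thesis by (simp add: emeasure_eq_measure)
qed

lemma H_ac_Tn: "n \<ge> 1 \<Longrightarrow> H_ac (Tn n) = L2"
  using Tn_spectral_measure(2) by (auto simp: H_ac_def)

text \<open>A measure that is carried by an \<open>H1_null\<close> set and also vanishes on all such
  sets is \<open>0\<close>, so its mass, the squared norm of \<open>f\<close>, is
  \<open>0\<close>.\<close>

lemma H_sc_Tn:
  assumes n: "n \<ge> 1"
  shows "H_sc (Tn n) = {f \<in> L2. ae_eq f (\<lambda>x. 0)}"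
proof (intro set_eqI iffI)
  fix f assume "f \<in> H_sc (Tn n)"
  hence f: "f \<in> L2" and sc: "sing_cont_meas (spectral_measure (Tn n) f)" by (auto simp: H_sc_def)
  let ?\<mu> = "spectral_measure (Tn n) f"
  have sets: "sets ?\<mu> = sets borel" using Tn_spectral_measure(1)[OF n f] by (simp add: is_spectral_measure_def)
  obtain A where A: "A \<in> sets borel" "H1_null A" "emeasure ?\<mu> (UNIV - A) = 0"
    using sc unfolding sing_cont_meas_def by blast
  have "emeasure ?\<mu> A = 0" using Tn_spectral_measure(2)[OF n f] A unfolding abs_cont_meas_def by blast
  moreover have "UNIV - A \<in> sets ?\<mu>" "A \<in> sets ?\<mu>" using A(1) sets by auto
  ultimately have "emeasure ?\<mu> (A \<union> (UNIV - A)) = 0"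
    using A(3) by (metis emeasure_Un_null_set null_setsI)
  hence "(L2norm f)\<^sup>2 = 0" using Tn_spectral_measure_mass[OF n f] by simp
  thus "f \<in> {f \<in> L2. ae_eq f (\<lambda>x. 0)}" using f L2norm_eq_0_iff[OF f] by simp
next
  fix f assume "f \<in> {f \<in> L2. ae_eq f (\<lambda>x. 0)}"
  hence f: "f \<in> L2" and f0: "L2norm f = 0" using L2norm_eq_0_iff by auto
  let ?\<mu> = "spectral_measure (Tn n) f"
  have sets: "sets ?\<mu> = sets borel" using Tn_spectral_measure(1)[OF n f] by (simp add: is_spectral_measure_def)
  have U: "emeasure ?\<mu> UNIV = 0" using Tn_spectral_measure_mass[OF n f] f0 by simp
  have "emeasure ?\<mu> X = 0" if "X \<in> sets borel" for X
  proof -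
    have "emeasure ?\<mu> X \<le> emeasure ?\<mu> UNIV" using sets by (intro emeasure_mono) auto
    thus ?thesis using U by simp
  qed
  hence "sing_cont_meas ?\<mu>"
    unfolding sing_cont_meas_def using H1_null_empty U by (intro conjI allI bexI[of _ "{}"]) auto
  thus "f \<in> H_sc (Tn n)" using f by (simp add: H_sc_def)
qed

text \<open>On the space of null functions any two elements agree almost everywhere, so the identity
  is a bounded inverse of \<open>Tn n - l\<close> for every \<open>l\<close>.\<close>

theorem sigma_sc_Tn:
  assumes n: "n \<ge> 1"
  shows "sigma_sc (Tn n) = {}"
proof -
  let ?K = "{f \<in> L2. ae_eq f (\<lambda>x. 0)}"
  note b = MultD(1)[OF Mult_Tn[of n]]
  have T0: "ae_eq (Tn n f) (\<lambda>x. 0)" if f: "f \<in> L2" "ae_eq f (\<lambda>x. 0)" for f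
  proof -
    have "ae_eq (Tn n f) (Tn n (\<lambda>x. 0 * f x))"
      using f L2_zero by (intro bounded_opD(2)[OF b]) simp_all
    moreover have "ae_eq (Tn n (\<lambda>x. 0 * f x)) (\<lambda>x. 0 * Tn n f x)" by (rule bounded_opD(4)[OF b f(1)])
    ultimately have "ae_eq (Tn n f) (\<lambda>x. 0 * Tn n f x)" by (rule ae_eq_trans)
    thus ?thesis by simp
  qed
  have z: "ae_eq (\<lambda>x. Tn n f x - l * f x) f" if "f \<in> L2" "ae_eq f (\<lambda>x. 0)" for f l
    using T0[OF that] that(2) unfolding ae_eq_def by eventually_elim simp
  have "bounded_op_on ?K (\<lambda>f. f)"
    unfolding bounded_op_on_def by (auto intro!: exI[of _ 1])
  hence "l \<notin> spectrum_on ?K (Tn n)" for l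
    unfolding spectrum_on_def using z by (auto intro!: exI[of _ "\<lambda>f. f"])
  thus ?thesis unfolding sigma_sc_def H_sc_Tn[OF n] by blast
qed

text \<open>A general eigenfunction has no transform at hand, so the eigenvalue equation is tested
  in quadratic form: applying the adjoint of \<open>Tn n - l\<close> and pairing with
  \<open>f\<close> gives \<open>\<integral> |m - l|^2 \<rho> = 0\<close>. The level set of
  \<open>m\<close> at \<open>l\<close> is null, hence \<open>\<rho>\<close> vanishes almost
  everywhere, and so does its mass, the squared norm of \<open>f\<close>.\<close>

theorem point_spectrum_Tn:
  assumes n: "n \<ge> 1"
  shows "point_spectrum (Tn n) = {}"
proof -
  have "ae_eq f (\<lambda>x. 0)" if f: "f \<in> L2" and ev: "ae_eq (Tn n f) (\<lambda>x. l * f x)" for f l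
  proof -
    obtain A where A: "Mult A (\<lambda>\<tau>. cnj (symbol n \<tau>))" using Tn_adjoint by metis
    obtain \<rho> :: "real \<Rightarrow> real" where \<rho>: "\<And>\<tau>. \<rho> \<tau> \<ge> 0" "\<rho> \<in> borel_measurable borel" "integrable lborel \<rho>"
      "\<And>B b K. Mult B b \<Longrightarrow> b \<in> borel_measurable borel \<Longrightarrow> (\<And>\<tau>. cmod (b \<tau>) \<le> K) \<Longrightarrow>
         ip (B f) f = (LINT \<tau>|lborel. b \<tau> * of_real (\<rho> \<tau>))"
      by (rule spectral_density[OF f]) blast
    note [measurable] = \<rho>(2)
    let ?T = "\<lambda>f x. Tn n f x - l * f x" and ?A = "\<lambda>f x. A f x - cnj l * f x"
    let ?d = "\<lambda>\<tau>. symbol n \<tau> - l"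
    have T: "Mult ?T ?d" by (rule Mult_minus_scalar[OF Mult_Tn])
    have A': "Mult ?A (\<lambda>\<tau>. cnj (symbol n \<tau>) - cnj l)" by (rule Mult_minus_scalar[OF A])
    have AT: "Mult (\<lambda>f. ?A (?T f)) (\<lambda>\<tau>. of_real ((cmod (?d \<tau>))\<^sup>2))"
      by (rule Mult_symbol_cong[OF Mult_comp[OF A' T]]) (simp add: complex_norm_square mult.commute del: of_real_power)
    have d_bound: "cmod (?d \<tau>) \<le> 2 ^ n + cmod l" for \<tau>
      using norm_triangle_ineq4[of "symbol n \<tau>" l] symbol_bound[of n \<tau>] by linarith
    have "ae_eq (?T f) (\<lambda>x. 0)" using ev by (simp add: ae_eq_def)
    hence "ae_eq (?A (?T f)) (?A (\<lambda>x. 0))"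
      by (intro bounded_opD(2)[OF MultD(1)[OF A']] bounded_opD(1)[OF MultD(1)[OF T]] f L2_zero)
    moreover have "ae_eq (?A (\<lambda>x. 0 * f x)) (\<lambda>x. 0 * ?A f x)" by (rule bounded_opD(4)[OF MultD(1)[OF A'] f])
    ultimately have "ae_eq (?A (?T f)) (\<lambda>x. 0)" using ae_eq_trans by simp
    hence "ip (?A (?T f)) f = ip (\<lambda>x. 0) f"
      by (intro ip_cong_ae L2_zero f ae_eq_refl bounded_opD(1)[OF MultD(1)[OF AT]])
    hence "0 = ip (?A (?T f)) f" by (simp add: ip_def)
    also have "\<dots> = (LINT \<tau>|lborel. of_real ((cmod (?d \<tau>))\<^sup>2) * of_real (\<rho> \<tau>))"
    proof (rule \<rho>(4)[OF AT])
      show "cmod (of_real ((cmod (?d \<tau>))\<^sup>2)) \<le> (2 ^ n + cmod l)\<^sup>2" for \<tau>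
        using power_mono[OF d_bound[of \<tau>], of 2] by (simp add: norm_power)
    qed measurable
    also have "\<dots> = of_real (LINT \<tau>|lborel. (cmod (?d \<tau>))\<^sup>2 * \<rho> \<tau>)"
      unfolding of_real_mult[symmetric] by (rule integral_complex_of_real)
    finally have I: "(LINT \<tau>|lborel. (cmod (?d \<tau>))\<^sup>2 * \<rho> \<tau>) = 0"
      by (metis of_real_eq_0_iff)
    have "integrable lborel (\<lambda>\<tau>. (cmod (?d \<tau>))\<^sup>2 * \<rho> \<tau>)"
    proof (rule Bochner_Integration.integrable_bound)
      show "integrable lborel (\<lambda>\<tau>. (2 ^ n + cmod l)\<^sup>2 * \<rho> \<tau>)" using \<rho>(3) by simp
      show "AE \<tau> in lborel. norm ((cmod (?d \<tau>))\<^sup>2 * \<rho> \<tau>) \<le> norm ((2 ^ n + cmod l)\<^sup>2 * \<rho> \<tau>)"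
        using power_mono[OF d_bound norm_ge_zero, where n=2] \<rho>(1) by (intro AE_I2) (simp add: abs_mult mult_right_mono)
    qed measurable
    hence "AE \<tau> in lborel. (cmod (?d \<tau>))\<^sup>2 * \<rho> \<tau> = 0"
      using I \<rho>(1) by (subst (asm) integral_nonneg_eq_0_iff_AE) auto
    moreover have "AE \<tau> in lborel. \<tau> \<notin> symbol n -` {l}"
    proof (rule AE_not_in)
      have "symbol n -` {l} \<in> sets borel" using measurable_sets_borel[OF measurable_symbol] by simp
      thus "symbol n -` {l} \<in> null_sets lborel"
        using symbol_preimage_null[OF n _ H1_null_singleton, of l] by (auto simp: null_sets_def)
    qed
    ultimately have \<rho>0: "AE \<tau> in lborel. complex_of_real (\<rho> \<tau>) = 0"
      by eventually_elim auto
    have "ip f f = (LINT \<tau>|lborel. 1 * of_real (\<rho> \<tau>))"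
      by (rule \<rho>(4)[OF Mult_id, of 1]) auto
    also have "\<dots> = (LINT \<tau>|(lborel::real measure). 0)" by (intro integral_cong_AE) (use \<rho>0 in auto)
    finally have "L2norm f = 0" by (simp add: ip_self)
    thus ?thesis using L2norm_eq_0_iff[OF f] by simp
  qed
  thus ?thesis unfolding point_spectrum_def by blast
qed

section \<open>The spectrum\<close>

text \<open>In the coordinate \<open>t = ln x\<close>, a Gaussian of width
  \<open>1 / \<delta>\<close> modulated by the frequency \<open>\<sigma>\<close>; its transform is a
  Gaussian of width \<open>\<delta>\<close> centred at \<open>\<sigma>\<close>.\<close>

definition wave_packet :: "real \<Rightarrow> real \<Rightarrow> real \<Rightarrow> complex" where
  "wave_packet \<sigma> \<delta> x = iexp (\<sigma> * ln x) * of_real (gauss (\<delta> * ln x) / sqrt x)"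

lemma lift_wave_packet: "lift (wave_packet \<sigma> \<delta>) t = iexp (\<sigma> * t) * of_real (gauss (\<delta> * t))"
proof -
  have s: "sqrt (exp t) = exp (t / 2)"
    by (rule real_sqrt_unique) (simp_all add: power2_eq_square mult_exp_exp)
  show ?thesis by (simp add: lift_def wave_packet_def s del: of_real_exp)
qed

lemma integrable_gauss_scale: "\<delta> > 0 \<Longrightarrow> integrable lborel (\<lambda>t. gauss (\<delta> * t))"
  using lborel_integrable_real_affine_iff[of \<delta> gauss 0] integrable_gaussian by simp

lemma wave_packet_core: "\<delta> > 0 \<Longrightarrow> wave_packet \<sigma> \<delta> \<in> core"
  unfolding core_def mem_Collect_eq
proof (rule BCI_I[where B=1])
  assume d: "\<delta> > 0"
  show "continuous_on UNIV (lift (wave_packet \<sigma> \<delta>))"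
    unfolding lift_wave_packet[abs_def] by (intro continuous_intros)
  show "cmod (lift (wave_packet \<sigma> \<delta>) t) \<le> 1" for t
    using gauss_le_1[of "\<delta> * t"] gauss_pos[of "\<delta> * t"] by (simp add: lift_wave_packet norm_mult)
  show "integrable lborel (lift (wave_packet \<sigma> \<delta>))"
    by (rule Bochner_Integration.integrable_bound[OF integrable_gauss_scale[OF d]])
       (auto simp: lift_wave_packet[abs_def] norm_mult)
qed

lemma mellin_wave_packet:
  assumes d: "\<delta> > 0"
  shows "mellin (wave_packet \<sigma> \<delta>) \<tau> = of_real (sqrt (2 * pi) / \<delta> * gauss ((\<tau> - \<sigma>) / \<delta>))"
proof -
  have "mellin (wave_packet \<sigma> \<delta>) \<tau> = (LINT t|lborel. iexp ((\<sigma> - \<tau>) * t) * of_real (gauss (\<delta> * t)))"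
    unfolding mellin_def fourier_def lift_wave_packet
    by (intro Bochner_Integration.integral_cong) (simp_all add: mult_exp_exp algebra_simps)
  also have "\<dots> = (LINT t|lborel. (\<lambda>y. iexp ((\<sigma> - \<tau>) / \<delta> * y) * of_real (gauss y)) (0 + \<delta> * t))"
    using d by simp
  also have "\<dots> = (1 / \<delta>) *\<^sub>R (LINT y|lborel. iexp ((\<sigma> - \<tau>) / \<delta> * y) * of_real (gauss y))"
    using d by (subst lborel_integral_real_affine[of \<delta> "\<lambda>y. iexp ((\<sigma> - \<tau>) / \<delta> * y) * of_real (gauss y)" 0]) auto
  also have "\<dots> = (1 / \<delta>) *\<^sub>R of_real (sqrt (2 * pi) * gauss ((\<sigma> - \<tau>) / \<delta>))"
    by (subst fourier_gaussian) simp
  also have "gauss ((\<sigma> - \<tau>) / \<delta>) = gauss ((\<tau> - \<sigma>) / \<delta>)"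
    using gauss_minus[of "(\<tau> - \<sigma>) / \<delta>"] by (simp add: minus_divide_left)
  finally show ?thesis by (simp add: scaleR_conv_of_real)
qed

lemma wave_packet_norm:
  assumes B: "Mult B b" and d: "\<delta> > 0"
  shows "2 * pi * (L2norm (B (wave_packet \<sigma> \<delta>)))\<^sup>2 =
    2 * pi / \<delta> * (LINT s|lborel. (cmod (b (\<sigma> + \<delta> * s)))\<^sup>2 * (gauss s)\<^sup>2)"
proof -
  note c = wave_packet_core[OF d, of \<sigma>]
  have "2 * pi * (L2norm (B (wave_packet \<sigma> \<delta>)))\<^sup>2 =
      (LINT \<tau>|lborel. (cmod (b \<tau> * mellin (wave_packet \<sigma> \<delta>) \<tau>))\<^sup>2)"
    using mellin_isometry(3)[OF MultD(2)[OF B c]] MultD(3)[OF B c] by simp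
  also have "\<dots> = (LINT \<tau>|lborel. (2 * pi / \<delta>\<^sup>2) * ((cmod (b \<tau>))\<^sup>2 * (gauss ((\<tau> - \<sigma>) / \<delta>))\<^sup>2))"
    by (intro Bochner_Integration.integral_cong refl)
       (simp add: mellin_wave_packet[OF d] norm_mult norm_divide power_mult_distrib power_divide)
  also have "\<dots> = \<bar>\<delta>\<bar> *\<^sub>R (LINT s|lborel. (2 * pi / \<delta>\<^sup>2) * ((cmod (b (\<sigma> + \<delta> * s)))\<^sup>2 * (gauss s)\<^sup>2))"
    using d by (subst lborel_integral_real_affine[of \<delta> _ \<sigma>]) auto
  also have "\<dots> = 2 * pi / \<delta> * (LINT s|lborel. (cmod (b (\<sigma> + \<delta> * s)))\<^sup>2 * (gauss s)\<^sup>2)"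
    using d by (simp add: power2_eq_square)
  finally show ?thesis .
qed

lemma integrable_gauss_sq: "integrable lborel (\<lambda>s. (gauss s)\<^sup>2)"
proof (rule Bochner_Integration.integrable_bound[OF integrable_gaussian])
  have "(gauss s)\<^sup>2 \<le> gauss s" for s
    using gauss_pos[of s] gauss_le_1[of s] by (simp add: power2_eq_square mult_le_cancel_left1)
  thus "AE s in lborel. norm ((gauss s)\<^sup>2) \<le> norm (gauss s)"
    using gauss_pos by (intro AE_I2) (simp add: less_imp_le)
qed measurable

lemma integral_gauss_sq_pos: "(LINT s|lborel. (gauss s)\<^sup>2) > 0"
proof -
  have "(LINT s|lborel. (gauss s)\<^sup>2) \<noteq> 0"
  proof
    assume "(LINT s|lborel. (gauss s)\<^sup>2) = 0"
    hence "AE s in lborel. (gauss s)\<^sup>2 = 0"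
      using integrable_gauss_sq by (subst (asm) integral_nonneg_eq_0_iff_AE) auto
    hence "AE s in (lborel::real measure). False"
      by eventually_elim (use gauss_pos in \<open>auto simp: less_le\<close>)
    thus False by (simp add: ae_filter_eq_bot_iff eventually_False emeasure_lborel_UNIV)
  qed
  moreover have "(LINT s|lborel. (gauss s)\<^sup>2) \<ge> 0" by simp
  ultimately show ?thesis by linarith
qed

text \<open>After the substitution \<open>\<tau> = \<sigma> + \<delta> * s\<close>, the squared
  norms of the error and of the packet carry the same factor \<open>1 / \<delta>\<close>, which
  cancels in their quotient. The remaining integral of
  \<open>|b (\<sigma> + \<delta> * s) - b \<sigma>|^2\<close> against \<open>(gauss s)^2\<close>
  tends to \<open>0\<close> by dominated convergence.\<close>

lemma approximate_eigenvector:
  assumes B: "Mult B b" and b: "continuous_on UNIV b" "\<And>\<tau>. cmod (b \<tau>) \<le> K" and e: "e > 0"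
  obtains f where "f \<in> L2" "L2norm f > 0" "L2norm (\<lambda>x. B f x - b \<sigma> * f x) \<le> e * L2norm f"
proof -
  have [measurable]: "b \<in> borel_measurable borel" by (rule borel_measurable_continuous_onI[OF b(1)])
  let ?d = "\<lambda>n. 1 / real (Suc n)"
  let ?I = "LINT s|lborel. (gauss s)\<^sup>2"
  have K: "cmod (b \<tau> - b \<sigma>) \<le> 2 * K" for \<tau>
    using norm_triangle_ineq4[of "b \<tau>" "b \<sigma>"] b(2)[of \<tau>] b(2)[of \<sigma>] by linarith
  have "(\<lambda>n. LINT s|lborel. (cmod (b (\<sigma> + ?d n * s) - b \<sigma>))\<^sup>2 * (gauss s)\<^sup>2) \<longlonglongrightarrow> (LINT s|(lborel::real measure). 0)"
  proof (rule integral_dominated_convergence[where w="\<lambda>s. (2 * K)\<^sup>2 * (gauss s)\<^sup>2"])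
    show "AE s in lborel. (\<lambda>n. (cmod (b (\<sigma> + ?d n * s) - b \<sigma>))\<^sup>2 * (gauss s)\<^sup>2) \<longlonglongrightarrow> 0"
    proof (intro AE_I2)
      fix s :: real
      have "(\<lambda>n. \<sigma> + ?d n * s) \<longlonglongrightarrow> \<sigma> + 0 * s"
        by (intro tendsto_intros LIMSEQ_Suc[OF lim_const_over_n])
      hence "(\<lambda>n. b (\<sigma> + ?d n * s)) \<longlonglongrightarrow> b \<sigma>"
        by (intro continuous_on_UNIV_tendsto[OF b(1)]) simp
      hence "(\<lambda>n. (cmod (b (\<sigma> + ?d n * s) - b \<sigma>))\<^sup>2 * (gauss s)\<^sup>2) \<longlonglongrightarrow> (cmod (b \<sigma> - b \<sigma>))\<^sup>2 * (gauss s)\<^sup>2"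
        by (rule tendsto_mult_right[OF tendsto_power[OF tendsto_norm[OF tendsto_diff[OF _ tendsto_const]]]])
      thus "(\<lambda>n. (cmod (b (\<sigma> + ?d n * s) - b \<sigma>))\<^sup>2 * (gauss s)\<^sup>2) \<longlonglongrightarrow> 0" by simp
    qed
    show "AE s in lborel. norm ((cmod (b (\<sigma> + ?d n * s) - b \<sigma>))\<^sup>2 * (gauss s)\<^sup>2) \<le> (2 * K)\<^sup>2 * (gauss s)\<^sup>2" for n
      using power_mono[OF K norm_ge_zero, where n=2] by (intro AE_I2) (simp add: abs_mult mult_right_mono)
  qed (use integrable_gauss_sq in auto)
  moreover have "0 < e\<^sup>2 * ?I" using e integral_gauss_sq_pos by simp
  ultimately have "\<forall>\<^sub>F n in sequentially. (LINT s|lborel. (cmod (b (\<sigma> + ?d n * s) - b \<sigma>))\<^sup>2 * (gauss s)\<^sup>2) < e\<^sup>2 * ?I"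
    by (intro order_tendstoD(2)) auto
  then obtain n where n: "(LINT s|lborel. (cmod (b (\<sigma> + ?d n * s) - b \<sigma>))\<^sup>2 * (gauss s)\<^sup>2) < e\<^sup>2 * ?I"
    by (auto simp: eventually_sequentially)
  have d: "?d n > 0" by simp
  let ?f = "wave_packet \<sigma> (?d n)"
  note N1 = wave_packet_norm[OF Mult_minus_scalar[OF B] d, of \<sigma> "b \<sigma>"]
  note N2 = wave_packet_norm[OF Mult_id d, of \<sigma>]
  have N2': "2 * pi * (L2norm ?f)\<^sup>2 = 2 * pi / ?d n * ?I" using N2 by simp
  show ?thesis
  proof (rule that[of ?f])
    show "?f \<in> L2" by (rule mellin_isometry(1)[OF wave_packet_core[OF d]])
    have "0 < 2 * pi / ?d n * ?I" using integral_gauss_sq_pos d by (intro mult_pos_pos divide_pos_pos) auto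
    hence "L2norm ?f \<noteq> 0" using N2' by auto
    thus "L2norm ?f > 0" using L2norm_nonneg[of ?f] by linarith
    have "2 * pi * (L2norm (\<lambda>x. B ?f x - b \<sigma> * ?f x))\<^sup>2 \<le> 2 * pi / ?d n * (e\<^sup>2 * ?I)"
      unfolding N1 using n by (intro mult_left_mono) auto
    also have "\<dots> = e\<^sup>2 * (2 * pi / ?d n * ?I)" by simp
    also have "\<dots> = 2 * pi * (e * L2norm ?f)\<^sup>2" unfolding N2'[symmetric] by (simp add: power_mult_distrib)
    finally have "(L2norm (\<lambda>x. B ?f x - b \<sigma> * ?f x))\<^sup>2 \<le> (e * L2norm ?f)\<^sup>2" by simp
    thus "L2norm (\<lambda>x. B ?f x - b \<sigma> * ?f x) \<le> e * L2norm ?f"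
      by (rule power2_le_imp_le) (intro mult_nonneg_nonneg less_imp_le[OF e] L2norm_nonneg)
  qed
qed

lemma spectrum_superset:
  assumes B: "Mult B b" and b: "continuous_on UNIV b" "\<And>\<tau>. cmod (b \<tau>) \<le> K"
    and l: "\<And>e. e > 0 \<Longrightarrow> \<exists>\<sigma>. cmod (b \<sigma> - l) < e"
  shows "l \<in> spectrum_on L2 B"
proof (rule ccontr)
  assume "l \<notin> spectrum_on L2 B"
  then obtain S where S: "bounded_op_on L2 S" "\<And>f. f \<in> L2 \<Longrightarrow> ae_eq (S (\<lambda>x. B f x - l * f x)) f"
    unfolding spectrum_on_def by blast
  obtain C where C: "C > 0" "\<And>f. f \<in> L2 \<Longrightarrow> L2norm (S f) \<le> C * L2norm f" using bounded_op_norm[OF S(1)] by metis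
  \<comment> \<open>Two errors of relative size \<open>e\<close> arise, one from the packet and one
    from \<open>b \<sigma> - l\<close>; the inverse magnifies their sum to \<open>2 / 3 < 1\<close>,
    a contradiction.\<close>
  define e where "e = 1 / (3 * C)"
  have e: "e > 0" using C by (simp add: e_def)
  obtain \<sigma> where \<sigma>: "cmod (b \<sigma> - l) < e" using l[OF e] by blast
  obtain f where f: "f \<in> L2" "L2norm f > 0" "L2norm (\<lambda>x. B f x - b \<sigma> * f x) \<le> e * L2norm f"
    by (rule approximate_eigenvector[OF B b e])
  note L = bounded_opD(1)[OF MultD(1)[OF Mult_minus_scalar[OF B]] f(1)]
  have "L2norm f = L2norm (S (\<lambda>x. B f x - l * f x))"
    by (rule L2norm_cong_ae[OF f(1) bounded_opD(1)[OF S(1) L] ae_eq_sym[OF S(2)[OF f(1)]]])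
  also have "\<dots> \<le> C * L2norm (\<lambda>x. B f x - l * f x)" by (rule C(2)[OF L])
  also have "L2norm (\<lambda>x. B f x - l * f x) = L2norm (\<lambda>x. (B f x - b \<sigma> * f x) + (b \<sigma> - l) * f x)"
    by (simp add: algebra_simps)
  also have "\<dots> \<le> L2norm (\<lambda>x. B f x - b \<sigma> * f x) + L2norm (\<lambda>x. (b \<sigma> - l) * f x)"
    by (intro L2norm_triangle L L2_cmult f)
  also have "\<dots> \<le> e * L2norm f + e * L2norm f"
    unfolding L2norm_cmult using f \<sigma> by (intro add_mono mult_right_mono) auto
  finally have "L2norm f \<le> C * (e * L2norm f + e * L2norm f)" using C(1) by (simp add: mult_left_mono)
  also have "\<dots> = 2 / 3 * L2norm f" using C(1) by (simp add: e_def field_simps)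
  finally show False using f(2) by simp
qed

section \<open>Resolvents from rational symbols, and the spectrum of \<open>Tn\<close>\<close>

text \<open>Partial fractions, one root at a time: a root \<open>c\<close> of \<open>q\<close> is
  off the imaginary axis, so \<open>1 / (z - c)\<close> is the symbol of a resolvent, and
  \<open>p / q\<close> equals \<open>p1 / q1 + (1 / (z - c)) * (p c / q1)\<close> with
  \<open>q = (z - c) * q1\<close>. Both quotients have the smaller denominator \<open>q1\<close>;
  the degree condition keeps the symbol bounded at infinity.\<close>

lemma rational_symbol:
  assumes "q \<noteq> 0" "degree p \<le> degree q" "\<And>\<tau>. poly q (\<i> * of_real \<tau>) \<noteq> 0"
  shows "\<exists>B. Mult B (\<lambda>\<tau>. poly p (\<i> * of_real \<tau>) / poly q (\<i> * of_real \<tau>))"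
  using assms
proof (induction "degree q" arbitrary: p q)
  case 0
  then obtain c d where "q = [:c:]" "p = [:d:]" by (metis degree_eq_zeroE le_zero_eq)
  thus ?case using Mult_scalar[of "d / c"] by auto
next
  case (Suc m)
  have "\<not> constant (poly q)" using Suc.hyps(2) by (simp add: constant_degree)
  then obtain c where c: "poly q c = 0" using fundamental_theorem_of_algebra by blast
  then obtain q1 where q1: "q = [:- c, 1:] * q1" by (metis poly_eq_0_iff_dvd dvdE)
  have q10: "q1 \<noteq> 0" using Suc.prems(1) q1 by auto
  have dq: "m = degree q1" using Suc.hyps(2) q10 unfolding q1 by (subst (asm) degree_mult_eq) auto
  have pq: "poly q z = (z - c) * poly q1 z" for z by (simp add: q1 algebra_simps)
  have q1n: "poly q1 (\<i> * of_real \<tau>) \<noteq> 0" and cn: "\<i> * of_real \<tau> - c \<noteq> 0" for \<tau>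
    using Suc.prems(3)[of \<tau>] unfolding pq by auto
  have "Re (- c) \<noteq> 0"
  proof
    assume "Re (- c) = 0"
    hence "\<i> * of_real (Im c) - c = 0" by (simp add: complex_eq_iff)
    thus False using cn[of "Im c"] by simp
  qed
  then obtain R where R: "Mult R (\<lambda>\<tau>. 1 / (- c + \<i> * of_real \<tau>))" by (rule resolvent_exists)
  \<comment> \<open>The quotient of \<open>p\<close> by \<open>z - c\<close>, with remainder
    \<open>poly p c\<close>; the degrees of numerator and denominator both drop by one, or the
    numerator is already constant.\<close>
  let ?p1 = "synthetic_div p c"
  have "degree ?p1 \<le> degree q1"
    using Suc.prems(2) Suc.hyps(2) dq by (simp add: degree_synthetic_div)
  then obtain B1 where B1: "Mult B1 (\<lambda>\<tau>. poly ?p1 (\<i> * of_real \<tau>) / poly q1 (\<i> * of_real \<tau>))"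
    using Suc.hyps(1)[OF dq q10 _ q1n] by blast
  obtain B2 where B2: "Mult B2 (\<lambda>\<tau>. poly [:poly p c:] (\<i> * of_real \<tau>) / poly q1 (\<i> * of_real \<tau>))"
    using Suc.hyps(1)[OF dq q10 _ q1n, of "[:poly p c:]"] by auto
  have pp: "poly p z = (z - c) * poly ?p1 z + poly p c" for z
    by (subst (1) synthetic_div_correct'[of c p, symmetric]) (simp add: algebra_simps)
  have eq: "poly ?p1 (\<i> * of_real \<tau>) / poly q1 (\<i> * of_real \<tau>) +
     1 / (- c + \<i> * of_real \<tau>) * (poly [:poly p c:] (\<i> * of_real \<tau>) / poly q1 (\<i> * of_real \<tau>)) =
     poly p (\<i> * of_real \<tau>) / poly q (\<i> * of_real \<tau>)" for \<tau>
  proof -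
    define z where "z = \<i> * complex_of_real \<tau>"
    have nz: "z - c \<noteq> 0" "poly q1 z \<noteq> 0" using cn[of \<tau>] q1n[of \<tau>] by (simp_all add: z_def)
    have "poly ?p1 z / poly q1 z + 1 / (z - c) * (poly p c / poly q1 z) = ((z - c) * poly ?p1 z + poly p c) / ((z - c) * poly q1 z)"
      using nz by (simp add: add_divide_distrib)
    thus ?thesis unfolding pp[of "\<i> * of_real \<tau>"] pq by (simp add: z_def)
  qed
  show ?case
    by (rule exI, rule Mult_symbol_cong[OF Mult_add[OF B1 Mult_comp[OF R B2]] eq])
qed

text \<open>With \<open>P = 1 / m\<close> as a polynomial in \<open>\<i> * \<tau>\<close>, the
  inverse has symbol \<open>1 / (m - l) = P / (1 - l * P)\<close>. The denominator has no zero on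
  the imaginary axis since \<open>m\<close> omits \<open>l\<close>, and its degree is that of
  \<open>P\<close> because \<open>l \<noteq> 0\<close>.\<close>

lemma spectrum_subset:
  assumes l: "l \<noteq> 0" "\<And>\<tau>. symbol n \<tau> \<noteq> l"
  shows "l \<notin> spectrum_on L2 (Tn n)"
proof -
  define P :: "complex poly" where "P = (\<Prod>k<n. [:of_nat k + 1/2, 1:])"
  define q where "q = 1 - smult l P"
  have Pv: "poly P (\<i> * of_real \<tau>) = 1 / symbol n \<tau>" for \<tau>
    by (simp add: P_def symbol_def poly_prod prod_dividef)
  have qv: "poly q (\<i> * of_real \<tau>) = (symbol n \<tau> - l) / symbol n \<tau>" for \<tau>
    using symbol_ne_0[of n \<tau>] by (simp add: q_def Pv field_simps)
  have qn: "poly q (\<i> * of_real \<tau>) \<noteq> 0" for \<tau> unfolding qv using l(2)[of \<tau>] symbol_ne_0[of n \<tau>] by simp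
  have "P \<noteq> 0" unfolding P_def by auto
  have "degree P \<le> degree q"
  \<comment> \<open>For positive degree the constant \<open>1\<close> cannot cancel the leading term
    of \<open>smult l P\<close>.\<close>
  proof (cases "degree P = 0")
    case False
    hence "degree (smult l P) > degree (1 :: complex poly)" using l(1) by simp
    hence "degree q = degree (smult l P)" unfolding q_def
      by (metis degree_add_eq_right degree_minus diff_conv_add_uminus)
    thus ?thesis using l(1) by simp
  qed simp
  moreover have "q \<noteq> 0" using qn[of 0] by auto
  ultimately obtain S where "Mult S (\<lambda>\<tau>. poly P (\<i> * of_real \<tau>) / poly q (\<i> * of_real \<tau>))"
    using rational_symbol qn by blast
  hence S: "Mult S (\<lambda>\<tau>. 1 / (symbol n \<tau> - l))"
    by (rule Mult_symbol_cong) (simp add: Pv qv symbol_ne_0)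
  note T = Mult_minus_scalar[OF Mult_Tn[of n], of l]
  have TS: "Mult (\<lambda>f. S (\<lambda>x. Tn n f x - l * f x)) (\<lambda>\<tau>. 1)"
    by (rule Mult_symbol_cong[OF Mult_comp[OF S T]]) (use l(2) in simp)
  have 1: "ae_eq (S (\<lambda>x. Tn n f x - l * f x)) f" if "f \<in> L2" for f
    by (rule Mult_unique[OF TS Mult_id that])
  have ST: "Mult (\<lambda>g x. Tn n (S g) x - l * S g x) (\<lambda>\<tau>. 1)"
    by (rule Mult_symbol_cong[OF Mult_comp[OF T S]]) (use l(2) in simp)
  have 2: "ae_eq (\<lambda>x. Tn n (S g) x - l * S g x) g" if "g \<in> L2" for g
    by (rule Mult_unique[OF ST Mult_id that])
  show ?thesis unfolding spectrum_on_def using MultD(1)[OF S] 1 2 by blast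
qed

lemma symbol_small:
  assumes "n \<ge> 1" "e > 0"
  shows "\<exists>\<tau>. cmod (symbol n \<tau>) < e"
proof -
  obtain m where m: "n = Suc m" using assms by (cases n) auto
  \<comment> \<open>All factors but the last are bounded by \<open>2\<close>, together
    \<open>2 ^ m\<close>, and the last by \<open>1 / \<tau>\<close>; the summand \<open>1\<close>
    makes the final inequality strict.\<close>
  define \<tau> where "\<tau> = 2 ^ m / e + 1"
  have "2 ^ m / e \<ge> 0" using assms by simp
  hence \<tau>: "\<tau> > 0" unfolding \<tau>_def by linarith
  have "\<bar>Im (of_nat m + 1/2 + \<i> * of_real \<tau>)\<bar> \<le> cmod (of_nat m + 1/2 + \<i> * of_real \<tau>)" by (rule abs_Im_le_cmod)
  hence d: "\<tau> \<le> cmod (of_nat m + 1/2 + \<i> * of_real \<tau>)" by simp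
  have "cmod (symbol n \<tau>) = cmod (symbol m \<tau>) / cmod (of_nat m + 1/2 + \<i> * of_real \<tau>)"
    by (simp add: m symbol_def norm_mult norm_divide)
  also have "\<dots> \<le> 2 ^ m / \<tau>" using \<tau> d by (intro frac_le symbol_bound) auto
  also have "\<dots> < e" using \<tau> assms(2) by (simp add: \<tau>_def field_simps)
  finally show ?thesis by blast
qed

theorem spectrum_Tn:
  assumes n: "n \<ge> 1"
  shows "spectrum_on L2 (Tn n) = insert 0 (range (symbol n))"
proof (intro equalityI subsetI)
  fix l assume "l \<in> spectrum_on L2 (Tn n)"
  thus "l \<in> insert 0 (range (symbol n))" using spectrum_subset[of l n] by blast
next
  fix l assume l: "l \<in> insert 0 (range (symbol n))"
  have "\<exists>\<sigma>. cmod (symbol n \<sigma> - l) < e" if "e > 0" for e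
  proof (cases "l = 0")
    case False
    then obtain \<sigma> where "l = symbol n \<sigma>" using l by blast
    hence "cmod (symbol n \<sigma> - l) < e" using that by simp
    thus ?thesis by blast
  qed (use symbol_small[OF n that] in simp)
  thus "l \<in> spectrum_on L2 (Tn n)"
    by (rule spectrum_superset[OF Mult_Tn continuous_symbol symbol_bound])
qed

section \<open>The spectrum as the image of the circle under \<open>rn n\<close>\<close>

text \<open>The factor with \<open>k = 0\<close> is \<open>1\<close>, so it may be added to the
  product; then each of the \<open>n\<close> factors receives one \<open>z\<close>.\<close>

lemma rn_eq_prod:
  assumes "n \<ge> 1"
  shows "rn n z = (\<Prod>k<n. z * inverse (1 + of_nat k * z))"
proof -
  have s: "{..<n} = insert 0 {1..n - 1}" using assms by auto
  have "(\<Prod>k<n. inverse (1 + of_nat k * z)) = (\<Prod>k=1..n-1. inverse (1 + of_nat k * z))"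
    unfolding s by (subst prod.insert) auto
  thus ?thesis by (simp add: rn_def prod.distrib)
qed

lemma symbol_eq_rn:
  assumes "n \<ge> 1"
  shows "symbol n \<tau> = rn n (1 / (1/2 + \<i> * of_real \<tau>))"
  unfolding rn_eq_prod[OF assms] symbol_def
proof (rule prod.cong[OF refl])
  fix k
  let ?w = "1/2 + \<i> * complex_of_real \<tau>"
  have w: "?w \<noteq> 0" using symbol_denominator_ne_0[of 0 \<tau>] by simp
  have "1 + c * (1 / w) = (w + c) / w" if "w \<noteq> 0" for c w :: complex
    using that by (simp add: add_divide_distrib)
  from this[OF w, of "of_nat k"] have "1 + of_nat k * (1 / ?w) = (of_nat k + 1/2 + \<i> * of_real \<tau>) / ?w"
    by (simp only: add_ac)
  thus "1 / (of_nat k + 1/2 + \<i> * of_real \<tau>) = 1 / ?w * inverse (1 + of_nat k * (1 / ?w))"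
    using w by (simp add: inverse_eq_divide)
qed

lemma circle_eq: "{1 + exp (\<i> * of_real \<theta>) |\<theta>. \<theta> \<in> {0..2*pi}} = {z. cmod (z - 1) = 1}"
proof (intro set_eqI iffI)
  fix z assume "z \<in> {z. cmod (z - 1) = 1}"
  hence "exp (\<i> * of_real (Arg2pi (z - 1))) = z - 1" using Arg2pi_eq[of "z - 1"] by simp
  hence "z = 1 + exp (\<i> * of_real (Arg2pi (z - 1)))" by simp
  moreover have "Arg2pi (z - 1) \<in> {0..2*pi}"
    using Arg2pi_ge_0[of "z - 1"] Arg2pi_lt_2pi[of "z - 1"] by simp
  ultimately show "z \<in> {1 + exp (\<i> * of_real \<theta>) |\<theta>. \<theta> \<in> {0..2*pi}}" by blast
qed auto

text \<open>Inversion maps the circle, which passes through the origin, to the line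
  \<open>Re w = 1/2\<close>: the equation \<open>|z - 1| = 1\<close> reads
  \<open>|z|^2 = 2 * Re z\<close>. The point \<open>0\<close> corresponds to infinity on the
  line.\<close>

lemma circle_inversion: "{z. cmod (z - 1) = 1} = insert 0 (range (\<lambda>\<tau>. 1 / (1/2 + \<i> * complex_of_real \<tau>)))"
proof (intro set_eqI iffI)
  fix z assume z: "z \<in> {z. cmod (z - 1) = 1}"
  show "z \<in> insert 0 (range (\<lambda>\<tau>. 1 / (1/2 + \<i> * complex_of_real \<tau>)))"
  proof (cases "z = 0")
    case False
    have "(cmod (z - 1))\<^sup>2 = 1" using z by simp
    hence "(Re (z - 1))\<^sup>2 + (Im (z - 1))\<^sup>2 = 1" unfolding cmod_power2 .
    hence "(Re z)\<^sup>2 + (Im z)\<^sup>2 = 2 * Re z" by (simp add: power2_eq_square algebra_simps)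
    moreover have "(Re z)\<^sup>2 + (Im z)\<^sup>2 \<noteq> 0" using False by (simp add: complex_eq_iff sum_power2_eq_zero_iff)
    ultimately have "Re (1 / z) = 1/2" by (simp add: Re_divide)
    hence "1 / z = 1/2 + \<i> * of_real (Im (1 / z))" by (simp add: complex_eq_iff)
    hence "z = 1 / (1/2 + \<i> * of_real (Im (1 / z)))" by (metis divide_divide_eq_right div_by_1 mult_1)
    thus ?thesis by blast
  qed simp
next
  fix z assume "z \<in> insert 0 (range (\<lambda>\<tau>. 1 / (1/2 + \<i> * complex_of_real \<tau>)))"
  then consider "z = 0" | \<tau> where "z = 1 / (1/2 + \<i> * of_real \<tau>)" by blast
  thus "z \<in> {z. cmod (z - 1) = 1}"
  proof cases
    case 2
    let ?w = "1/2 + \<i> * complex_of_real \<tau>"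
    have w: "?w \<noteq> 0" using symbol_denominator_ne_0[of 0 \<tau>] by simp
    have "1 / w - 1 = (1 - w) / w" if "w \<noteq> 0" for w :: complex
      using that by (simp add: diff_divide_distrib)
    from this[OF w] have "z - 1 = (1 - ?w) / ?w" using 2 by simp
    also have "1 - ?w = cnj ?w" by (simp add: complex_eq_iff)
    finally have "cmod (z - 1) = cmod (cnj ?w) / cmod ?w" by (simp only: norm_divide)
    thus ?thesis using w unfolding complex_mod_cnj by simp
  qed simp
qed

lemma spectrum_Tn_circle:
  assumes n: "n \<ge> 1"
  shows "spectrum_on L2 (Tn n) = rn n ` {z. cmod (z - 1) = 1}"
  using n unfolding spectrum_Tn[OF n] circle_inversion
  by (simp add: image_image symbol_eq_rn[OF n, symmetric, abs_def]) (simp add: rn_def power_0_left Suc_le_eq)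

theorem theorem7p9:
  fixes n :: nat
  assumes "n \<ge> 1"
  shows "normal_op (Tn n) \<and>
    spectrum_on L2 (Tn n) = rn n ` spectrum_on L2 (Tn 1) \<and>
    spectrum_on L2 (Tn n) = {rn n (1 + exp (\<i> * of_real \<theta>)) | \<theta>. \<theta> \<in> {0..2*pi}} \<and>
    spectrum_on L2 (Tn n) = sigma_ac (Tn n) \<and>
    point_spectrum (Tn n) = {} \<and> sigma_sc (Tn n) = {}"
proof (intro conjI)
  \<comment> \<open>The map \<open>rn 1\<close> is the identity, so the circle itself is the
    spectrum of \<open>Tn 1\<close>.\<close>
  have "spectrum_on L2 (Tn 1) = {z. cmod (z - 1) = 1}"
    unfolding spectrum_Tn_circle[OF order_refl] by (simp add: rn_def)
  thus "spectrum_on L2 (Tn n) = rn n ` spectrum_on L2 (Tn 1)"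
    using spectrum_Tn_circle[OF assms] by simp
  show "spectrum_on L2 (Tn n) = {rn n (1 + exp (\<i> * of_real \<theta>)) | \<theta>. \<theta> \<in> {0..2*pi}}"
    unfolding spectrum_Tn_circle[OF assms] circle_eq[symmetric] by blast
  show "spectrum_on L2 (Tn n) = sigma_ac (Tn n)" by (simp add: sigma_ac_def H_ac_Tn[OF assms])
qed (intro normal_Tn point_spectrum_Tn[OF assms] sigma_sc_Tn[OF assms])+

end
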